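(* Let $\Omega\subset\mathbb{R}^n$ be non-empty, open and bounded, and let $s\in\mathbb{R}$. Then the following three (mutually equivalent) statements hold if and only if $s$ is a non-negative integer: (i) the restriction operator $|_\Omega:\widetilde H^s(\Omega)\to H^s_0(\Omega)$ is a unitary isomorphism; (ii) $\big\|\phi|_\Omega\big\|_{H^s(\Omega)}=\|\phi\|_{H^s(\mathbb{R}^n)}$ for all $\phi\in\mathscr{D}(\Omega)$; (iii) $\mathscr{D}(\Omega)\subset (H^s_{\Omega^c})^\perp$.
   Context: Here $n\in\mathbb{N}$. $\mathscr{D}(\mathbb{R}^n)$ is the space of compactly supported smooth functions on $\mathbb{R}^n$; for open $\Omega\subset\mathbb{R}^n$, $\mathscr{D}(\Omega)=\{u\in\mathscr{D}(\mathbb{R}^n):\operatorname{supp}u\subset\Omega\}$. $\mathscr{D}^*(\Omega)$ is the space of distributions on $\Omega$ (anti-linear continuous functionals on $\mathscr{D}(\Omega)$), and $\mathscr{S}^*(\mathbb{R}^n)$ is the space of tempered distributions (anti-linear continuous functionals on the Schwartz space). The Fourier transform is $\hat u(\xi)=(2\pi)^{-n/2}\int_{\mathbb{R}^n}e^{-i\xi\cdot x}u(x)\,dx$, extended to $\mathscr{S}^*(\mathbb{R}^n)$. For $s\in\mathbb{R}$, $H^s(\mathbb{R}^n)$ is the Hilbert space of $u\in\mathscr{S}^*(\mathbb{R}^n)$ with $\|u\|_{H^s(\mathbb{R}^n)}^2=\int_{\mathbb{R}^n}(1+|\xi|^2)^s|\hat u(\xi)|^2\,d\xi<\infty$, with inner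 product $(u,v)_{H^s(\mathbb{R}^n)}=\int_{\mathbb{R}^n}(1+|\xi|^2)^s\hat u(\xi)\overline{\hat v(\xi)}\,d\xi$. For closed $F\subset\mathbb{R}^n$, $H^s_F=\{u\in H^s(\mathbb{R}^n):\operatorname{supp}u\subset F\}$; $\Omega^c=\mathbb{R}^n\setminus\Omega$, and $(H^s_{\Omega^c})^\perp$ is the orthogonal complement in $H^s(\mathbb{R}^n)$. $\widetilde H^s(\Omega)$ is the closure of $\mathscr{D}(\Omega)$ in $H^s(\mathbb{R}^n)$, with the inner product of $H^s(\mathbb{R}^n)$. $H^s(\Omega)=\{u\in\mathscr{D}^*(\Omega):u=U|_\Omega\text{ for some }U\in H^s(\mathbb{R}^n)\}$, where $U|_\Omega$ is the restriction of the distribution $U$ to $\Omega$, with norm $\|u\|_{H^s(\Omega)}=\min\{\|U\|_{H^s(\mathbb{R}^n)}:U\in H^s(\mathbb{R}^n),\ U|_\Omega=u\}$; it is a Hilbert space with inner product $(u,v)_{H^s(\Omega)}=(Q_sU,Q_sV)_{H^s(\mathbb{R}^n)}$, where $U|_\Omega=u$, $V|_\Omega=v$ and $Q_s$ is the orthogonal projection of $H^s(\mathbb{R}^n)$ onto $(H^s_{\Omega^c})^\perp$. $H^s_0(\Omega)$ is the closure of $\{\phi|_\Omega:\phi\in\mathscr{D}(\Omega)\}$ in $H^s(\Omega)$. A unitary isomorphism is a surjective linear isometry between Hilbert spaces. *)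

theory Defs
  imports "HOL-Analysis.Analysis"
begin

section \<open>Test functions and Schwartz functions\<close>

text \<open>
  Iterated partial derivatives are indexed by lists of coordinate directions instead of
  multi-indices. For smooth functions the order of the directions is irrelevant, so both
  conventions give the same family of derivatives.
\<close>

primrec partials :: "'n list \<Rightarrow> (real^'n \<Rightarrow> complex) \<Rightarrow> real^'n \<Rightarrow> complex" where
  "partials [] f = f"
| "partials (i # is) f = (\<lambda>x. frechet_derivative (partials is f) (at x) (axis i 1))"

definition smooth :: "(real^'n \<Rightarrow> complex) \<Rightarrow> bool" where
  "smooth f \<longleftrightarrow> (\<forall>is x. partials is f differentiable (at x))"

definition fun_supp :: "(real^'n \<Rightarrow> complex) \<Rightarrow> (real^'n) set" where
  "fun_supp f = closure {x. f x \<noteq> 0}"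

definition test_functions :: "(real^'n) set \<Rightarrow> (real^'n \<Rightarrow> complex) set" where
  "test_functions \<Omega> = {\<phi>. smooth \<phi> \<and> compact (fun_supp \<phi>) \<and> fun_supp \<phi> \<subseteq> \<Omega>}"

definition schwartz :: "(real^'n \<Rightarrow> complex) set" where
  "schwartz = {\<phi>. smooth \<phi> \<and>
     (\<forall>k is. bounded (range (\<lambda>x. (1 + norm x) ^ k *\<^sub>R partials is \<phi> x)))}"

definition converges_test ::
    "(real^'n) set \<Rightarrow> (nat \<Rightarrow> real^'n \<Rightarrow> complex) \<Rightarrow> (real^'n \<Rightarrow> complex) \<Rightarrow> bool" where
  "converges_test \<Omega> \<Phi> \<phi> \<longleftrightarrow>
     (\<forall>j. \<Phi> j \<in> test_functions \<Omega>) \<and> \<phi> \<in> test_functions \<Omega> \<and>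
     (\<exists>K. compact K \<and> K \<subseteq> \<Omega> \<and> (\<forall>j. fun_supp (\<Phi> j) \<subseteq> K)) \<and>
     (\<forall>is. uniform_limit UNIV (\<lambda>j. partials is (\<Phi> j)) (partials is \<phi>) sequentially)"

definition converges_schwartz ::
    "(nat \<Rightarrow> real^'n \<Rightarrow> complex) \<Rightarrow> (real^'n \<Rightarrow> complex) \<Rightarrow> bool" where
  "converges_schwartz \<Phi> \<phi> \<longleftrightarrow>
     (\<forall>j. \<Phi> j \<in> schwartz) \<and> \<phi> \<in> schwartz \<and>
     (\<forall>k is. uniform_limit UNIV (\<lambda>j x. (1 + norm x) ^ k *\<^sub>R partials is (\<Phi> j) x)
        (\<lambda>x. (1 + norm x) ^ k *\<^sub>R partials is \<phi> x) sequentially)"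

section \<open>Distributions\<close>

text \<open>
  A functional on a space \<open>A\<close> of functions is a total HOL function that vanishes outside \<open>A\<close>,
  so that equality of functionals on \<open>A\<close> is HOL equality and the vector space operations
  are the pointwise ones. Continuity is sequential continuity, which for linear and anti-linear
  functionals coincides with continuity in the usual topologies of the two function spaces.
\<close>

definition on_space :: "(real^'n \<Rightarrow> complex) set \<Rightarrow> ((real^'n \<Rightarrow> complex) \<Rightarrow> complex) \<Rightarrow>
    (real^'n \<Rightarrow> complex) \<Rightarrow> complex" where
  "on_space A u = (\<lambda>\<phi>. if \<phi> \<in> A then u \<phi> else 0)"

definition antilinear_on ::
    "(real^'n \<Rightarrow> complex) set \<Rightarrow> ((real^'n \<Rightarrow> complex) \<Rightarrow> complex) \<Rightarrow> bool" where
  "antilinear_on A u \<longleftrightarrow> (\<forall>\<phi>\<in>A. \<forall>\<psi>\<in>A. \<forall>a b.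
     u (\<lambda>x. a * \<phi> x + b * \<psi> x) = cnj a * u \<phi> + cnj b * u \<psi>)"

definition distributions :: "(real^'n) set \<Rightarrow> ((real^'n \<Rightarrow> complex) \<Rightarrow> complex) set" where
  "distributions \<Omega> = {u. (\<forall>\<phi>. \<phi> \<notin> test_functions \<Omega> \<longrightarrow> u \<phi> = 0) \<and>
     antilinear_on (test_functions \<Omega>) u \<and>
     (\<forall>\<Phi> \<phi>. converges_test \<Omega> \<Phi> \<phi> \<longrightarrow> (\<lambda>j. u (\<Phi> j)) \<longlonglongrightarrow> u \<phi>)}"

definition tempered :: "((real^'n \<Rightarrow> complex) \<Rightarrow> complex) set" where
  "tempered = {u. (\<forall>\<phi>. \<phi> \<notin> schwartz \<longrightarrow> u \<phi> = 0) \<and>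
     antilinear_on schwartz u \<and>
     (\<forall>\<Phi> \<phi>. converges_schwartz \<Phi> \<phi> \<longrightarrow> (\<lambda>j. u (\<Phi> j)) \<longlonglongrightarrow> u \<phi>)}"

definition restrict_dist :: "(real^'n) set \<Rightarrow> ((real^'n \<Rightarrow> complex) \<Rightarrow> complex) \<Rightarrow>
    (real^'n \<Rightarrow> complex) \<Rightarrow> complex" where
  "restrict_dist \<Omega> U = on_space (test_functions \<Omega>) U"

definition dist_supp :: "((real^'n \<Rightarrow> complex) \<Rightarrow> complex) \<Rightarrow> (real^'n) set" where
  "dist_supp u = - \<Union>{V. open V \<and> (\<forall>\<phi>\<in>test_functions V. u \<phi> = 0)}"

text \<open>The identification of a function with the anti-linear functional that it induces.\<close>

definition regular_dist :: "(real^'n \<Rightarrow> complex) \<Rightarrow> (real^'n \<Rightarrow> complex) \<Rightarrow> complex" where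
  "regular_dist f = on_space schwartz (\<lambda>\<psi>. \<integral>x. f x * cnj (\<psi> x) \<partial>lborel)"

section \<open>Fourier transform\<close>

definition fourier :: "(real^'n \<Rightarrow> complex) \<Rightarrow> real^'n \<Rightarrow> complex" where
  "fourier u \<xi> = (2 * pi) powr (- real CARD('n) / 2) *\<^sub>R
     (\<integral>x. exp (- \<i> * of_real (\<xi> \<bullet> x)) * u x \<partial>lborel)"

text \<open>
  For integrable \<open>u\<close> and Schwartz \<open>\<psi>\<close>, Fubini's theorem shows that the integral of
  \<open>fourier u\<close> times the conjugate of \<open>\<psi>\<close> equals the integral of \<open>u\<close> times the conjugate
  of \<open>x \<mapsto> fourier \<psi> (- x)\<close>. The extension to tempered distributions is dictated by this
  identity; the reflection is due to the functionals being anti-linear.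
\<close>

definition fourier_dist :: "((real^'n \<Rightarrow> complex) \<Rightarrow> complex) \<Rightarrow>
    (real^'n \<Rightarrow> complex) \<Rightarrow> complex" where
  "fourier_dist u = on_space schwartz (\<lambda>\<psi>. u (\<lambda>x. fourier \<psi> (- x)))"

definition is_density ::
    "((real^'n \<Rightarrow> complex) \<Rightarrow> complex) \<Rightarrow> (real^'n \<Rightarrow> complex) \<Rightarrow> bool" where
  "is_density v g \<longleftrightarrow> g \<in> borel_measurable lborel \<and>
     (\<forall>\<psi>\<in>schwartz. integrable lborel (\<lambda>\<xi>. g \<xi> * cnj (\<psi> \<xi>))) \<and> v = regular_dist g"

text \<open>
  The Fourier transform of \<open>u\<close> as a function, when it is one. It is determined almost
  everywhere, hence the integrals below do not depend on the choice.
\<close>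

definition fourier_fun :: "((real^'n \<Rightarrow> complex) \<Rightarrow> complex) \<Rightarrow> real^'n \<Rightarrow> complex" where
  "fourier_fun u = (SOME g. is_density (fourier_dist u) g)"

section \<open>Sobolev spaces on the whole space\<close>

definition sobolev :: "real \<Rightarrow> ((real^'n \<Rightarrow> complex) \<Rightarrow> complex) set" where
  "sobolev s = {u \<in> tempered. (\<exists>g. is_density (fourier_dist u) g) \<and>
     integrable lborel (\<lambda>\<xi>. (1 + (norm \<xi>)\<^sup>2) powr s * (cmod (fourier_fun u \<xi>))\<^sup>2)}"

definition sobolev_inner :: "real \<Rightarrow> ((real^'n \<Rightarrow> complex) \<Rightarrow> complex) \<Rightarrow>
    ((real^'n \<Rightarrow> complex) \<Rightarrow> complex) \<Rightarrow> complex" where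
  "sobolev_inner s u v =
     (\<integral>\<xi>. of_real ((1 + (norm \<xi>)\<^sup>2) powr s) * fourier_fun u \<xi> * cnj (fourier_fun v \<xi>) \<partial>lborel)"

definition sobolev_norm :: "real \<Rightarrow> ((real^'n \<Rightarrow> complex) \<Rightarrow> complex) \<Rightarrow> real" where
  "sobolev_norm s u =
     sqrt (\<integral>\<xi>. (1 + (norm \<xi>)\<^sup>2) powr s * (cmod (fourier_fun u \<xi>))\<^sup>2 \<partial>lborel)"

definition sobolev_supported ::
    "real \<Rightarrow> (real^'n) set \<Rightarrow> ((real^'n \<Rightarrow> complex) \<Rightarrow> complex) set" where
  "sobolev_supported s F = {u \<in> sobolev s. dist_supp u \<subseteq> F}"

definition sobolev_orth :: "real \<Rightarrow> ((real^'n \<Rightarrow> complex) \<Rightarrow> complex) set \<Rightarrow>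
    ((real^'n \<Rightarrow> complex) \<Rightarrow> complex) set" where
  "sobolev_orth s A = {u \<in> sobolev s. \<forall>v\<in>A. sobolev_inner s u v = 0}"

definition norm_closure :: "(((real^'n \<Rightarrow> complex) \<Rightarrow> complex) \<Rightarrow> real) \<Rightarrow>
    ((real^'n \<Rightarrow> complex) \<Rightarrow> complex) set \<Rightarrow> ((real^'n \<Rightarrow> complex) \<Rightarrow> complex) set \<Rightarrow>
    ((real^'n \<Rightarrow> complex) \<Rightarrow> complex) set" where
  "norm_closure N X A = {u \<in> X. \<forall>\<epsilon>>0. \<exists>a\<in>A. N (\<lambda>\<phi>. u \<phi> - a \<phi>) < \<epsilon>}"

definition sobolev_tilde ::
    "real \<Rightarrow> (real^'n) set \<Rightarrow> ((real^'n \<Rightarrow> complex) \<Rightarrow> complex) set" where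
  "sobolev_tilde s \<Omega> =
     norm_closure (sobolev_norm s) (sobolev s) (regular_dist ` test_functions \<Omega>)"

section \<open>Sobolev spaces on open sets\<close>

definition sobolev_on ::
    "real \<Rightarrow> (real^'n) set \<Rightarrow> ((real^'n \<Rightarrow> complex) \<Rightarrow> complex) set" where
  "sobolev_on s \<Omega> = {u \<in> distributions \<Omega>. \<exists>U\<in>sobolev s. u = restrict_dist \<Omega> U}"

text \<open>\<open>LEAST\<close> is the minimum, which is attained for every \<open>u \<in> sobolev_on s \<Omega>\<close>.\<close>

definition sobolev_on_norm ::
    "real \<Rightarrow> (real^'n) set \<Rightarrow> ((real^'n \<Rightarrow> complex) \<Rightarrow> complex) \<Rightarrow> real" where
  "sobolev_on_norm s \<Omega> u =
     (LEAST r. r \<in> {sobolev_norm s U | U. U \<in> sobolev s \<and> restrict_dist \<Omega> U = u})"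

definition sobolev_on_0 ::
    "real \<Rightarrow> (real^'n) set \<Rightarrow> ((real^'n \<Rightarrow> complex) \<Rightarrow> complex) set" where
  "sobolev_on_0 s \<Omega> = norm_closure (sobolev_on_norm s \<Omega>) (sobolev_on s \<Omega>)
     ((\<lambda>\<phi>. restrict_dist \<Omega> (regular_dist \<phi>)) ` test_functions \<Omega>)"

definition unitary_iso ::
    "((real^'n \<Rightarrow> complex) \<Rightarrow> complex) set \<Rightarrow> (((real^'n \<Rightarrow> complex) \<Rightarrow> complex) \<Rightarrow> real) \<Rightarrow>
     ((real^'n \<Rightarrow> complex) \<Rightarrow> complex) set \<Rightarrow> (((real^'n \<Rightarrow> complex) \<Rightarrow> complex) \<Rightarrow> real) \<Rightarrow>
     (((real^'n \<Rightarrow> complex) \<Rightarrow> complex) \<Rightarrow> (real^'n \<Rightarrow> complex) \<Rightarrow> complex) \<Rightarrow> bool" where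
  "unitary_iso X normX Y normY T \<longleftrightarrow>
     T ` X = Y \<and>
     (\<forall>u\<in>X. \<forall>v\<in>X. \<forall>a b. T (\<lambda>\<phi>. a * u \<phi> + b * v \<phi>) = (\<lambda>\<phi>. a * T u \<phi> + b * T v \<phi>)) \<and>
     (\<forall>u\<in>X. normY (T u) = normX u)"

end

theory Submission
  imports Defs "HOL-Probability.Probability" "HOL-Complex_Analysis.Complex_Analysis"
begin

text \<open>
  By Fourier inversion \<open>H\<^sup>s\<close> is a weighted \<open>L\<^sup>2\<close> space, hence complete, and every element of
  \<open>H\<^sup>s(\<Omega>)\<close> has a unique extension of minimal norm, namely the one in \<open>(H\<^sup>s\<^bsub>-\<Omega>\<^esub>)\<^sup>\<bottom>\<close>. So (ii)
  says that every test function is its own minimal extension, which is (iii), and (iii) passes to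
  closures and gives (i).

  For \<open>s = m \<in> \<nat>\<close> the product of \<open>(1 + |\<xi>|\<^sup>2)\<^sup>m\<close> with the transform of \<open>\<phi>\<close> is the transform of
  \<open>(1 - \<Delta>)\<^sup>m \<phi>\<close>, which is supported in \<open>\<Omega>\<close>, and (iii) follows. Conversely, take a bump
  \<open>\<phi> \<ge> 0\<close> in \<open>\<Omega>\<close>. By (iii) the inverse transform \<open>u\<close> of \<open>(1 + |\<xi>|\<^sup>2)\<^sup>s\<close> times the transform of
  \<open>\<phi>\<close> vanishes off the closure of \<open>\<Omega>\<close>. On a coordinate axis the transforms of \<open>\<phi>\<close> and \<open>u\<close>
  therefore extend to entire functions \<open>F\<close> and \<open>G\<close> with \<open>G(t) = (1 + t\<^sup>2)\<^sup>s F(t)\<close> for real \<open>t\<close>. As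
  \<open>F(\<i>) > 0\<close>, the order of the zero of \<open>G\<close> at \<open>\<i>\<close> is \<open>s\<close>.
\<close>

text \<open>The point \<open>\<i>\<close> is the branch point of (1 + z^2)^s. The argument therefore
  stays on the unit disc, where the principal logarithm of 1 + z^2 is holomorphic, and approaches
  \<open>\<i>\<close> from inside along the imaginary axis; only moduli are compared there, at
  distance x from \<open>\<i>\<close>. \<open>F\<close> is nonzero at \<open>\<i>\<close> because
  the kernel exp(-\<i> z x_j) becomes the positive function exp(x_j). Boundedness of \<Omega> gives
  \<open>u\<close> compact support, which makes \<open>G\<close> entire. It also makes the transform
  of the weighted function integrable, so that inversion applies: \<open>u\<close> is known only as
  an inverse transform and has to be transformed back. On the functional side, a Sobolev
  distribution carries its Fourier transform only as an arbitrarily chosen density. All Hilbert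
  space arguments are therefore made for actual functions in \<open>weighted_L2 s\<close> and
  carried over by \<open>fourier_synthesis\<close>; almost everywhere uniqueness of densities makes
  norms and inner products agree. A partition of unity turns the support condition into testing
  against functions on \<Omega>.\<close>

no_notation fps_nth (infixl "$" 75)

section \<open>Smooth and rapidly decreasing functions\<close>

abbreviation pd :: "'n \<Rightarrow> (real^'n \<Rightarrow> complex) \<Rightarrow> real^'n \<Rightarrow> complex" where
  "pd i f \<equiv> (\<lambda>x. frechet_derivative f (at x) (axis i 1))"

lemma pd_eqI: "(\<And>x. (f has_derivative f' x) (at x)) \<Longrightarrow> pd i f = (\<lambda>x. f' x (axis i 1))"
  using frechet_derivative_at by metis

lemma partials_append: "partials (is @ js) f = partials is (partials js f)"
  by (induction "is") auto

text \<open>\<open>partials\<close> prepends directions, so a set closed under every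
  \<open>pd\<close> contains all iterated derivatives of its members. Smoothness of sums, products
  and transforms is then shown by exhibiting such a set, without a formula for higher
  derivatives.\<close>

lemma smooth_coinduct:
  assumes "f \<in> S" "\<And>g x. g \<in> S \<Longrightarrow> g differentiable (at x)" "\<And>g i. g \<in> S \<Longrightarrow> pd i g \<in> S"
  shows "smooth f"
proof -
  have "partials is f \<in> S" for "is"
    using assms by (induction "is") auto
  then show ?thesis
    using assms(2) by (auto simp: smooth_def)
qed

lemma smooth_differentiable: "smooth f \<Longrightarrow> f differentiable (at x)"
  unfolding smooth_def by (metis partials.simps(1))

lemma smooth_has_derivative:
  "smooth f \<Longrightarrow> (f has_derivative frechet_derivative f (at x)) (at x)"
  using smooth_differentiable frechet_derivative_works by blast

lemma smooth_partials: "smooth f \<Longrightarrow> smooth (partials is f)"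
  unfolding smooth_def by (metis partials_append)

lemma smooth_pd: "smooth f \<Longrightarrow> smooth (pd i f)"
  using smooth_partials[of f "[i]"] by simp

lemma smooth_continuous: "smooth f \<Longrightarrow> continuous_on A f"
  by (meson continuous_at_imp_continuous_on differentiable_imp_continuous_within
      smooth_differentiable)

lemma smooth_measurable: "smooth f \<Longrightarrow> f \<in> borel_measurable borel"
  by (simp add: borel_measurable_continuous_onI smooth_continuous)

lemma pd_add:
  assumes "\<And>x. f differentiable (at x)" "\<And>x. g differentiable (at x)"
  shows "pd i (\<lambda>x. f x + g x) = (\<lambda>x. pd i f x + pd i g x)"
  by (rule pd_eqI) (use assms in \<open>auto intro!: derivative_intros simp: frechet_derivative_works\<close>)

lemma pd_mult:
  assumes "\<And>x. f differentiable (at x)" "\<And>x. g differentiable (at x)"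
  shows "pd i (\<lambda>x. f x * g x) = (\<lambda>x. f x * pd i g x + pd i f x * g x)"
  by (rule pd_eqI) (use assms in \<open>auto intro!: derivative_intros simp: frechet_derivative_works\<close>)

lemma has_derivative_coord:
  "((\<lambda>x::real^'n. complex_of_real (x $ j)) has_derivative (\<lambda>h. complex_of_real (h $ j))) (at x)"
  by (auto intro!: derivative_eq_intros bounded_linear_imp_has_derivative
      bounded_linear_compose[OF bounded_linear_of_real] bounded_linear_vec_nth)

lemma pd_coord: "pd i (\<lambda>x. complex_of_real (x $ j)) = (\<lambda>x. if j = i then 1 else 0)"
  by (subst pd_eqI[OF has_derivative_coord]) (auto simp: axis_def fun_eq_iff)

lemma smooth_const: "smooth (\<lambda>x. c)"
  by (rule smooth_coinduct[where S="range (\<lambda>c x. c)"]) (auto simp: frechet_derivative_const)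

lemma smooth_coord: "smooth (\<lambda>x::real^'n. complex_of_real (x $ j))"
proof (rule smooth_coinduct[where S="insert (\<lambda>x. complex_of_real (x $ j)) (range (\<lambda>c x. c))"])
  fix g i assume "g \<in> insert (\<lambda>x. complex_of_real (x $ j)) (range (\<lambda>c (x::real^'n). c))"
  then show "pd i g \<in> insert (\<lambda>x. complex_of_real (x $ j)) (range (\<lambda>c x. c))"
    by (auto simp: pd_coord frechet_derivative_const)
qed (auto intro: differentiableI has_derivative_coord)

text \<open>A single product is not stable under \<open>pd\<close>, but by the Leibniz rule sums of
  products of smooth functions are; this is the invariant for
  \<open>smooth_coinduct\<close>.\<close>

inductive_set smooth_algebra :: "(real^'n \<Rightarrow> complex) set" where
  base: "smooth f \<Longrightarrow> f \<in> smooth_algebra"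
| add: "f \<in> smooth_algebra \<Longrightarrow> g \<in> smooth_algebra \<Longrightarrow> (\<lambda>x. f x + g x) \<in> smooth_algebra"
| mult: "f \<in> smooth_algebra \<Longrightarrow> g \<in> smooth_algebra \<Longrightarrow> (\<lambda>x. f x * g x) \<in> smooth_algebra"

lemma smooth_algebra_smooth: "f \<in> smooth_algebra \<Longrightarrow> smooth f"
proof (erule smooth_coinduct)
  have *: "\<forall>x. g differentiable (at x)" if "g \<in> smooth_algebra" for g :: "real^'n \<Rightarrow> complex"
    using that by induction (auto simp: smooth_differentiable)
  then show "\<And>(g::real^'n \<Rightarrow> complex) x. g \<in> smooth_algebra \<Longrightarrow> g differentiable (at x)" by blast
  show "pd i g \<in> smooth_algebra" if "g \<in> smooth_algebra" for i and g :: "real^'n \<Rightarrow> complex"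
    using that
  proof induction
    case (base f)
    then show ?case by (simp add: smooth_algebra.base smooth_pd)
  next
    case (add f g)
    then show ?case using * by (subst pd_add) (blast, blast, rule smooth_algebra.add)
  next
    case (mult f g)
    have "(\<lambda>x. f x * pd i g x + pd i f x * g x) \<in> smooth_algebra"
      by (intro smooth_algebra.add smooth_algebra.mult mult)
    then show ?case using * mult by (subst pd_mult) auto
  qed
qed

lemma smooth_add: "smooth f \<Longrightarrow> smooth g \<Longrightarrow> smooth (\<lambda>x. f x + g x)"
  by (simp add: smooth_algebra.add smooth_algebra.base smooth_algebra_smooth)

lemma smooth_mult: "smooth f \<Longrightarrow> smooth g \<Longrightarrow> smooth (\<lambda>x. f x * g x)"
  by (simp add: smooth_algebra.mult smooth_algebra.base smooth_algebra_smooth)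

lemma smooth_scale: "smooth f \<Longrightarrow> smooth (\<lambda>x. c * f x)"
  by (simp add: smooth_const smooth_mult)

lemma smooth_diff: "smooth f \<Longrightarrow> smooth g \<Longrightarrow> smooth (\<lambda>x. f x - g x)"
  using smooth_add[OF _ smooth_scale[of g "-1"], of f] by simp

lemma smooth_sum: "(\<And>i. i \<in> I \<Longrightarrow> smooth (f i)) \<Longrightarrow> smooth (\<lambda>x. \<Sum>i\<in>I. f i x)"
  by (induction I rule: infinite_finite_induct) (auto simp: smooth_const smooth_add)

lemma smooth_prod: "(\<And>i. i \<in> I \<Longrightarrow> smooth (f i)) \<Longrightarrow> smooth (\<lambda>x. \<Prod>i\<in>I. f i x)"
  by (induction I rule: infinite_finite_induct) (auto simp: smooth_const smooth_mult)

lemma partials_lincomb: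
  assumes "smooth f" "smooth g"
  shows "partials is (\<lambda>x. a * f x + b * g x) = (\<lambda>x. a * partials is f x + b * partials is g x)"
proof (induction "is")
  case (Cons i "is")
  have "pd i (\<lambda>x. a * partials is f x + b * partials is g x)
      = (\<lambda>x. a * pd i (partials is f) x + b * pd i (partials is g) x)"
    by (rule pd_eqI)
       (use assms in \<open>auto intro!: derivative_eq_intros smooth_has_derivative smooth_partials\<close>)
  then show ?case using Cons by simp
qed auto

section \<open>Rapid decay and the Schwartz space\<close>

definition rapid :: "(real^'n \<Rightarrow> complex) \<Rightarrow> bool" where
  "rapid f \<longleftrightarrow> (\<forall>k. \<exists>C. \<forall>x. (1 + norm x) ^ k * cmod (f x) \<le> C)"

lemma bounded_range_weight:
  "bounded (range (\<lambda>x::real^'n. (1 + norm x) ^ k *\<^sub>R f x))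
    \<longleftrightarrow> (\<exists>C. \<forall>x. (1 + norm x) ^ k * cmod (f x) \<le> C)"
  by (auto simp: bounded_iff abs_mult)

lemma schwartz_iff: "f \<in> schwartz \<longleftrightarrow> smooth f \<and> (\<forall>is. rapid (partials is f))"
  unfolding schwartz_def rapid_def bounded_range_weight by auto

lemma schwartz_rapid: "f \<in> schwartz \<Longrightarrow> rapid f"
  by (metis schwartz_iff partials.simps(1))

lemma schwartz_smooth: "f \<in> schwartz \<Longrightarrow> smooth f"
  by (simp add: schwartz_iff)

lemma schwartz_coinduct:
  assumes "f \<in> S" "\<And>g x. g \<in> S \<Longrightarrow> g differentiable (at x)" "\<And>g i. g \<in> S \<Longrightarrow> pd i g \<in> S"
    "\<And>g. g \<in> S \<Longrightarrow> rapid g"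
  shows "f \<in> schwartz"
proof -
  have "partials is f \<in> S" for "is"
    using assms(1,3) by (induction "is") auto
  then show ?thesis
    using assms(4) smooth_coinduct[OF assms(1-3)] by (auto simp: schwartz_iff)
qed

text \<open>A factor of degree \<open>m\<close> uses up \<open>m\<close> of the arbitrarily many
  available powers of decay.\<close>

lemma rapid_bound:
  assumes "rapid g" "\<And>x. cmod (f x) \<le> B * (1 + norm x) ^ m * cmod (g x)"
  shows "rapid f"
  unfolding rapid_def
proof
  fix k
  obtain C where C: "\<And>x. (1 + norm x) ^ (k + m) * cmod (g x) \<le> C"
    using assms(1) unfolding rapid_def by blast
  have "(1 + norm x) ^ k * cmod (f x) \<le> \<bar>B\<bar> * C" for x
  proof -
    have "cmod (f x) \<le> \<bar>B\<bar> * (1 + norm x) ^ m * cmod (g x)"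
      by (rule order_trans[OF assms(2)]) (auto intro!: mult_right_mono)
    then have "(1 + norm x) ^ k * cmod (f x) \<le> (1 + norm x) ^ k * (\<bar>B\<bar> * (1 + norm x) ^ m * cmod (g x))"
      by (intro mult_left_mono) auto
    also have "\<dots> = \<bar>B\<bar> * ((1 + norm x) ^ (k + m) * cmod (g x))"
      by (simp add: power_add algebra_simps)
    also have "\<dots> \<le> \<bar>B\<bar> * C" using C by (intro mult_left_mono) auto
    finally show ?thesis .
  qed
  then show "\<exists>C. \<forall>x. (1 + norm x) ^ k * cmod (f x) \<le> C" by blast
qed

lemma rapid_add:
  fixes f g :: "real^'n \<Rightarrow> complex"
  assumes "rapid f" "rapid g"
  shows "rapid (\<lambda>x. f x + g x)"
  unfolding rapid_def
proof
  fix k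
  obtain C D where "\<And>x. (1 + norm x) ^ k * cmod (f x) \<le> C" "\<And>x. (1 + norm x) ^ k * cmod (g x) \<le> D"
    using assms unfolding rapid_def by metis
  moreover have "(1 + norm x) ^ k * cmod (f x + g x)
      \<le> (1 + norm x) ^ k * cmod (f x) + (1 + norm x) ^ k * cmod (g x)" for x :: "real^'n"
    using norm_triangle_ineq[of "f x" "g x"]
    by (metis distrib_left mult_left_mono zero_le_power add_nonneg_nonneg norm_ge_zero zero_le_one)
  ultimately show "\<exists>C. \<forall>x. (1 + norm x) ^ k * cmod (f x + g x) \<le> C"
    by (meson add_mono order_trans)
qed

lemma rapid_scale: "rapid f \<Longrightarrow> rapid (\<lambda>x. c * f x)"
  by (rule rapid_bound[of f _ "cmod c" 0]) (auto simp: norm_mult)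

lemma rapid_coord: "rapid f \<Longrightarrow> rapid (\<lambda>x. complex_of_real (x $ j) * f x)"
  by (rule rapid_bound[of f _ 1 1])
     (auto simp: norm_mult intro!: mult_right_mono order_trans[OF component_le_norm_cart])

lemma schwartz_pd: "f \<in> schwartz \<Longrightarrow> pd i f \<in> schwartz"
  unfolding schwartz_iff using smooth_pd[of f i] partials_append[of _ "[i]" f, symmetric] by simp

lemma schwartz_partials: "f \<in> schwartz \<Longrightarrow> partials is f \<in> schwartz"
  by (induction "is") (auto simp: schwartz_pd)

lemma schwartz_lincomb:
  "f \<in> schwartz \<Longrightarrow> g \<in> schwartz \<Longrightarrow> (\<lambda>x. a * f x + b * g x) \<in> schwartz"
  by (auto simp: schwartz_iff partials_lincomb intro!: smooth_add smooth_scale rapid_add rapid_scale)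

lemma schwartz_add: "f \<in> schwartz \<Longrightarrow> g \<in> schwartz \<Longrightarrow> (\<lambda>x. f x + g x) \<in> schwartz"
  using schwartz_lincomb[of f g 1 1] by simp

lemma schwartz_diff: "f \<in> schwartz \<Longrightarrow> g \<in> schwartz \<Longrightarrow> (\<lambda>x. f x - g x) \<in> schwartz"
  using schwartz_lincomb[of f g 1 "-1"] by simp

lemma schwartz_scale: "f \<in> schwartz \<Longrightarrow> (\<lambda>x. c * f x) \<in> schwartz"
  using schwartz_lincomb[of f f c 0] by simp

lemma schwartz_zero: "(\<lambda>x. 0) \<in> schwartz"
  by (rule schwartz_coinduct[where S="{\<lambda>x. 0}"]) (auto simp: frechet_derivative_const rapid_def)

inductive_set schwartz_coord_span :: "(real^'n \<Rightarrow> complex) set" where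
  base: "f \<in> schwartz \<Longrightarrow> f \<in> schwartz_coord_span"
| add: "f \<in> schwartz_coord_span \<Longrightarrow> g \<in> schwartz_coord_span \<Longrightarrow>
    (\<lambda>x. f x + g x) \<in> schwartz_coord_span"
| coord: "f \<in> schwartz_coord_span \<Longrightarrow> (\<lambda>x. complex_of_real (x $ j) * f x) \<in> schwartz_coord_span"

lemma schwartz_coord_span_schwartz: "f \<in> schwartz_coord_span \<Longrightarrow> f \<in> schwartz"
proof (erule schwartz_coinduct)
  have sm: "smooth g" if "g \<in> schwartz_coord_span" for g :: "real^'n \<Rightarrow> complex"
    using that by induction (auto intro!: smooth_add smooth_mult[OF smooth_coord] dest: schwartz_smooth)
  then have *: "\<forall>x. g differentiable (at x)" if "g \<in> schwartz_coord_span" for g :: "real^'n \<Rightarrow> complex"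
    using that smooth_differentiable by blast
  then show "\<And>(g::real^'n \<Rightarrow> complex) x. g \<in> schwartz_coord_span \<Longrightarrow> g differentiable (at x)" by blast
  show "rapid g" if "g \<in> schwartz_coord_span" for g :: "real^'n \<Rightarrow> complex"
    using that by induction (auto intro!: rapid_add rapid_coord dest: schwartz_rapid)
  show "pd i g \<in> schwartz_coord_span" if "g \<in> schwartz_coord_span" for i and g :: "real^'n \<Rightarrow> complex"
    using that
  proof induction
    case (base f)
    then show ?case by (simp add: schwartz_coord_span.base schwartz_pd)
  next
    case (add f g)
    then show ?case using * by (subst pd_add) (blast, blast, rule schwartz_coord_span.add)
  next
    case (coord f j)
    have "(\<lambda>x. complex_of_real (x $ j) * pd i f x + (if j = i then 1 else 0) * f x)
        \<in> schwartz_coord_span"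
    proof (intro schwartz_coord_span.add schwartz_coord_span.coord coord)
      show "(\<lambda>x. (if j = i then 1 else 0) * f x) \<in> schwartz_coord_span"
        using coord schwartz_coord_span.base[OF schwartz_zero] by (cases "j = i") auto
    qed
    moreover have "pd i (\<lambda>x. complex_of_real (x $ j) * f x)
        = (\<lambda>x. complex_of_real (x $ j) * pd i f x + pd i (\<lambda>x. complex_of_real (x $ j)) x * f x)"
      by (rule pd_mult) (use * coord smooth_coord[THEN smooth_differentiable] in auto)
    ultimately show ?case by (simp only: fun_cong[OF pd_coord])
  qed
qed

lemma schwartz_coord: "f \<in> schwartz \<Longrightarrow> (\<lambda>x. complex_of_real (x $ j) * f x) \<in> schwartz"
  by (simp add: schwartz_coord_span.base schwartz_coord_span.coord schwartz_coord_span_schwartz)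

lemma pd_reflect:
  assumes "\<And>x. f differentiable (at x)"
  shows "pd i (\<lambda>x. f (- x)) = (\<lambda>x. - pd i f (- x))"
proof (rule pd_eqI[THEN trans])
  show "((\<lambda>x. f (- x)) has_derivative (\<lambda>h. frechet_derivative f (at (- x)) (- h))) (at x)" for x
    using has_derivative_compose[of "\<lambda>x. - x" "\<lambda>h. - h" x UNIV f "frechet_derivative f (at (- x))"]
      assms by (auto simp: frechet_derivative_works intro: derivative_intros)
  show "(\<lambda>x. frechet_derivative f (at (- x)) (- axis i 1)) = (\<lambda>x. - pd i f (- x))"
    using assms[unfolded frechet_derivative_works, THEN has_derivative_linear, THEN linear_neg] by simp
qed

lemma rapid_reflect: "rapid f \<Longrightarrow> rapid (\<lambda>x. f (- x))"
  unfolding rapid_def by (metis norm_minus_cancel)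

lemma schwartz_reflect:
  fixes f :: "real^'n \<Rightarrow> complex"
  assumes "f \<in> schwartz" shows "(\<lambda>x. f (- x)) \<in> schwartz"
proof (rule schwartz_coinduct[where S="(\<lambda>f x. f (- x)) ` schwartz"])
  show "(\<lambda>x. f (- x)) \<in> (\<lambda>f x. f (- x)) ` schwartz" using assms by blast
  show "g differentiable (at x)" if g: "g \<in> (\<lambda>f x. f (- x)) ` schwartz" for g and x :: "real^'n"
  proof -
    obtain f where f: "f \<in> schwartz" "g = (\<lambda>x. f (- x))" using g by (rule imageE)
    show ?thesis unfolding f(2)
      by (rule differentiable_compose[of f])
         (use f in \<open>auto simp: schwartz_smooth smooth_differentiable\<close>)
  qed
  show "pd i g \<in> (\<lambda>f x. f (- x)) ` schwartz"
    if g: "g \<in> (\<lambda>f x. f (- x)) ` schwartz" for i and g :: "real^'n \<Rightarrow> complex"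
  proof -
    obtain f where f: "f \<in> schwartz" "g = (\<lambda>x. f (- x))" using g by (rule imageE)
    have "pd i g = (\<lambda>x. (\<lambda>y. (- 1) * pd i f y) (- x))"
      unfolding f(2) using pd_reflect[OF smooth_differentiable[OF schwartz_smooth[OF f(1)]], of i]
      by simp
    moreover have "(\<lambda>y. (- 1) * pd i f y) \<in> schwartz"
      by (intro schwartz_scale schwartz_pd f)
    ultimately show ?thesis by (rule image_eqI)
  qed
  show "rapid g" if "g \<in> (\<lambda>f x. f (- x)) ` schwartz" for g :: "real^'n \<Rightarrow> complex"
    using that by (rule imageE) (simp add: rapid_reflect schwartz_rapid)
qed

section \<open>Test functions\<close>

lemma closed_fun_supp: "closed (fun_supp f)"
  by (simp add: fun_supp_def)

lemma fun_supp_subset: "closed F \<Longrightarrow> (\<And>x. x \<notin> F \<Longrightarrow> f x = 0) \<Longrightarrow> fun_supp f \<subseteq> F"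
  unfolding fun_supp_def by (rule closure_minimal) auto

lemma not_in_fun_supp: "x \<notin> fun_supp f \<Longrightarrow> f x = 0"
  unfolding fun_supp_def using closure_subset[of "{x. f x \<noteq> 0}"] by auto

lemma test_functionsI:
  assumes "smooth f" "compact K" "K \<subseteq> \<Omega>" "\<And>x. x \<notin> K \<Longrightarrow> f x = 0"
  shows "f \<in> test_functions \<Omega>"
proof -
  have "fun_supp f \<subseteq> K" using assms by (simp add: compact_imp_closed fun_supp_subset)
  then show ?thesis unfolding test_functions_def using assms
    by (metis (mono_tags) bounded_subset closed_fun_supp compact_eq_bounded_closed
        mem_Collect_eq subset_trans)
qed

lemma test_functionsD:
  assumes "f \<in> test_functions \<Omega>"
  shows "smooth f" "compact (fun_supp f)" "fun_supp f \<subseteq> \<Omega>" "\<And>x. x \<notin> \<Omega> \<Longrightarrow> f x = 0"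
  using assms not_in_fun_supp unfolding test_functions_def by blast+

lemma test_functions_mono: "A \<subseteq> B \<Longrightarrow> test_functions A \<subseteq> test_functions B"
  by (auto simp: test_functions_def)

lemma pd_eq_0:
  assumes "closed F" "\<And>x. x \<notin> F \<Longrightarrow> f x = 0" "x \<notin> F"
  shows "pd i f x = 0"
proof -
  have "((\<lambda>x. 0) has_derivative (\<lambda>h. 0)) (at x)" by simp
  then have "(f has_derivative (\<lambda>h. 0)) (at x)"
    by (rule has_derivative_transform_within_open[of _ _ _ _ "- F"])
       (use assms in auto)
  then show ?thesis by (simp add: frechet_derivative_at[symmetric])
qed

lemma test_functions_pd: 
  assumes "f \<in> test_functions \<Omega>" shows "pd i f \<in> test_functions \<Omega>"
  using assms pd_eq_0[OF closed_fun_supp not_in_fun_supp, of f]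
  by (intro test_functionsI[of _ "fun_supp f"]) (auto dest: test_functionsD intro: smooth_pd)

lemma test_functions_lincomb:
  assumes "f \<in> test_functions \<Omega>" "g \<in> test_functions \<Omega>"
  shows "(\<lambda>x. a * f x + b * g x) \<in> test_functions \<Omega>"
  using assms
  by (intro test_functionsI[of _ "fun_supp f \<union> fun_supp g"])
     (auto dest: test_functionsD intro!: smooth_add smooth_scale simp: not_in_fun_supp)

lemma test_functions_mult:
  assumes "f \<in> test_functions \<Omega>" "smooth g"
  shows "(\<lambda>x. f x * g x) \<in> test_functions \<Omega>"
  using assms
  by (intro test_functionsI[of _ "fun_supp f"])
     (auto dest: test_functionsD intro!: smooth_mult simp: not_in_fun_supp)

lemma rapid_compact_support:
  assumes "continuous_on UNIV f" "compact K" "\<And>x. x \<notin> K \<Longrightarrow> f x = 0"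
  shows "rapid f"
  unfolding rapid_def
proof
  fix k
  have "compact ((\<lambda>x. (1 + norm x) ^ k * cmod (f x)) ` K)"
    by (intro compact_continuous_image continuous_intros continuous_on_subset[OF assms(1)] assms) auto
  then obtain C where C: "\<And>x. x \<in> K \<Longrightarrow> (1 + norm x) ^ k * cmod (f x) \<le> C"
    unfolding bounded_iff by (metis (mono_tags) abs_le_D1 bounded_iff compact_imp_bounded image_eqI real_norm_def)
  have "(1 + norm x) ^ k * cmod (f x) \<le> max C 0" for x
    using C[of x] assms(3)[of x] by (cases "x \<in> K") auto
  then show "\<exists>C. \<forall>x. (1 + norm x) ^ k * cmod (f x) \<le> C" by blast
qed

text \<open>The space of test functions is closed under \<open>pd\<close>, so it is itself the
  invariant for \<open>schwartz_coinduct\<close>.\<close>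

lemma test_functions_subset_schwartz: "test_functions (\<Omega> :: (real^'n) set) \<subseteq> schwartz"
proof
  fix f :: "real^'n \<Rightarrow> complex" assume "f \<in> test_functions \<Omega>"
  then show "f \<in> schwartz"
    by (rule schwartz_coinduct)
       (auto simp: test_functions_pd smooth_differentiable test_functionsD(1)
         intro: rapid_compact_support[OF smooth_continuous test_functionsD(2) not_in_fun_supp])
qed

lemmas test_functions_schwartz = subsetD[OF test_functions_subset_schwartz]

section \<open>Integrals over Euclidean space\<close>

text \<open>\<open>lborel\<close> on \<open>real^'n\<close> is the image of a product measure
  indexed by \<open>Basis\<close>, whereas the factors \<open>h\<close> are indexed by
  \<open>'n\<close>. The bijection \<open>axis i 1\<close> between the two index sets turns Fubini
  for product measures into the coordinate form.\<close>

lemma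
  fixes h :: "'n::finite \<Rightarrow> real \<Rightarrow> 'b::{real_normed_field,banach,second_countable_topology}"
  assumes h: "\<And>i. integrable lborel (h i)"
  shows integrable_prod_coord: "integrable lborel (\<lambda>x::real^'n. \<Prod>i\<in>UNIV. h i (x $ i))"
    and integral_prod_coord:
      "(\<integral>(x::real^'n). (\<Prod>i\<in>UNIV. h i (x $ i)) \<partial>lborel) = (\<Prod>i\<in>UNIV. integral\<^sup>L lborel (h i))"
proof -
  interpret product_sigma_finite "\<lambda>_::real^'n. lborel :: real measure" ..
  let ?e = "\<lambda>i::'n. axis i (1::real)"
  have Basis: "(Basis :: (real^'n) set) = range ?e"
    by (auto simp: Basis_vec_def)
  have inj: "inj ?e" by (auto simp: inj_on_def axis_eq_axis)
  define H where "H b = h (inv ?e b)" for b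
  have He: "H (?e i) = h i" for i unfolding H_def using inv_f_f[OF inj] by simp
  have comp: "(\<Sum>b\<in>Basis. f b *\<^sub>R b) $ i = f (?e i)" for f :: "real^'n \<Rightarrow> real" and i
    unfolding Basis sum.reindex[OF inj]
    by (simp add: sum_component axis_def if_distrib[of "\<lambda>x. _ * x"] cong: if_cong)
  have eq: "(\<Prod>i\<in>UNIV. h i ((\<Sum>b\<in>Basis. f b *\<^sub>R b) $ i)) = (\<Prod>b\<in>Basis. H b (f b))" for f
    unfolding comp unfolding Basis prod.reindex[OF inj] by (simp add: He)
  have [measurable]: "h i \<in> borel_measurable borel" for i
    using h[of i] by (simp add: borel_measurable_integrable)
  have HI: "integrable lborel (H b)" for b using h by (simp add: H_def)
  have m1: "(\<lambda>f. \<Sum>b\<in>Basis. f b *\<^sub>R b :: real^'n) \<in> (\<Pi>\<^sub>M b\<in>Basis. lborel) \<rightarrow>\<^sub>M borel"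
    by measurable
  have m2: "(\<lambda>x::real^'n. \<Prod>i\<in>UNIV. h i (x $ i)) \<in> borel_measurable borel"
    by measurable
  show "integrable lborel (\<lambda>x::real^'n. \<Prod>i\<in>UNIV. h i (x $ i))"
    unfolding lborel_eq[where 'a="real^'n"] integrable_distr_eq[OF m1 m2] eq
    by (intro product_integrable_prod HI finite_Basis)
  have "(\<integral>(x::real^'n). (\<Prod>i\<in>UNIV. h i (x $ i)) \<partial>lborel) = (\<Prod>b\<in>Basis. integral\<^sup>L lborel (H b))"
    unfolding lborel_eq[where 'a="real^'n"] integral_distr[OF m1 m2] eq
    by (intro product_integral_prod HI finite_Basis)
  also have "\<dots> = (\<Prod>i\<in>UNIV. integral\<^sup>L lborel (h i))"
    unfolding Basis prod.reindex[OF inj] by (simp add: He)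
  finally show "(\<integral>(x::real^'n). (\<Prod>i\<in>UNIV. h i (x $ i)) \<partial>lborel) = (\<Prod>i\<in>UNIV. integral\<^sup>L lborel (h i))" .
qed

text \<open>The exponent is twice the dimension because (1 + |x|)^2 dominates each 1 + x_i^2: the
  weight is then at most the product of the one-dimensional integrable functions 1 / (1 +
  x_i^2).\<close>

definition decay_weight :: "real^'n \<Rightarrow> real" where
  "decay_weight x = inverse ((1 + norm x) ^ (2 * CARD('n)))"

lemma decay_weight_pos: "0 < decay_weight x"
  unfolding decay_weight_def by (simp add: add_pos_nonneg)

lemma decay_weight_measurable [measurable]: "decay_weight \<in> borel_measurable borel"
  unfolding decay_weight_def by measurable

lemma integrable_decay_weight: "integrable lborel (decay_weight :: real^'n \<Rightarrow> real)"
proof (rule Bochner_Integration.integrable_bound)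
  have "integrable lborel (\<lambda>x::real. inverse (1 + x\<^sup>2))"
    using integrable_inverse_1_plus_square by (simp add: set_integrable_def)
  then show "integrable lborel (\<lambda>x::real^'n. \<Prod>i\<in>UNIV. inverse (1 + (x $ i)\<^sup>2))"
    by (rule integrable_prod_coord)
  have "(\<Prod>i\<in>UNIV. 1 + (x $ i)\<^sup>2) \<le> (\<Prod>i\<in>(UNIV::'n set). (1 + norm x)\<^sup>2)" for x :: "real^'n"
  proof (rule prod_mono, safe)
    fix i
    have "(x $ i)\<^sup>2 \<le> (norm x)\<^sup>2" using component_le_norm_cart[of x i] abs_le_square_iff
      by (metis abs_norm_cancel)
    then show "1 + (x $ i)\<^sup>2 \<le> (1 + norm x)\<^sup>2" by (simp add: power2_sum add_increasing2)
  qed (simp add: add_nonneg_nonneg)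
  then have "(\<Prod>i\<in>UNIV. 1 + (x $ i)\<^sup>2) \<le> (1 + norm x) ^ (2 * CARD('n))" for x :: "real^'n"
    by (simp add: power_mult)
  moreover have "0 < (\<Prod>i\<in>UNIV. 1 + (x $ i)\<^sup>2)" for x :: "real^'n"
    by (intro prod_pos) (simp add: add_pos_nonneg)
  ultimately have le: "decay_weight x \<le> (\<Prod>i\<in>UNIV. inverse (1 + (x $ i)\<^sup>2))" for x :: "real^'n"
    unfolding decay_weight_def prod_inversef[unfolded o_def] by (intro le_imp_inverse_le) auto
  then show "AE x::real^'n in lborel. norm (decay_weight x) \<le> norm (\<Prod>i\<in>UNIV. inverse (1 + (x $ i)\<^sup>2))" 
    using order_trans[OF le abs_ge_self] by (intro AE_I2) (simp add: abs_of_pos[OF decay_weight_pos])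
qed measurable

lemma le_decay_weight:
  fixes x :: "real^'n"
  shows "(1 + norm x) ^ (2 * CARD('n)) * a \<le> C \<Longrightarrow> a \<le> C * decay_weight x"
  unfolding decay_weight_def
  by (simp add: field_simps add_pos_nonneg)

lemma rapid_integrable:
  fixes f :: "real^'n \<Rightarrow> complex"
  assumes "rapid f" "f \<in> borel_measurable borel"
  shows "integrable lborel f"
proof -
  obtain C where "\<And>x. (1 + norm x) ^ (2 * CARD('n)) * cmod (f x) \<le> C"
    using assms(1) unfolding rapid_def by blast
  then have C: "\<And>x. cmod (f x) \<le> C * decay_weight x" by (rule le_decay_weight)
  have "integrable lborel (\<lambda>x::real^'n. C * decay_weight x)"
    by (intro integrable_mult_right integrable_decay_weight)
  then show ?thesis
    by (rule Bochner_Integration.integrable_bound)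
       (use assms C in \<open>auto intro!: AE_I2 order_trans[OF _ abs_ge_self]\<close>)
qed

lemma schwartz_measurable: "f \<in> schwartz \<Longrightarrow> f \<in> borel_measurable borel"
  by (simp add: schwartz_smooth smooth_measurable)

lemma schwartz_integrable: "f \<in> schwartz \<Longrightarrow> integrable lborel f"
  by (simp add: rapid_integrable schwartz_measurable schwartz_rapid)

section \<open>The Fourier transform\<close>

abbreviation fourier_factor :: "'n itself \<Rightarrow> real" where
  "fourier_factor _ \<equiv> (2 * pi) powr (- real CARD('n) / 2)"

lemma integrable_exp_mult:
  fixes f :: "real^'n \<Rightarrow> complex"
  assumes "integrable lborel f"
  shows "integrable lborel (\<lambda>x. exp (- \<i> * of_real (\<xi> \<bullet> x)) * f x)"
  by (rule Bochner_Integration.integrable_bound[OF assms])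
     (use assms in \<open>auto simp: norm_mult\<close>)

lemma fourier_lincomb:
  assumes "integrable lborel f" "integrable lborel g"
  shows "fourier (\<lambda>x. a * f x + b * g x) \<xi> = a * fourier f \<xi> + b * fourier g \<xi>"
proof -
  have "(\<integral>x. exp (- \<i> * of_real (\<xi> \<bullet> x)) * (a * f x + b * g x) \<partial>lborel)
      = (\<integral>x. a * (exp (- \<i> * of_real (\<xi> \<bullet> x)) * f x) + b * (exp (- \<i> * of_real (\<xi> \<bullet> x)) * g x) \<partial>lborel)"
    by (simp add: algebra_simps)
  also have "\<dots> = a * (\<integral>x. exp (- \<i> * of_real (\<xi> \<bullet> x)) * f x \<partial>lborel)
      + b * (\<integral>x. exp (- \<i> * of_real (\<xi> \<bullet> x)) * g x \<partial>lborel)"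
    using assms[THEN integrable_exp_mult] by (subst Bochner_Integration.integral_add) auto
  finally show ?thesis
    by (simp add: fourier_def scaleR_conv_of_real algebra_simps)
qed

lemma fourier_diff:
  "integrable lborel f \<Longrightarrow> integrable lborel g \<Longrightarrow>
    fourier (\<lambda>x. f x - g x) \<xi> = fourier f \<xi> - fourier g \<xi>"
  using fourier_lincomb[of f g 1 "-1"] by simp

lemma fourier_bound:
  fixes f :: "real^'n \<Rightarrow> complex"
  assumes "integrable lborel f"
  shows "cmod (fourier f \<xi>) \<le> fourier_factor TYPE('n) * (\<integral>x. cmod (f x) \<partial>lborel)"
proof -
  have "cmod (\<integral>x. exp (- \<i> * of_real (\<xi> \<bullet> x)) * f x \<partial>lborel)
      \<le> (\<integral>x. cmod (exp (- \<i> * of_real (\<xi> \<bullet> x)) * f x) \<partial>lborel)"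
    by (rule integral_norm_bound)
  then show ?thesis
    by (simp add: fourier_def norm_mult mult_left_mono)
qed

lemma fourier_continuous:
  fixes f :: "real^'n \<Rightarrow> complex"
  assumes "integrable lborel f"
  shows "continuous_on A (fourier f)"
proof (rule continuous_at_imp_continuous_on, rule ballI)
  fix \<xi>
  have [measurable]: "f \<in> borel_measurable borel" using assms by auto
  have "(\<lambda>k. \<integral>x. exp (- \<i> * of_real (X k \<bullet> x)) * f x \<partial>lborel)
      \<longlonglongrightarrow> (\<integral>x. exp (- \<i> * of_real (\<xi> \<bullet> x)) * f x \<partial>lborel)" if "X \<longlonglongrightarrow> \<xi>" for X :: "nat \<Rightarrow> real^'n"
    by (rule integral_dominated_convergence[where w="\<lambda>x. cmod (f x)"])
       (use assms that in \<open>auto simp: norm_mult intro!: tendsto_intros\<close>)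
  then show "isCont (fourier f) \<xi>"
    unfolding continuous_at_sequentially fourier_def o_def by (auto intro!: tendsto_intros)
qed

lemma fourier_measurable: "integrable lborel f \<Longrightarrow> fourier f \<in> borel_measurable borel"
  by (simp add: borel_measurable_continuous_onI fourier_continuous)

text \<open>Covers translation (\<open>c = 1\<close>), reflection (\<open>c = -1\<close>) and
  dilation at once; both the vanishing of integrals of derivatives and Fourier inversion rest on
  it.\<close>

lemma
  fixes f :: "real^'n \<Rightarrow> complex"
  assumes [measurable]: "f \<in> borel_measurable borel" and c: "c \<noteq> 0"
  shows integral_lborel_affine:
      "(\<integral>x. f x \<partial>lborel) = (\<bar>c\<bar> ^ CARD('n)) *\<^sub>R (\<integral>x. f (t + c *\<^sub>R x) \<partial>lborel)"
    and integrable_lborel_affine: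
      "integrable lborel (\<lambda>x. f (t + c *\<^sub>R x)) \<longleftrightarrow> integrable lborel f"
proof -
  have eq: "lborel = density (distr lborel borel (\<lambda>x::real^'n. t + c *\<^sub>R x)) (\<lambda>_. ennreal (\<bar>c\<bar> ^ CARD('n)))"
    using lborel_affine[OF c, of t] by (simp add: ennreal_power)
  show "(\<integral>x. f x \<partial>lborel) = (\<bar>c\<bar> ^ CARD('n)) *\<^sub>R (\<integral>x. f (t + c *\<^sub>R x) \<partial>lborel)"
    by (subst eq, subst integral_density) (auto simp: integral_distr)
  have "integrable lborel f \<longleftrightarrow> integrable lborel (\<lambda>x. (\<bar>c\<bar> ^ CARD('n)) *\<^sub>R f (t + c *\<^sub>R x))"
    by (subst eq, subst integrable_density) (auto simp: integrable_distr_eq)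
  also have "\<dots> \<longleftrightarrow> integrable lborel (\<lambda>x. f (t + c *\<^sub>R x))"
  proof
    assume "integrable lborel (\<lambda>x. (\<bar>c\<bar> ^ CARD('n)) *\<^sub>R f (t + c *\<^sub>R x))"
    then have "integrable lborel (\<lambda>x. inverse (\<bar>c\<bar> ^ CARD('n)) *\<^sub>R ((\<bar>c\<bar> ^ CARD('n)) *\<^sub>R f (t + c *\<^sub>R x)))"
      by (rule integrable_scaleR_right)
    then show "integrable lborel (\<lambda>x. f (t + c *\<^sub>R x))" using c by simp
  qed (rule integrable_scaleR_right)
  finally show "integrable lborel (\<lambda>x. f (t + c *\<^sub>R x)) \<longleftrightarrow> integrable lborel f" ..
qed

lemma fourier_reflect:
  fixes f :: "real^'n \<Rightarrow> complex"
  assumes [measurable]: "f \<in> borel_measurable borel"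
  shows "fourier (\<lambda>x. f (- x)) \<xi> = fourier f (- \<xi>)"
  unfolding fourier_def
  by (subst integral_lborel_affine[where c="-1" and t=0]) auto

lemma cnj_fourier:
  "cnj (fourier f \<xi>) = fourier (\<lambda>x. cnj (f x)) (- \<xi>)"
proof -
  have "cnj (\<integral>x. exp (- \<i> * of_real (\<xi> \<bullet> x)) * f x \<partial>lborel)
      = (\<integral>x. cnj (exp (- \<i> * of_real (\<xi> \<bullet> x)) * f x) \<partial>lborel)"
    by (rule Bochner_Integration.integral_cnj[symmetric])
  then show ?thesis by (simp add: fourier_def exp_cnj)
qed

text \<open>The kernel is symmetric in its two arguments, so Fubini's theorem exchanges the roles of
  \<open>f\<close> and \<open>g\<close>.\<close>

lemma fourier_mult_swap:
  fixes f g :: "real^'n \<Rightarrow> complex"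
  assumes f: "integrable lborel f" and g: "integrable lborel g"
  shows "(\<integral>x. fourier f x * g x \<partial>lborel) = (\<integral>x. f x * fourier g x \<partial>lborel)"
proof -
  have [measurable]: "f \<in> borel_measurable borel" "g \<in> borel_measurable borel" using f g by auto
  let ?h = "\<lambda>x y. exp (- \<i> * of_real (x \<bullet> y)) * f y * g x"
  have "integrable (lborel \<Otimes>\<^sub>M lborel) (\<lambda>(x, y). ?h x y)"
  proof (rule lborel_pair.Fubini_integrable)
    show "(\<lambda>(x, y). ?h x y) \<in> borel_measurable (lborel \<Otimes>\<^sub>M lborel)" by measurable
    show "integrable lborel (\<lambda>x. \<integral>y. norm (case (x, y) of (x, y) \<Rightarrow> ?h x y) \<partial>lborel)"
      using g by (simp add: norm_mult)
    show "AE x in lborel. integrable lborel (\<lambda>y. case (x, y) of (x, y) \<Rightarrow> ?h x y)"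
      using integrable_exp_mult[OF f] by simp
  qed
  then have "(\<integral>y. (\<integral>x. ?h x y \<partial>lborel) \<partial>lborel) = (\<integral>x. (\<integral>y. ?h x y \<partial>lborel) \<partial>lborel)"
    by (rule lborel_pair.Fubini_integral)
  moreover have "(\<integral>x. ?h x y \<partial>lborel) = f y * (\<integral>x. exp (- \<i> * of_real (y \<bullet> x)) * g x \<partial>lborel)" for y
    by (simp add: inner_commute[of y] mult.assoc mult.left_commute[of _ "f y"])
  ultimately have "(\<integral>x. (\<integral>y. exp (- \<i> * of_real (x \<bullet> y)) * f y \<partial>lborel) * g x \<partial>lborel)
      = (\<integral>y. f y * (\<integral>x. exp (- \<i> * of_real (y \<bullet> x)) * g x \<partial>lborel) \<partial>lborel)"
    by simp
  then show ?thesis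
    by (simp add: fourier_def)
qed

text \<open>Conjugation passes to the kernel and changes its sign, whence the argument
  \<open>- x\<close>; the same reflection occurs in \<open>fourier_dist\<close>.\<close>

lemma fourier_parseval:
  fixes f g :: "real^'n \<Rightarrow> complex"
  assumes f: "integrable lborel f" and g: "integrable lborel g"
  shows "(\<integral>x. fourier f x * cnj (g x) \<partial>lborel) = (\<integral>x. f x * cnj (fourier g (- x)) \<partial>lborel)"
  using fourier_mult_swap[OF f Bochner_Integration.integrable_cnj[OF g]] by (simp add: cnj_fourier)

section \<open>The Fourier transform of Schwartz functions\<close>

lemma schwartz_weight_integrable:
  assumes "f \<in> schwartz" "g \<in> borel_measurable borel"
    "\<And>x. cmod (g x) \<le> B * (1 + norm x) ^ m * cmod (f x)"
  shows "integrable lborel g"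
  by (rule rapid_integrable[OF rapid_bound[OF schwartz_rapid]]) (use assms in auto)

text \<open>\<open>smooth\<close> asks for total derivatives, so the integral is differentiated with
  an explicit remainder: the first-order Taylor error of the kernel is quadratic in the increment,
  and Schwartz decay makes |x|^2 |f(x)| integrable.\<close>

lemma fourier_has_derivative:
  fixes f :: "real^'n \<Rightarrow> complex"
  assumes f: "f \<in> schwartz"
  shows "(fourier f has_derivative (\<lambda>h. fourier (\<lambda>x. - \<i> * of_real (h \<bullet> x) * f x) \<xi>)) (at \<xi>)"
proof -
  have [measurable]: "f \<in> borel_measurable borel" using f by (rule schwartz_measurable)
  note fi = schwartz_integrable[OF f]
  have gi: "integrable lborel (\<lambda>x. - \<i> * of_real (h \<bullet> x) * f x)" for h
  proof (rule schwartz_weight_integrable[OF f, of _ "norm h" 1])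
    show "cmod (- \<i> * of_real (h \<bullet> x) * f x) \<le> norm h * (1 + norm x) ^ 1 * cmod (f x)" for x
      by (auto simp: norm_mult intro!: mult_right_mono order_trans[OF Cauchy_Schwarz_ineq2] mult_left_mono)
  qed auto
  have n1: "integrable lborel (\<lambda>x. norm x * cmod (f x))"
    using schwartz_weight_integrable[OF f, of "\<lambda>x. of_real (norm x) * f x" 1 1, THEN integrable_norm]
    by (simp add: norm_mult mult_right_mono)
  have n2: "integrable lborel (\<lambda>x. (norm x)\<^sup>2 * cmod (f x))"
    using schwartz_weight_integrable[OF f, of "\<lambda>x. of_real ((norm x)\<^sup>2) * f x" 1 2, THEN integrable_norm]
    by (simp add: norm_mult mult_right_mono power_mono norm_power)
  let ?c = "fourier_factor TYPE('n)"
  let ?D = "\<lambda>h. fourier (\<lambda>x. - \<i> * of_real (h \<bullet> x) * f x) \<xi>"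
  have bl: "bounded_linear ?D"
  proof (rule bounded_linear_intro)
    show "?D (h + k) = ?D h + ?D k" for h k
      using fourier_lincomb[OF gi[of h] gi[of k], of 1 1 \<xi>]
      by (simp add: inner_add_left algebra_simps)
    show "?D (r *\<^sub>R h) = r *\<^sub>R ?D h" for r h
      using fourier_lincomb[OF gi[of h] gi[of h], of "of_real r" 0 \<xi>]
      unfolding inner_scaleR_left by (simp add: scaleR_conv_of_real algebra_simps)
    show "norm (?D h) \<le> norm h * (?c * (\<integral>x. norm x * cmod (f x) \<partial>lborel))" for h
    proof -
      have "(\<integral>x. cmod (- \<i> * of_real (h \<bullet> x) * f x) \<partial>lborel) \<le> (\<integral>x. norm h * (norm x * cmod (f x)) \<partial>lborel)"
        by (intro integral_mono integrable_norm gi integrable_mult_right n1)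
           (auto simp: norm_mult mult.assoc[symmetric] intro!: mult_right_mono Cauchy_Schwarz_ineq2)
      also have "\<dots> = norm h * (\<integral>x. norm x * cmod (f x) \<partial>lborel)" by simp
      finally have "?c * (\<integral>x. cmod (- \<i> * of_real (h \<bullet> x) * f x) \<partial>lborel)
          \<le> ?c * (norm h * (\<integral>x. norm x * cmod (f x) \<partial>lborel))"
        by (rule mult_left_mono) simp
      with fourier_bound[OF gi[of h], of \<xi>]
      have "norm (?D h) \<le> ?c * (norm h * (\<integral>x. norm x * cmod (f x) \<partial>lborel))" by (rule order_trans)
      then show ?thesis by (simp only: mult.left_commute)
    qed
  qed
  define C where "C = ?c * (\<integral>x. (norm x)\<^sup>2 * cmod (f x) \<partial>lborel)"
  show ?thesis
  proof (rule has_derivativeI_sandwich[where e=1 and H="\<lambda>\<eta>. C * norm (\<eta> - \<xi>)"])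
    fix \<eta> :: "real^'n" assume "\<eta> \<noteq> \<xi>"
    define h where "h = \<eta> - \<xi>"
    \<comment> \<open>A shift of the frequency by \<open>h\<close> multiplies \<open>f\<close> by
      exp(-\<i> h x), so the whole error of the linear approximation is the transform of this one
      function.\<close>
    let ?r = "\<lambda>x. (exp (- \<i> * of_real (h \<bullet> x)) - 1 - (- \<i> * of_real (h \<bullet> x))) * f x"
    have r: "cmod (?r x) \<le> (norm h)\<^sup>2 * ((norm x)\<^sup>2 * cmod (f x))" for x
    proof -
      have "cmod (exp (- \<i> * of_real (h \<bullet> x)) - 1 - (- \<i> * of_real (h \<bullet> x))) \<le> \<bar>h \<bullet> x\<bar>\<^sup>2 / 2"
        using iexp_approx1[of "- (h \<bullet> x)" 1] by (simp add: numeral_2_eq_2 algebra_simps)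
      also have "\<dots> \<le> (norm h * norm x)\<^sup>2"
        using power_mono[OF Cauchy_Schwarz_ineq2[of h x], of 2] zero_le_power2[of "h \<bullet> x"] 
        by (simp only: power2_abs) linarith
      finally show ?thesis
        unfolding norm_mult mult.assoc[symmetric] power_mult_distrib[symmetric]
        by (rule mult_right_mono) simp
    qed
    have ri: "integrable lborel ?r"
      by (rule Bochner_Integration.integrable_bound[OF integrable_mult_right[OF n2, of "(norm h)\<^sup>2"]])
         (use r in \<open>auto intro!: order_trans[OF _ abs_ge_self]\<close>)
    have "fourier f \<eta> = fourier (\<lambda>x. exp (- \<i> * of_real (h \<bullet> x)) * f x) \<xi>"
      by (simp add: fourier_def h_def inner_diff_left mult.assoc[symmetric] exp_add[symmetric] algebra_simps)
    also have "\<dots> - fourier f \<xi> - ?D h = fourier ?r \<xi>"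
    proof -
      have "?r = (\<lambda>x. (exp (- \<i> * of_real (h \<bullet> x)) * f x - f x) - - \<i> * of_real (h \<bullet> x) * f x)"
        by (auto simp: algebra_simps)
      then show ?thesis
        using fourier_diff[OF Bochner_Integration.integrable_diff[OF integrable_exp_mult[OF fi, of h] fi] gi[of h], of \<xi>]
          fourier_diff[OF integrable_exp_mult[OF fi, of h] fi, of \<xi>] by simp
    qed
    finally have "cmod (fourier f \<eta> - fourier f \<xi> - ?D (\<eta> - \<xi>)) = cmod (fourier ?r \<xi>)"
      by (simp add: h_def)
    also have "\<dots> \<le> ?c * (\<integral>x. cmod (?r x) \<partial>lborel)"
      by (rule fourier_bound[OF ri])
    also have "\<dots> \<le> ?c * (\<integral>x. (norm h)\<^sup>2 * ((norm x)\<^sup>2 * cmod (f x)) \<partial>lborel)"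
      by (intro mult_left_mono integral_mono integrable_norm ri integrable_mult_right n2 r) simp
    also have "\<dots> = C * norm (\<eta> - \<xi>) * norm (\<eta> - \<xi>)"
      by (simp add: C_def h_def power2_eq_square)
    finally show "norm (fourier f \<eta> - fourier f \<xi> - ?D (\<eta> - \<xi>)) / norm (\<eta> - \<xi>) \<le> C * norm (\<eta> - \<xi>)"
      using \<open>\<eta> \<noteq> \<xi>\<close> by (simp add: divide_le_eq)
  next
    show "((\<lambda>\<eta>. C * norm (\<eta> - \<xi>)) \<longlongrightarrow> 0) (at \<xi>)"
      by (auto intro!: tendsto_eq_intros)
  qed (use bl in simp_all)
qed

lemma pd_fourier:
  assumes "f \<in> schwartz"
  shows "pd i (fourier f) = fourier (\<lambda>x. - \<i> * (of_real (x $ i) * f x))"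
  using pd_eqI[OF fourier_has_derivative[OF assms], of i] by (simp add: inner_axis' mult.assoc)

text \<open>Lets a difference quotient with step at most 1 be dominated by the weight at its base
  point, with a constant independent of the step.\<close>

lemma decay_weight_shift:
  fixes x y :: "real^'n"
  assumes "norm (y - x) \<le> 1"
  shows "decay_weight y \<le> 2 ^ (2 * CARD('n)) * decay_weight x"
proof -
  have "norm x \<le> norm y + norm (y - x)" using norm_triangle_ineq2[of x y] by (simp add: norm_minus_commute)
  then have "1 + norm x \<le> 2 + norm y" using assms by linarith
  also have "\<dots> \<le> 2 * (1 + norm y)" by simp
  finally have "1 + norm x \<le> 2 * (1 + norm y)" .
  moreover have *: "inverse b \<le> K * inverse a" if "a \<le> K * b" "a > 0" "b > 0" for a b K :: real
    using that by (simp add: field_simps)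
  ultimately have "(1 + norm x) ^ (2 * CARD('n)) \<le> (2 * (1 + norm y)) ^ (2 * CARD('n))"
    by (intro power_mono) auto
  then show ?thesis
    unfolding decay_weight_def power_mult_distrib
    by (intro *) (auto intro!: zero_less_power add_pos_nonneg)
qed

lemma rapid_decay_weight:
  fixes f :: "real^'n \<Rightarrow> complex"
  assumes "rapid f"
  shows "\<exists>C\<ge>0. \<forall>x. cmod (f x) \<le> C * decay_weight x"
proof -
  obtain C where C: "\<And>x. (1 + norm x) ^ (2 * CARD('n)) * cmod (f x) \<le> C"
    using assms(1) unfolding rapid_def by blast
  have "C \<ge> 0" using C[of 0] by (rule order_trans[rotated]) simp
  with le_decay_weight[OF C] show ?thesis by blast
qed

text \<open>By translation invariance all difference quotients of \<open>g\<close> integrate to 0.\<close>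

lemma integral_pd_eq_0:
  fixes g :: "real^'n \<Rightarrow> complex"
  assumes diff: "\<And>x. g differentiable (at x)" and g: "rapid g" and dg: "rapid (pd i g)"
  shows "(\<integral>x. pd i g x \<partial>lborel) = 0"
proof -
  let ?e = "axis i 1 :: real^'n"
  have "continuous_on UNIV g"
    by (meson continuous_at_imp_continuous_on differentiable_imp_continuous_within diff)
  then have gm [measurable]: "g \<in> borel_measurable borel" by (rule borel_measurable_continuous_onI)
  have gi: "integrable lborel g" using rapid_integrable[OF g gm] .
  obtain C where C: "C \<ge> 0" "\<And>x. cmod (pd i g x) \<le> C * decay_weight x"
    using rapid_decay_weight[OF dg] by blast
  define C' where "C' = C * 2 ^ (2 * CARD('n))"
  have deriv: "((\<lambda>s. g (x + s *\<^sub>R ?e)) has_vector_derivative pd i g (x + s *\<^sub>R ?e)) (at s within S)" for x s S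
  proof -
    have "((\<lambda>s. g (x + s *\<^sub>R ?e)) has_derivative
        (\<lambda>h. frechet_derivative g (at (x + s *\<^sub>R ?e)) (h *\<^sub>R ?e))) (at s)"
      by (rule has_derivative_compose[of "\<lambda>s. x + s *\<^sub>R ?e" "\<lambda>h. h *\<^sub>R ?e" s UNIV g])
         (use diff in \<open>auto simp: frechet_derivative_works intro!: derivative_eq_intros\<close>)
    then show ?thesis
      using linear_cmul[OF has_derivative_linear[OF diff[unfolded frechet_derivative_works]]]
      by (simp add: has_vector_derivative_def has_derivative_at_withinI)
  qed
  define t where "t k = inverse (real (Suc k))" for k
  have t: "0 < t k" "t k \<le> 1" "t \<longlonglongrightarrow> 0" for k
    unfolding t_def using LIMSEQ_inverse_real_of_nat by (auto simp: inverse_le_1_iff)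
  define q where "q k x = inverse (t k) *\<^sub>R (g (x + t k *\<^sub>R ?e) - g x)" for k x
  have [measurable]: "q k \<in> borel_measurable borel" for k unfolding q_def by measurable
  have q0: "(\<integral>x. q k x \<partial>lborel) = 0" for k
    using integral_lborel_affine[OF gm, of 1 "t k *\<^sub>R ?e"] integrable_lborel_affine[OF gm, of 1 "t k *\<^sub>R ?e"] gi
    by (simp add: q_def add.commute)
  have lim: "(\<lambda>k. q k x) \<longlonglongrightarrow> pd i g x" for x
  proof -
    have "((\<lambda>s. inverse s *\<^sub>R (g (x + s *\<^sub>R ?e) - g x)) \<longlongrightarrow> pd i g x) (at 0)"
    proof (rule LIM_zero_cancel, rule tendsto_norm_zero_cancel)
      have "((\<lambda>h. norm (g (x + (0 + h) *\<^sub>R ?e) - g (x + 0 *\<^sub>R ?e) - h *\<^sub>R pd i g (x + 0 *\<^sub>R ?e)) / norm h) \<longlongrightarrow> 0) (at 0)"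
        using deriv[of x 0 UNIV] unfolding has_vector_derivative_def has_derivative_at by blast
      then show "((\<lambda>s. norm (inverse s *\<^sub>R (g (x + s *\<^sub>R ?e) - g x) - pd i g x)) \<longlongrightarrow> 0) (at 0)"
      proof (rule Lim_transform_eventually)
        have "norm (g (x + (0 + h) *\<^sub>R ?e) - g (x + 0 *\<^sub>R ?e) - h *\<^sub>R pd i g (x + 0 *\<^sub>R ?e)) / norm h
            = norm (inverse h *\<^sub>R (g (x + h *\<^sub>R ?e) - g x) - pd i g x)" if "h \<noteq> 0" for h
        proof -
          have "inverse h *\<^sub>R (g (x + h *\<^sub>R ?e) - g x) - pd i g x
              = inverse h *\<^sub>R (g (x + h *\<^sub>R ?e) - g x - h *\<^sub>R pd i g x)"
            using that by (simp add: scaleR_diff_right)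
          then show ?thesis by (simp add: divide_inverse mult.commute)
        qed
        then show "\<forall>\<^sub>F h in at 0. norm (g (x + (0 + h) *\<^sub>R ?e) - g (x + 0 *\<^sub>R ?e) - h *\<^sub>R pd i g (x + 0 *\<^sub>R ?e)) / norm h
            = norm (inverse h *\<^sub>R (g (x + h *\<^sub>R ?e) - g x) - pd i g x)"
          by (simp add: eventually_at_filter)
      qed
    qed
    moreover have "filterlim t (at 0) sequentially"
      using t by (auto simp: filterlim_at intro!: always_eventually) (metis less_irrefl)
    ultimately show ?thesis unfolding q_def by (rule filterlim_compose)
  qed
  \<comment> \<open>Only differentiability is given, so measurability of the derivative is inherited
    from the quotients that converge to it.\<close>
  then have [measurable]: "pd i g \<in> borel_measurable borel"
    by (rule borel_measurable_LIMSEQ_metric[of q, rotated]) simp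
  \<comment> \<open>Mean value inequality on the unit segment starting at \<open>x\<close>:
    \<open>decay_weight_shift\<close> turns the bound for the derivative along the segment into one
    at \<open>x\<close>.\<close>
  have bound: "cmod (q k x) \<le> C' * decay_weight x" for k x
  proof -
    have "norm (g (x + t k *\<^sub>R ?e) - g (x + 0 *\<^sub>R ?e)) \<le> C' * decay_weight x * norm (t k - 0)"
    proof (rule differentiable_bound[of "{0..1}" "\<lambda>s. g (x + s *\<^sub>R ?e)" "\<lambda>s h. h *\<^sub>R pd i g (x + s *\<^sub>R ?e)"])
      fix s :: real assume s: "s \<in> {0..1}"
      show "((\<lambda>s. g (x + s *\<^sub>R ?e)) has_derivative (\<lambda>h. h *\<^sub>R pd i g (x + s *\<^sub>R ?e))) (at s within {0..1})"
        using deriv by (simp add: has_vector_derivative_def)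
      have "cmod (pd i g (x + s *\<^sub>R ?e)) \<le> C * decay_weight (x + s *\<^sub>R ?e)" by (rule C)
      also have "\<dots> \<le> C * (2 ^ (2 * CARD('n)) * decay_weight x)"
        using s by (intro mult_left_mono decay_weight_shift C) simp
      finally have "cmod (pd i g (x + s *\<^sub>R ?e)) \<le> C' * decay_weight x" by (simp add: C'_def)
      then show "onorm (\<lambda>h. h *\<^sub>R pd i g (x + s *\<^sub>R ?e)) \<le> C' * decay_weight x"
        by (intro onorm_le) (simp add: mult.commute mult_left_mono)
    qed (use t(1,2)[of k] in auto)
    then show ?thesis using t(1)[of k] unfolding q_def norm_scaleR by (simp add: field_simps)
  qed
  have "(\<lambda>k. \<integral>x. q k x \<partial>lborel) \<longlonglongrightarrow> (\<integral>x. pd i g x \<partial>lborel)"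
    by (rule integral_dominated_convergence[where w="\<lambda>x. C' * decay_weight x"])
       (auto simp: lim bound intro!: integrable_mult_right integrable_decay_weight)
  then show ?thesis unfolding q0 using LIMSEQ_unique tendsto_const by blast
qed

text \<open>Integration by parts without boundary terms: the derivative of the whole integrand
  exp(-\<i> \<xi> x) f(x) has integral 0, and the Leibniz rule splits it into the two sides.\<close>

lemma fourier_pd:
  fixes f :: "real^'n \<Rightarrow> complex"
  assumes f: "f \<in> schwartz"
  shows "fourier (pd i f) \<xi> = \<i> * of_real (\<xi> $ i) * fourier f \<xi>"
proof -
  let ?E = "\<lambda>x. exp (- \<i> * of_real (\<xi> \<bullet> x))"
  note df = smooth_has_derivative[OF schwartz_smooth[OF f]]
  have d: "((\<lambda>x. ?E x * f x) has_derivative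
      (\<lambda>h. ?E x * frechet_derivative f (at x) h + (?E x * (- \<i> * of_real (\<xi> \<bullet> h))) * f x)) (at x)" for x
  proof -
    have "((\<lambda>x. - \<i> * complex_of_real (\<xi> \<bullet> x)) has_derivative (\<lambda>h. - \<i> * of_real (\<xi> \<bullet> h))) (at x)"
      by (intro has_derivative_mult_right has_derivative_of_real has_derivative_inner_right has_derivative_ident)
    from has_derivative_compose[OF this, of exp "\<lambda>z. exp (- \<i> * complex_of_real (\<xi> \<bullet> x)) * z"]
    have "(?E has_derivative (\<lambda>h. ?E x * (- \<i> * of_real (\<xi> \<bullet> h)))) (at x)"
      using DERIV_exp[of "- \<i> * complex_of_real (\<xi> \<bullet> x)"] unfolding has_field_derivative_def by blast
    from has_derivative_mult[OF this df] show ?thesis by simp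
  qed
  have pdE: "pd i (\<lambda>x. ?E x * f x) = (\<lambda>x. ?E x * pd i f x + (- \<i> * of_real (\<xi> $ i)) * (?E x * f x))"
    by (subst pd_eqI[OF d]) (auto simp: inner_axis algebra_simps)
  have rE: "rapid (\<lambda>x. ?E x * g x)" if "rapid g" for g
    by (rule rapid_bound[OF that, of _ 1 0]) (simp add: norm_mult)
  have "(\<integral>x. pd i (\<lambda>x. ?E x * f x) x \<partial>lborel) = 0"
  proof (rule integral_pd_eq_0)
    show "(\<lambda>x. ?E x * f x) differentiable (at x)" for x using d by (rule differentiableI)
    show "rapid (\<lambda>x. ?E x * f x)" using f by (intro rE schwartz_rapid)
    show "rapid (pd i (\<lambda>x. ?E x * f x))"
      unfolding pdE using f by (intro rapid_add rapid_scale rE schwartz_rapid schwartz_pd)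
  qed
  then have "(\<integral>x. ?E x * pd i f x \<partial>lborel) + (- \<i> * of_real (\<xi> $ i)) * (\<integral>x. ?E x * f x \<partial>lborel) = 0"
    unfolding pdE
    using integrable_exp_mult[OF schwartz_integrable[OF f], of \<xi>]
      integrable_exp_mult[OF schwartz_integrable[OF schwartz_pd[OF f]], of \<xi>]
    by (subst (asm) Bochner_Integration.integral_add) auto
  then show ?thesis by (simp add: fourier_def scaleR_conv_of_real algebra_simps)
qed

section \<open>Decay of transforms and continuity on the Schwartz space\<close>

lemma fourier_partials_replicate:
  assumes f: "f \<in> schwartz"
  shows "fourier (partials (replicate k i) f) \<xi> = (\<i> * of_real (\<xi> $ i)) ^ k * fourier f \<xi>"
  by (induction k) (auto simp: fourier_pd schwartz_partials[OF f])

text \<open>Reduces a power of the norm to pure powers of single coordinates. Each of these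
  corresponds to a repeated derivative in one direction, so no mixed derivatives enter
  \<open>fourier_decay\<close>.\<close>

lemma one_plus_norm_power_le:
  fixes \<xi> :: "real^'n"
  shows "(1 + norm \<xi>) ^ k \<le> (1 + real CARD('n)) ^ k * (1 + (\<Sum>i\<in>UNIV. \<bar>\<xi> $ i\<bar> ^ k))"
proof -
  \<comment> \<open>Including 1 in the maximum lets \<open>M\<close> absorb the constant term of 1 +
    |\<xi>|.\<close>
  define M where "M = Max (insert 1 (range (\<lambda>i. \<bar>\<xi> $ i\<bar>)))"
  have M: "1 \<le> M" "\<bar>\<xi> $ i\<bar> \<le> M" for i unfolding M_def by (rule Max_ge; simp)+
  have "M \<in> insert 1 (range (\<lambda>i. \<bar>\<xi> $ i\<bar>))" unfolding M_def by (rule Max_in) auto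
  then have Mk: "M ^ k \<le> 1 + (\<Sum>i\<in>UNIV. \<bar>\<xi> $ i\<bar> ^ k)"
    using member_le_sum[of _ UNIV "\<lambda>i. \<bar>\<xi> $ i\<bar> ^ k"]
    by (auto simp: sum_nonneg add_increasing add_increasing2)
  have "norm \<xi> \<le> (\<Sum>i\<in>UNIV. \<bar>\<xi> $ i\<bar>)" by (rule norm_le_l1_cart)
  also have "\<dots> \<le> real CARD('n) * M" using sum_bounded_above[of UNIV "\<lambda>i. \<bar>\<xi> $ i\<bar>" M] M by simp
  finally have "1 + norm \<xi> \<le> (1 + real CARD('n)) * M" using M by (simp add: algebra_simps)
  then have "(1 + norm \<xi>) ^ k \<le> ((1 + real CARD('n)) * M) ^ k" by (intro power_mono) auto
  also have "\<dots> \<le> (1 + real CARD('n)) ^ k * (1 + (\<Sum>i\<in>UNIV. \<bar>\<xi> $ i\<bar> ^ k))"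
    unfolding power_mult_distrib by (intro mult_left_mono Mk) simp
  finally show ?thesis .
qed

text \<open>The constant is displayed because the estimate is applied twice: to a fixed function for
  rapid decay, and to the differences in a convergent sequence, where the integrals on the right
  tend to 0.\<close>

lemma fourier_decay:
  fixes f :: "real^'n \<Rightarrow> complex"
  assumes f: "f \<in> schwartz"
  shows "(1 + norm \<xi>) ^ k * cmod (fourier f \<xi>) \<le> (1 + real CARD('n)) ^ k * fourier_factor TYPE('n) *
    ((\<integral>x. cmod (f x) \<partial>lborel) + (\<Sum>i\<in>UNIV. \<integral>x. cmod (partials (replicate k i) f x) \<partial>lborel))"
    (is "_ \<le> ?a * ?c * ?B")
proof -
  have "(1 + norm \<xi>) ^ k * cmod (fourier f \<xi>)
      \<le> (?a * (1 + (\<Sum>i\<in>UNIV. \<bar>\<xi> $ i\<bar> ^ k))) * cmod (fourier f \<xi>)"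
    by (intro mult_right_mono one_plus_norm_power_le) simp
  also have "\<dots> = ?a * (cmod (fourier f \<xi>) + (\<Sum>i\<in>UNIV. cmod (fourier (partials (replicate k i) f) \<xi>)))"
    by (simp add: fourier_partials_replicate[OF f] norm_mult norm_power algebra_simps sum_distrib_left)
  also have "\<dots> \<le> ?a * (?c * (\<integral>x. cmod (f x) \<partial>lborel)
      + (\<Sum>i\<in>UNIV. ?c * (\<integral>x. cmod (partials (replicate k i) f x) \<partial>lborel)))"
    by (intro mult_left_mono add_mono sum_mono fourier_bound schwartz_integrable schwartz_partials f) simp
  also have "\<dots> = ?a * ?c * ?B" 
    unfolding sum_distrib_left[symmetric] by (simp add: algebra_simps)
  finally show ?thesis .
qed

lemma rapid_fourier: "f \<in> schwartz \<Longrightarrow> rapid (fourier f)"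
  unfolding rapid_def using fourier_decay by blast

text \<open>Transforms of Schwartz functions form an invariant set: differentiating a transform
  multiplies the original function by a coordinate and a constant, which stays in the Schwartz
  space.\<close>

lemma fourier_schwartz:
  fixes f :: "real^'n \<Rightarrow> complex"
  assumes "f \<in> schwartz"
  shows "fourier f \<in> schwartz"
proof (rule schwartz_coinduct[where S="fourier ` schwartz"])
  show "fourier f \<in> fourier ` schwartz" using assms by blast
  show "g differentiable (at x)" if "g \<in> fourier ` schwartz" for g and x :: "real^'n"
    using that fourier_has_derivative by (blast intro: differentiableI)
  show "rapid g" if "g \<in> fourier ` schwartz" for g :: "real^'n \<Rightarrow> complex"
    using that rapid_fourier by blast
  show "pd i g \<in> fourier ` schwartz" if g: "g \<in> fourier ` schwartz" for i and g :: "real^'n \<Rightarrow> complex"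
  proof -
    obtain f where f: "g = fourier f" "f \<in> schwartz" using g by (rule imageE)
    show ?thesis unfolding f(1) pd_fourier[OF f(2)]
      by (intro imageI schwartz_scale schwartz_coord f)
  qed
qed

text \<open>Uniform convergence after multiplication by the reciprocal of the integrable
  \<open>decay_weight\<close> gives convergence in L^1.\<close>

lemma converges_schwartz_integral:
  fixes \<phi> :: "real^'n \<Rightarrow> complex"
  assumes "converges_schwartz \<Phi> \<phi>"
  shows "(\<lambda>j. \<integral>x. cmod (partials is (\<Phi> j) x - partials is \<phi> x) \<partial>lborel) \<longlonglongrightarrow> 0"
proof (rule tendstoI)
  fix e :: real assume "0 < e"
  let ?I = "\<integral>x. decay_weight (x::real^'n) \<partial>lborel"
  have I: "0 \<le> ?I" by (intro Bochner_Integration.integral_nonneg less_imp_le decay_weight_pos)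
  define d where "d = e / (?I + 1)"
  have d: "d > 0" "d * ?I < e" using I \<open>0 < e\<close> by (auto simp: d_def field_simps)
  have S: "\<Phi> j \<in> schwartz" "\<phi> \<in> schwartz" for j
    using assms by (auto simp: converges_schwartz_def)
  have "uniform_limit UNIV (\<lambda>j x. (1 + norm x) ^ (2 * CARD('n)) *\<^sub>R partials is (\<Phi> j) x)
        (\<lambda>x. (1 + norm x) ^ (2 * CARD('n)) *\<^sub>R partials is \<phi> x) sequentially"
    using assms by (auto simp: converges_schwartz_def)
  from uniform_limitD[OF this d(1)]
  show "\<forall>\<^sub>F j in sequentially. dist (\<integral>x. cmod (partials is (\<Phi> j) x - partials is \<phi> x) \<partial>lborel) 0 < e"
  proof eventually_elim
    case (elim j)
    have "cmod (partials is (\<Phi> j) x - partials is \<phi> x) \<le> d * decay_weight x" for x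
    proof (rule le_decay_weight)
      have "norm ((1 + norm x) ^ (2 * CARD('n)) *\<^sub>R (partials is (\<Phi> j) x - partials is \<phi> x)) < d"
        using elim by (simp add: dist_norm scaleR_diff_right)
      then show "(1 + norm x) ^ (2 * CARD('n)) * cmod (partials is (\<Phi> j) x - partials is \<phi> x) \<le> d"
        by (simp add: abs_of_nonneg)
    qed
    then have "(\<integral>x. cmod (partials is (\<Phi> j) x - partials is \<phi> x) \<partial>lborel) \<le> (\<integral>x. d * decay_weight (x::real^'n) \<partial>lborel)"
      by (intro integral_mono integrable_norm Bochner_Integration.integrable_diff schwartz_integrable
          schwartz_partials S integrable_mult_right integrable_decay_weight)
    also have "\<dots> < e" using d by simp
    finally show ?case by simp
  qed
qed

text \<open>The bound is uniform in \<xi> with an arbitrary polynomial weight, which is what makes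
  \<open>fourier_synthesis\<close> sequentially continuous.\<close>

lemma converges_schwartz_fourier:
  fixes \<phi> :: "real^'n \<Rightarrow> complex"
  assumes "converges_schwartz \<Phi> \<phi>"
  obtains \<epsilon> where "\<epsilon> \<longlonglongrightarrow> 0" "\<And>j \<xi>. (1 + norm \<xi>) ^ k * cmod (fourier (\<Phi> j) \<xi> - fourier \<phi> \<xi>) \<le> \<epsilon> j"
proof -
  have S: "\<Phi> j \<in> schwartz" "\<phi> \<in> schwartz" for j
    using assms by (auto simp: converges_schwartz_def)
  let ?h = "\<lambda>j x. \<Phi> j x - \<phi> x"
  define \<epsilon> where "\<epsilon> j = (1 + real CARD('n)) ^ k * fourier_factor TYPE('n) *
    ((\<integral>x. cmod (?h j x) \<partial>lborel) + (\<Sum>i\<in>UNIV. \<integral>x. cmod (partials (replicate k i) (?h j) x) \<partial>lborel))" for j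
  have eq: "partials is (?h j) = (\<lambda>x. partials is (\<Phi> j) x - partials is \<phi> x)" for "is" j
    using partials_lincomb[of "\<Phi> j" \<phi> "is" 1 "-1"] S by (simp add: schwartz_smooth)
  have "\<epsilon> \<longlonglongrightarrow> (1 + real CARD('n)) ^ k * fourier_factor TYPE('n) * (0 + (\<Sum>i\<in>(UNIV::'n set). 0))"
    unfolding \<epsilon>_def eq
    using converges_schwartz_integral[OF assms, of "[]"] converges_schwartz_integral[OF assms]
    by (intro tendsto_intros) auto
  moreover have "(1 + norm \<xi>) ^ k * cmod (fourier (\<Phi> j) \<xi> - fourier \<phi> \<xi>) \<le> \<epsilon> j" for j \<xi>
    using fourier_decay[OF schwartz_diff[OF S(1)[of j] S(2)], of \<xi> k]
    by (simp add: fourier_diff schwartz_integrable S \<epsilon>_def)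
  ultimately show ?thesis using that by simp
qed

section \<open>Fourier inversion\<close>

definition gaussian :: "real^'n \<Rightarrow> complex" where
  "gaussian x = of_real (exp (- (norm x)\<^sup>2 / 2))"

lemma gaussian_prod: "gaussian x = (\<Prod>i\<in>UNIV. of_real (exp (- (x $ i)\<^sup>2 / 2)))"
proof -
  have "(norm x)\<^sup>2 = (\<Sum>i\<in>UNIV. (x $ i)\<^sup>2)"
    unfolding power2_norm_eq_inner inner_vec_def by (simp add: power2_eq_square)
  then have "- (norm x)\<^sup>2 / 2 = (\<Sum>i\<in>UNIV. - (x $ i)\<^sup>2 / 2)"
    by (simp add: sum_negf sum_divide_distrib)
  then show ?thesis
    unfolding gaussian_def by (simp only: exp_sum[OF finite] of_real_prod)
qed

text \<open>Up to the factor sqrt(2 pi) the integral is the characteristic function of the standard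
  normal distribution, evaluated at \<open>- t\<close>.\<close>

lemma
  integrable_gaussian_1d: "integrable lborel (\<lambda>x. exp (- \<i> * of_real (t * x)) * of_real (exp (- x\<^sup>2 / 2)))"
  and integral_gaussian_1d:
    "(\<integral>x. exp (- \<i> * of_real (t * x)) * of_real (exp (- x\<^sup>2 / 2)) \<partial>lborel) = of_real (sqrt (2 * pi) * exp (- t\<^sup>2 / 2))"
proof -
  let ?h = "\<lambda>x. exp (- \<i> * of_real (t * x)) * complex_of_real (exp (- x\<^sup>2 / 2))"
  have "integrable lborel (\<lambda>x. sqrt (2 * pi) * std_normal_density x)"
    using integrable_normal_density[of 1 0] by simp
  then show "integrable lborel ?h"
    by (rule Bochner_Integration.integrable_bound)
       (auto simp: norm_mult normal_density_def norm_exp_eq_Re)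
  have "of_real (exp (- t\<^sup>2 / 2)) = char std_normal_distribution (- t)"
    by (simp add: char_std_normal_distribution)
  also have "\<dots> = (\<integral>x. std_normal_density x *\<^sub>R iexp (- t * x) \<partial>lborel)"
    unfolding char_def by (subst integral_density) (auto simp: normal_density_nonneg)
  also have "\<dots> = (\<integral>x. of_real (1 / sqrt (2 * pi)) * ?h x \<partial>lborel)"
    by (rule Bochner_Integration.integral_cong) (auto simp: normal_density_def scaleR_conv_of_real)
  also have "\<dots> = of_real (1 / sqrt (2 * pi)) * (\<integral>x. ?h x \<partial>lborel)" by simp
  finally show "(\<integral>x. ?h x \<partial>lborel) = of_real (sqrt (2 * pi) * exp (- t\<^sup>2 / 2))"
    by (simp add: field_simps)
qed

lemma exp_gaussian_prod:
  "exp (- \<i> * of_real (\<xi> \<bullet> x)) * gaussian x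
    = (\<Prod>i\<in>UNIV. exp (- \<i> * of_real (\<xi> $ i * x $ i)) * of_real (exp (- (x $ i)\<^sup>2 / 2)))"
proof -
  have "- \<i> * of_real (\<xi> \<bullet> x) = (\<Sum>i\<in>UNIV. - \<i> * of_real (\<xi> $ i * x $ i))"
    by (simp add: inner_vec_def sum_distrib_left sum_negf)
  then show ?thesis by (simp only: exp_sum[OF finite] gaussian_prod prod.distrib)
qed

lemma gaussian_integrable: "integrable lborel (gaussian :: real^'n \<Rightarrow> complex)"
  using integrable_prod_coord[of "\<lambda>i::'n. \<lambda>x. exp (- \<i> * of_real (0 * x)) * of_real (exp (- x\<^sup>2 / 2))"]
    integrable_gaussian_1d[of 0] by (simp add: gaussian_prod[abs_def])

text \<open>Kernel and Gaussian both factor over the coordinates, and the factors sqrt(2 pi), one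
  per coordinate, cancel against the normalization of \<open>fourier\<close>.\<close>

lemma fourier_gaussian: "fourier gaussian = (gaussian :: real^'n \<Rightarrow> complex)"
proof
  fix \<xi> :: "real^'n"
  have "(\<integral>x. exp (- \<i> * of_real (\<xi> \<bullet> x)) * gaussian x \<partial>lborel)
      = (\<Prod>i\<in>UNIV. of_real (sqrt (2 * pi) * exp (- (\<xi> $ i)\<^sup>2 / 2)))"
    unfolding exp_gaussian_prod
    using integral_prod_coord[of "\<lambda>i x. exp (- \<i> * of_real (\<xi> $ i * x)) * of_real (exp (- x\<^sup>2 / 2))"]
      integrable_gaussian_1d by (simp only: integral_gaussian_1d)
  also have "\<dots> = of_real (sqrt (2 * pi) ^ CARD('n)) * gaussian \<xi>"
    by (simp add: gaussian_prod prod.distrib)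
  finally have "fourier gaussian \<xi> = (fourier_factor TYPE('n) * sqrt (2 * pi) ^ CARD('n)) *\<^sub>R gaussian \<xi>"
    by (simp add: fourier_def scaleR_conv_of_real)
  moreover have "sqrt (2 * pi) ^ CARD('n) = (2 * pi) powr (real CARD('n) / 2)"
    by (simp add: powr_half_sqrt[symmetric] powr_realpow[symmetric] powr_powr)
  ultimately show "fourier gaussian \<xi> = gaussian \<xi>"
    by (simp add: powr_add[symmetric])
qed

lemma gaussian_measurable [measurable]: "gaussian \<in> borel_measurable borel"
  unfolding gaussian_def by measurable

lemma cmod_gaussian_le: "cmod (gaussian x) \<le> 1"
  by (simp add: gaussian_def)

lemma integral_gaussian:
  "fourier_factor TYPE('n) *\<^sub>R (\<integral>x. gaussian (x::real^'n) \<partial>lborel) = 1"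
  using fun_cong[OF fourier_gaussian, of "0 :: real^'n"] by (simp add: fourier_def gaussian_def)

text \<open>The outer integral is damped by a Gaussian of width 1 / \<open>t k\<close>. The
  multiplication formula converts it into a Gaussian average of \<open>f\<close> around
  \<open>x\<close> at scale \<open>t k\<close>. Both sides converge as \<open>t k\<close> tends to
  0: one is dominated through integrability of the transform, the other through boundedness of
  \<open>f\<close>.\<close>

theorem fourier_inversion:
  fixes f :: "real^'n \<Rightarrow> complex"
  assumes f: "integrable lborel f" and ff: "integrable lborel (fourier f)"
    and cont: "continuous_on UNIV f" and bdd: "\<And>x. cmod (f x) \<le> B"
  shows "fourier (fourier f) (- x) = f x"
proof -
  let ?c = "fourier_factor TYPE('n)"
  have fm [measurable]: "f \<in> borel_measurable borel" and [measurable]: "fourier f \<in> borel_measurable borel"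
    using f ff by auto
  define t where "t k = inverse (real (Suc k))" for k
  have t: "0 < t k" "t k \<noteq> 0" "t \<longlonglongrightarrow> 0" for k
    unfolding t_def using LIMSEQ_inverse_real_of_nat by auto
  \<comment> \<open>Translation and dilation of \<open>f\<close> become a phase and an inverse
    dilation of its transform.\<close>
  have F: "fourier (\<lambda>z. f (x + t k *\<^sub>R z)) \<eta>
      = inverse (t k ^ CARD('n)) *\<^sub>R (exp (\<i> * of_real (\<eta> \<bullet> x / t k)) * fourier f (\<eta> /\<^sub>R t k))" for k \<eta>
  proof -
    let ?P = "\<lambda>y. exp (- \<i> * of_real (\<eta> \<bullet> (y - x) / t k)) * f y"
    have "(\<integral>y. ?P y \<partial>lborel) = t k ^ CARD('n) *\<^sub>R (\<integral>z. ?P (x + t k *\<^sub>R z) \<partial>lborel)"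
      using integral_lborel_affine[of ?P "t k" x, OF _ t(2)] t(1)[of k] by simp
    moreover have "?P (x + t k *\<^sub>R z) = exp (- \<i> * of_real (\<eta> \<bullet> z)) * f (x + t k *\<^sub>R z)" for z
      using t(2)[of k] by simp
    ultimately have *: "(\<integral>y. ?P y \<partial>lborel)
        = t k ^ CARD('n) *\<^sub>R (\<integral>z. exp (- \<i> * of_real (\<eta> \<bullet> z)) * f (x + t k *\<^sub>R z) \<partial>lborel)"
      by (simp only:)
    have "?P y = exp (\<i> * of_real (\<eta> \<bullet> x / t k)) * (exp (- \<i> * of_real ((\<eta> /\<^sub>R t k) \<bullet> y)) * f y)" for y
    proof -
      have "\<eta> \<bullet> (y - x) / t k = (\<eta> /\<^sub>R t k) \<bullet> y - \<eta> \<bullet> x / t k"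
        by (simp add: inner_diff_right right_diff_distrib divide_inverse mult.commute)
      moreover have "exp (- \<i> * complex_of_real (a - b)) = exp (\<i> * of_real b) * exp (- \<i> * of_real a)" for a b
        by (simp add: exp_add[symmetric] algebra_simps)
      ultimately show ?thesis by (simp only: mult.assoc)
    qed
    with * have "exp (\<i> * of_real (\<eta> \<bullet> x / t k)) * (\<integral>y. exp (- \<i> * of_real ((\<eta> /\<^sub>R t k) \<bullet> y)) * f y \<partial>lborel)
        = t k ^ CARD('n) *\<^sub>R (\<integral>z. exp (- \<i> * of_real (\<eta> \<bullet> z)) * f (x + t k *\<^sub>R z) \<partial>lborel)"
      (is "?E * ?B = _ *\<^sub>R ?A") by (simp only: integral_mult_right_zero)
    then have "?A = inverse (t k ^ CARD('n)) *\<^sub>R (?E * ?B)" using t(2)[of k] by simp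
    then show ?thesis unfolding fourier_def by simp
  qed
  \<comment> \<open>The substitution \<xi> = \<eta> / \<open>t k\<close> produces exactly the
    transform computed in \<open>F\<close>, times an undilated Gaussian, so the multiplication
    formula and \<open>fourier_gaussian\<close> apply.\<close>
  have eq: "(\<integral>\<xi>. exp (\<i> * of_real (\<xi> \<bullet> x)) * fourier f \<xi> * gaussian (t k *\<^sub>R \<xi>) \<partial>lborel)
      = (\<integral>z. f (x + t k *\<^sub>R z) * gaussian z \<partial>lborel)" for k
  proof -
    let ?Q = "\<lambda>\<xi>. exp (\<i> * of_real (\<xi> \<bullet> x)) * fourier f \<xi> * gaussian (t k *\<^sub>R \<xi>)"
    have "(\<integral>\<xi>. ?Q \<xi> \<partial>lborel) = inverse (t k) ^ CARD('n) *\<^sub>R (\<integral>\<eta>. ?Q (0 + inverse (t k) *\<^sub>R \<eta>) \<partial>lborel)"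
      using integral_lborel_affine[of ?Q "inverse (t k)" 0] t(1,2)[of k] by simp
    also have "\<dots> = (\<integral>\<eta>. inverse (t k) ^ CARD('n) *\<^sub>R ?Q (0 + inverse (t k) *\<^sub>R \<eta>) \<partial>lborel)" by simp
    also have "\<dots> = (\<integral>\<eta>. fourier (\<lambda>z. f (x + t k *\<^sub>R z)) \<eta> * gaussian \<eta> \<partial>lborel)"
      unfolding F using t(1,2)[of k] by (simp add: power_inverse divide_inverse mult.commute)
    also have "\<dots> = (\<integral>z. f (x + t k *\<^sub>R z) * fourier gaussian z \<partial>lborel)"
      using integrable_lborel_affine[OF fm, of "t k" x] t(1,2)[of k] f
      by (intro fourier_mult_swap gaussian_integrable) auto
    finally show ?thesis by (simp add: fourier_gaussian)
  qed
  have contx: "isCont f y" for y using cont by (simp add: continuous_on_eq_continuous_at)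
  have "(\<lambda>k. \<integral>z. f (x + t k *\<^sub>R z) * gaussian z \<partial>lborel) \<longlonglongrightarrow> (\<integral>(z::real^'n). f x * gaussian z \<partial>lborel)"
  proof (rule integral_dominated_convergence[where w="\<lambda>z::real^'n. B * cmod (gaussian z)"])
    show "integrable lborel (\<lambda>z::real^'n. B * cmod (gaussian z))"
      by (intro integrable_mult_right integrable_norm gaussian_integrable)
    have "(\<lambda>k. f (x + t k *\<^sub>R z)) \<longlonglongrightarrow> f x" for z
      by (rule isCont_tendsto_compose[OF contx]) (use t(3) in \<open>auto intro!: tendsto_eq_intros\<close>)
    then show "AE z in lborel. (\<lambda>k. f (x + t k *\<^sub>R z) * gaussian z) \<longlonglongrightarrow> f x * gaussian z"
      by (auto intro!: tendsto_intros)
    show "AE z in lborel. norm (f (x + t k *\<^sub>R z) * gaussian z) \<le> B * cmod (gaussian z)" for k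
      by (simp add: norm_mult bdd mult_right_mono)
  qed measurable
  moreover have "(\<lambda>k. \<integral>\<xi>. exp (\<i> * of_real (\<xi> \<bullet> x)) * fourier f \<xi> * gaussian (t k *\<^sub>R \<xi>) \<partial>lborel)
      \<longlonglongrightarrow> (\<integral>\<xi>. exp (\<i> * of_real (\<xi> \<bullet> x)) * fourier f \<xi> \<partial>lborel)"
  proof (rule integral_dominated_convergence[where w="\<lambda>\<xi>. cmod (fourier f \<xi>)"])
    have "(\<lambda>k. gaussian (t k *\<^sub>R z)) \<longlonglongrightarrow> of_real (exp (- (norm (0 *\<^sub>R z))\<^sup>2 / 2))" for z :: "real^'n"
      unfolding gaussian_def using t(3) by (intro tendsto_intros) auto
    then have "(\<lambda>k. exp (\<i> * of_real (\<xi> \<bullet> x)) * fourier f \<xi> * gaussian (t k *\<^sub>R \<xi>))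
        \<longlonglongrightarrow> exp (\<i> * of_real (\<xi> \<bullet> x)) * fourier f \<xi> * 1" for \<xi>
      by (intro tendsto_intros) simp
    then show "AE \<xi> in lborel. (\<lambda>k. exp (\<i> * of_real (\<xi> \<bullet> x)) * fourier f \<xi> * gaussian (t k *\<^sub>R \<xi>))
        \<longlonglongrightarrow> exp (\<i> * of_real (\<xi> \<bullet> x)) * fourier f \<xi>"
      by simp
    show "AE \<xi> in lborel. norm (exp (\<i> * of_real (\<xi> \<bullet> x)) * fourier f \<xi> * gaussian (t k *\<^sub>R \<xi>))
        \<le> cmod (fourier f \<xi>)" for k
      by (simp add: norm_mult norm_exp_eq_Re mult_left_le cmod_gaussian_le)
  qed (use ff in \<open>auto intro: integrable_norm\<close>)
  ultimately have "(\<integral>\<xi>. exp (\<i> * of_real (\<xi> \<bullet> x)) * fourier f \<xi> \<partial>lborel) = (\<integral>(z::real^'n). f x * gaussian z \<partial>lborel)"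
    unfolding eq using LIMSEQ_unique by blast
  then have "fourier (fourier f) (- x) = f x * (?c *\<^sub>R (\<integral>z. gaussian (z::real^'n) \<partial>lborel))"
    by (simp add: fourier_def inner_commute)
  then show ?thesis by (simp only: integral_gaussian) simp
qed

lemma rapid_bounded:
  assumes "rapid f" shows "\<exists>B. \<forall>x. cmod (f x) \<le> B"
  using assms unfolding rapid_def by (metis mult_1 power_0)

lemma schwartz_inversion:
  assumes "f \<in> schwartz" shows "fourier (fourier f) (- x) = f x"
proof -
  obtain B where "\<And>x. cmod (f x) \<le> B" using rapid_bounded[OF schwartz_rapid[OF assms]] by blast
  then show ?thesis
    using assms by (intro fourier_inversion)
      (auto intro: schwartz_integrable fourier_schwartz smooth_continuous schwartz_smooth)
qed

section \<open>Bump functions\<close>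

text \<open>The powers \<open>m\<close> make the family closed under differentiation up to linear
  combinations. \<open>c\<close> is a sharpness parameter: letting it decrease to 0 with
  \<open>m = 0\<close> turns the cutoff into the indicator of the positive half-line.\<close>

definition exp_cutoff :: "real \<Rightarrow> nat \<Rightarrow> real \<Rightarrow> real" where
  "exp_cutoff c m t = (if 0 < t then inverse t ^ m * exp (- (c / t)) else 0)"

text \<open>A single term of the exponential series, of degree \<open>m + 2\<close>, beats the
  singular factor and leaves two spare powers of \<open>t\<close>. Two are wanted so that the
  difference quotient at 0 tends to 0.\<close>

lemma exp_cutoff_le_square:
  assumes "0 < c"
  shows "\<bar>exp_cutoff c m t\<bar> \<le> fact (m + 2) / c ^ (m + 2) * t\<^sup>2"
proof (cases "0 < t")
  case True
  have "(c / t) ^ (m + 2) / fact (m + 2) \<le> exp (c / t)"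
  proof -
    have "(\<Sum>n\<in>{m + 2}. (c / t) ^ n /\<^sub>R fact n) \<le> (\<Sum>n. (c / t) ^ n /\<^sub>R fact n)"
      using True assms by (intro sum_le_suminf summable_exp_generic) auto
    then show ?thesis by (simp add: exp_def divide_inverse mult.commute)
  qed
  then have "inverse (exp (c / t)) \<le> inverse ((c / t) ^ (m + 2) / fact (m + 2))"
    using True assms by (intro le_imp_inverse_le) auto
  then have "exp (- (c / t)) \<le> fact (m + 2) / c ^ (m + 2) * t ^ (m + 2)"
    by (simp only: exp_minus power_divide inverse_divide divide_divide_eq_right times_divide_eq_left)
  then have "inverse t ^ m * exp (- (c / t)) \<le> inverse t ^ m * (fact (m + 2) / c ^ (m + 2) * t ^ (m + 2))"
    using True by (intro mult_left_mono) auto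
  also have "\<dots> = fact (m + 2) / c ^ (m + 2) * t\<^sup>2 * (inverse t ^ m * t ^ m)"
    by (simp only: power_add mult_ac)
  also have "inverse t ^ m * t ^ m = 1"
    using True by (simp add: power_mult_distrib[symmetric])
  finally show ?thesis using True by (simp add: exp_cutoff_def)
qed (use assms in \<open>simp add: exp_cutoff_def\<close>)

lemma exp_cutoff_has_derivative:
  assumes c: "0 < c"
  shows "(exp_cutoff c m has_real_derivative
      (c * exp_cutoff c (m + 2) t - real m * exp_cutoff c (m + 1) t)) (at t)"
proof (cases "t = 0")
  case True
  let ?K = "fact (m + 2) / c ^ (m + 2) :: real"
  have "((\<lambda>h. (exp_cutoff c m h - exp_cutoff c m 0) / (h - 0)) \<longlongrightarrow> 0) (at 0)"
  proof (rule Lim_null_comparison)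
    have "norm ((exp_cutoff c m h - exp_cutoff c m 0) / (h - 0)) \<le> ?K * \<bar>h\<bar>" if "h \<noteq> 0" for h
    proof -
      have "\<bar>exp_cutoff c m h\<bar> / \<bar>h\<bar> \<le> ?K * h\<^sup>2 / \<bar>h\<bar>"
        by (intro divide_right_mono exp_cutoff_le_square c) simp
      also have "\<dots> = ?K * \<bar>h\<bar>"
      proof -
        have "h\<^sup>2 / \<bar>h\<bar> = \<bar>h\<bar>" using that by (simp add: divide_simps power2_eq_square)
        then show ?thesis by (metis times_divide_eq_right)
      qed
      finally show ?thesis by (simp add: exp_cutoff_def)
    qed
    then show "\<forall>\<^sub>F h in at 0. norm ((exp_cutoff c m h - exp_cutoff c m 0) / (h - 0)) \<le> ?K * \<bar>h\<bar>"
      by (simp add: eventually_at_filter)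
    show "((\<lambda>h. ?K * \<bar>h\<bar>) \<longlongrightarrow> 0) (at 0)" by (rule tendsto_eq_intros tendsto_const refl | simp)+
  qed
  then show ?thesis using True by (simp add: has_field_derivative_iff exp_cutoff_def)
next
  case False
  then consider "t < 0" | "0 < t" by linarith
  then show ?thesis
  proof cases
    case 1
    have "((\<lambda>t. 0) has_real_derivative 0) (at t)" by simp
    then have "(exp_cutoff c m has_real_derivative 0) (at t)"
      by (rule has_field_derivative_transform_within_open[of _ _ _ "{..<0}"])
         (use 1 in \<open>auto simp: exp_cutoff_def\<close>)
    then show ?thesis using 1 by (simp add: exp_cutoff_def)
  next
    case 2
    have "((\<lambda>t. inverse t ^ m * exp (- (c / t))) has_real_derivative
        (c * (inverse t ^ (m + 2) * exp (- (c / t))) - real m * (inverse t ^ (m + 1) * exp (- (c / t))))) (at t)"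
    proof -
      have i: "(inverse has_real_derivative - (inverse t * inverse t)) (at t)"
        using 2 DERIV_inverse[of t] by simp
      have "((\<lambda>t. exp (- (c / t))) has_real_derivative exp (- (c / t)) * (c * (inverse t * inverse t))) (at t)"
        using 2 by (auto intro!: derivative_eq_intros simp: divide_inverse)
      from DERIV_mult[OF DERIV_power[OF i, of m] this] show ?thesis
        by (cases m) (simp_all add: algebra_simps)
    qed
    then have "(exp_cutoff c m has_real_derivative
        (c * (inverse t ^ (m + 2) * exp (- (c / t))) - real m * (inverse t ^ (m + 1) * exp (- (c / t))))) (at t)"
      by (rule has_field_derivative_transform_within_open[of _ _ _ "{0<..}"])
         (use 2 in \<open>auto simp: exp_cutoff_def\<close>)
    then show ?thesis using 2 by (simp add: exp_cutoff_def)
  qed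
qed

text \<open>Closed under \<open>pd\<close> because \<open>exp_cutoff_has_derivative\<close>
  expresses a derivative through the members with indices \<open>m + 1\<close> and
  \<open>m + 2\<close>.\<close>

inductive_set cutoff_span :: "real \<Rightarrow> real \<Rightarrow> real \<Rightarrow> 'n \<Rightarrow> (real^'n \<Rightarrow> complex) set"
  for c \<sigma> a i where
  base: "(\<lambda>x. of_real (exp_cutoff c m (\<sigma> * x $ i + a))) \<in> cutoff_span c \<sigma> a i"
| lincomb: "f \<in> cutoff_span c \<sigma> a i \<Longrightarrow> g \<in> cutoff_span c \<sigma> a i \<Longrightarrow>
    (\<lambda>x. \<alpha> * f x + \<beta> * g x) \<in> cutoff_span c \<sigma> a i"

lemma smooth_cutoff:
  fixes i :: "'n::finite"
  assumes c: "0 < c"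
  shows "smooth (\<lambda>x::real^'n. of_real (exp_cutoff c m (\<sigma> * x $ i + a)))"
proof (rule smooth_coinduct[where S="cutoff_span c \<sigma> a i"])
  let ?b = "\<lambda>m (x::real^'n). complex_of_real (exp_cutoff c m (\<sigma> * x $ i + a))"
  have hd: "(?b m has_derivative (\<lambda>h. complex_of_real ((c * exp_cutoff c (m + 2) (\<sigma> * x $ i + a)
      - real m * exp_cutoff c (m + 1) (\<sigma> * x $ i + a)) * (\<sigma> * h $ i)))) (at x)" for m x
  proof -
    have "((\<lambda>x::real^'n. \<sigma> * x $ i + a) has_derivative (\<lambda>h. \<sigma> * h $ i)) (at x)"
      by (auto intro!: derivative_eq_intros bounded_linear_imp_has_derivative bounded_linear_vec_nth)
    from has_derivative_compose[OF this exp_cutoff_has_derivative[OF c, of m, unfolded has_field_derivative_def]]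
    show ?thesis by (rule has_derivative_of_real)
  qed
  have "(\<forall>x. g differentiable (at x)) \<and> (\<forall>j. pd j g \<in> cutoff_span c \<sigma> a i)" if "g \<in> cutoff_span c \<sigma> a i" for g
    using that
  proof induction
    case (base m)
    have "pd j (?b m) \<in> cutoff_span c \<sigma> a i" for j
    proof -
      let ?d = "complex_of_real (if j = i then \<sigma> else 0)"
      have "pd j (?b m) = (\<lambda>x. (?d * of_real c) * ?b (m + 2) x + (- ?d * of_nat m) * ?b (m + 1) x)"
        by (subst pd_eqI[OF hd]) (auto simp: axis_def algebra_simps fun_eq_iff)
      then show ?thesis by (simp only: cutoff_span.intros)
    qed
    then show ?case using hd by (blast intro: differentiableI)
  next
    case (lincomb f g \<alpha> \<beta>)
    have d: "((\<lambda>x. \<alpha> * f x + \<beta> * g x) has_derivative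
        (\<lambda>h. \<alpha> * frechet_derivative f (at x) h + \<beta> * frechet_derivative g (at x) h)) (at x)" for x
      using lincomb by (intro derivative_intros) (simp_all add: frechet_derivative_works)
    have "pd j (\<lambda>x. \<alpha> * f x + \<beta> * g x) \<in> cutoff_span c \<sigma> a i" for j
      unfolding pd_eqI[OF d] using lincomb by (intro cutoff_span.lincomb) auto
    then show ?case using d by (blast intro: differentiableI)
  qed
  then show "\<And>g x. g \<in> cutoff_span c \<sigma> a i \<Longrightarrow> g differentiable (at x)"
    "\<And>g j. g \<in> cutoff_span c \<sigma> a i \<Longrightarrow> pd j g \<in> cutoff_span c \<sigma> a i" by blast+
qed (rule cutoff_span.base)

text \<open>A tensor product, so that it is positive exactly on the open box \<open>box a b\<close>;
  as \<open>c\<close> decreases to 0 it tends pointwise to the indicator of that box.\<close>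

definition bump_real :: "real \<Rightarrow> real^'n \<Rightarrow> real^'n \<Rightarrow> real^'n \<Rightarrow> real" where
  "bump_real c a b x = (\<Prod>i\<in>UNIV. exp_cutoff c 0 (x $ i - a $ i) * exp_cutoff c 0 (b $ i - x $ i))"

definition bump :: "real \<Rightarrow> real^'n \<Rightarrow> real^'n \<Rightarrow> real^'n \<Rightarrow> complex" where
  "bump c a b x = of_real (bump_real c a b x)"

lemma exp_cutoff_0: "exp_cutoff c 0 t = (if 0 < t then exp (- (c / t)) else 0)"
  by (simp add: exp_cutoff_def)

lemma bump_real_nonneg: "0 \<le> bump_real c a b x"
  unfolding bump_real_def by (intro prod_nonneg) (simp add: exp_cutoff_0)

lemma bump_real_pos: "x \<in> box a b \<Longrightarrow> 0 < bump_real c a b x"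
  unfolding bump_real_def by (intro prod_pos) (simp add: exp_cutoff_0 mem_box_cart)

lemma bump_real_outside: "x \<notin> box a b \<Longrightarrow> bump_real c a b x = 0"
  unfolding bump_real_def by (force simp: exp_cutoff_0 mem_box_cart intro: prod_zero)

lemma bump_real_le_1: "0 < c \<Longrightarrow> bump_real c a b x \<le> 1"
  unfolding bump_real_def by (intro prod_le_1) (auto simp: exp_cutoff_0 mult_le_one)

lemma smooth_bump: "0 < c \<Longrightarrow> smooth (bump c a b)"
  unfolding bump_def[abs_def] bump_real_def of_real_prod of_real_mult
  using smooth_cutoff[of c 0 1 _ "- a $ _"] smooth_cutoff[of c 0 "-1" _ "b $ _"]
  by (intro smooth_prod smooth_mult) (auto simp: algebra_simps)

lemma bump_test_function:
  assumes "0 < c" "cbox a b \<subseteq> \<Omega>"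
  shows "bump c a b \<in> test_functions \<Omega>"
  by (rule test_functionsI[of _ "cbox a b"])
     (use assms in \<open>auto simp: smooth_bump bump_def bump_real_outside[OF contra_subsetD[OF box_subset_cbox]]\<close>)

lemma bump_real_tendsto:
  assumes "x \<in> box a b"
  shows "(\<lambda>k. bump_real (inverse (real (Suc k))) a b x) \<longlonglongrightarrow> 1"
proof -
  have *: "(\<lambda>k. exp_cutoff (inverse (real (Suc k))) 0 t) \<longlonglongrightarrow> 1" if "0 < t" for t
  proof -
    have "(\<lambda>k. exp (- (inverse (real (Suc k)) / t))) \<longlonglongrightarrow> exp (- (0 / t))"
      using that LIMSEQ_inverse_real_of_nat by (intro tendsto_intros) auto
    then show ?thesis using that by (simp add: exp_cutoff_0)
  qed
  have "(\<lambda>k. bump_real (inverse (real (Suc k))) a b x) \<longlonglongrightarrow> (\<Prod>i\<in>(UNIV::'a set). 1 * 1)"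
    unfolding bump_real_def using assms
    by (intro tendsto_prod tendsto_mult *) (auto simp: mem_box_cart)
  then show ?thesis by simp
qed

section \<open>Smooth division and localisation of distributions\<close>

text \<open>\<open>F\<close> may vanish off the support of \<open>f\<close>. The invariant consists
  of the quotients g / F^m with \<open>g\<close> supported where \<open>f\<close> is; the quotient
  rule raises \<open>m\<close> and keeps the support of the numerator.\<close>

lemma smooth_divide:
  fixes f F :: "real^'n \<Rightarrow> complex"
  assumes f: "smooth f" and F: "smooth F" and nz: "\<And>x. x \<in> fun_supp f \<Longrightarrow> F x \<noteq> 0"
  shows "smooth (\<lambda>x. f x / F x)"
proof -
  define S where "S = {\<lambda>x. g x * inverse (F x) ^ m | g m. smooth g \<and> fun_supp g \<subseteq> fun_supp f}"
  have d: "((\<lambda>x. g x * inverse (F x) ^ m) has_derivative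
      (\<lambda>h. (frechet_derivative g (at x) h * F x - of_nat m * g x * frechet_derivative F (at x) h)
        * inverse (F x) ^ (m + 1))) (at x)" (is "(?G has_derivative ?D x) _")
    if g: "smooth g" "fun_supp g \<subseteq> fun_supp f" for g m x
  proof (cases "x \<in> fun_supp f")
    case True
    then have Fx: "F x \<noteq> 0" by (rule nz)
    have "((\<lambda>z. inverse z ^ m) has_field_derivative (- of_nat m * inverse (F x) ^ (m + 1))) (at (F x))"
    proof -
      have "(inverse has_field_derivative - (inverse (F x) * inverse (F x))) (at (F x))"
        using DERIV_inverse[OF Fx] by simp
      from DERIV_power[OF this, of m] show ?thesis by (cases m) (simp_all add: algebra_simps)
    qed
    from has_derivative_compose[OF smooth_has_derivative[OF F] this[unfolded has_field_derivative_def]]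
    have "((\<lambda>x. inverse (F x) ^ m) has_derivative
        (\<lambda>h. - of_nat m * inverse (F x) ^ (m + 1) * frechet_derivative F (at x) h)) (at x)" .
    from has_derivative_mult[OF smooth_has_derivative[OF g(1)] this]
    have "(?G has_derivative (\<lambda>h. g x * (- of_nat m * inverse (F x) ^ (m + 1) * frechet_derivative F (at x) h)
        + frechet_derivative g (at x) h * inverse (F x) ^ m)) (at x)" .
    moreover have "(\<lambda>h. g x * (- of_nat m * inverse (F x) ^ (m + 1) * frechet_derivative F (at x) h)
        + frechet_derivative g (at x) h * inverse (F x) ^ m) = ?D x"
      using Fx by (auto simp: fun_eq_iff algebra_simps)
    ultimately show ?thesis by simp
  next
    \<comment> \<open>Near such a point the quotient is identically 0, whatever \<open>F\<close>
      does, because the complement of the support is open.\<close>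
    case False
    have "((\<lambda>x. 0) has_derivative (\<lambda>h. 0)) (at x)" by simp
    then have 0: "(k has_derivative (\<lambda>h. 0)) (at x)" if "\<And>y. y \<notin> fun_supp f \<Longrightarrow> k y = 0"
      for k :: "real^'n \<Rightarrow> complex"
      by (rule has_derivative_transform_within_open[of _ _ _ _ "- fun_supp f"])
         (use False that in \<open>auto simp: closed_fun_supp open_Compl\<close>)
    have gz: "g y = 0" if "y \<notin> fun_supp f" for y using that g not_in_fun_supp by blast
    have "frechet_derivative g (at x) = (\<lambda>h. 0)"
      by (rule frechet_derivative_at[OF 0[OF gz], symmetric])
    moreover have "(?G has_derivative (\<lambda>h. 0)) (at x)" by (rule 0) (simp add: gz)
    ultimately show ?thesis using gz[OF False] by simp
  qed
  have "(\<lambda>x. f x * inverse (F x) ^ 1) \<in> S" unfolding S_def using f by blast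
  then have "(\<lambda>x. f x / F x) \<in> S" by (simp add: divide_inverse)
  then show ?thesis
  proof (rule smooth_coinduct)
    fix q assume "q \<in> S"
    then obtain g m where q: "q = (\<lambda>x. g x * inverse (F x) ^ m)" "smooth g" "fun_supp g \<subseteq> fun_supp f"
      unfolding S_def by blast
    show "q differentiable (at x)" for x
      unfolding q(1) using d[OF q(2,3)] by (rule differentiableI)
    fix i
    let ?g = "\<lambda>x. pd i g x * F x - of_nat m * g x * pd i F x"
    have "smooth ?g" using q(2) F by (intro smooth_diff smooth_mult smooth_scale smooth_pd)
    moreover have "fun_supp ?g \<subseteq> fun_supp f"
    proof (rule fun_supp_subset[OF closed_fun_supp])
      fix x assume x: "x \<notin> fun_supp f"
      have "g y = 0" if "y \<notin> fun_supp f" for y using that q not_in_fun_supp by blast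
      with pd_eq_0[OF closed_fun_supp this x, where i=i] x show "?g x = 0" by simp
    qed
    ultimately show "pd i q \<in> S"
      unfolding q(1) pd_eqI[OF d[OF q(2,3)]] S_def
      by (intro CollectI exI[of _ ?g] exI[of _ "m + 1"] conjI refl)
  qed
qed

lemma antilinear_on_sum:
  assumes u: "antilinear_on A u" and z: "(\<lambda>x. 0) \<in> A" "\<And>f g. f \<in> A \<Longrightarrow> g \<in> A \<Longrightarrow> (\<lambda>x. f x + g x) \<in> A"
    and f: "\<And>i. i \<in> I \<Longrightarrow> f i \<in> A"
  shows "(\<lambda>x. \<Sum>i\<in>I. f i x) \<in> A \<and> u (\<lambda>x. \<Sum>i\<in>I. f i x) = (\<Sum>i\<in>I. u (f i))"
proof -
  have add: "u (\<lambda>x. f x + g x) = u f + u g" if "f \<in> A" "g \<in> A" for f g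
    using u[unfolded antilinear_on_def, rule_format, OF that, of 1 1] by simp
  have 0: "u (\<lambda>x. 0) = 0"
    using u[unfolded antilinear_on_def, rule_format, OF z(1) z(1), of 0 0] by simp
  show ?thesis using f
    by (induction I rule: infinite_finite_induct) (auto simp: 0 z add)
qed

text \<open>A smooth partition of unity made of bumps on boxes.\<close>

lemma vanishes_off_support:
  fixes \<Omega> :: "(real^'n) set"
  assumes u: "antilinear_on schwartz u" and supp: "dist_supp u \<subseteq> - \<Omega>" and \<phi>: "\<phi> \<in> test_functions \<Omega>"
  shows "u \<phi> = 0"
proof -
  let ?K = "fun_supp \<phi>"
  let ?N = "\<lambda>V. \<forall>\<psi>\<in>test_functions V. u \<psi> = 0"
  \<comment> \<open>Vanishing is recorded for closed boxes, since these contain the supports of the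
    bumps, while the open boxes do the covering.\<close>
  define P where "P = {(a, b). ?N (cbox a (b::real^'n))}"
  have K: "compact ?K" "?K \<subseteq> \<Omega>" using \<phi> by (auto dest: test_functionsD)
  have "?K \<subseteq> (\<Union>p\<in>P. case_prod box p)"
  proof
    fix x assume "x \<in> ?K"
    then obtain V where V: "open V" "x \<in> V" "?N V"
      using K supp unfolding dist_supp_def by blast
    from open_contains_cbox[OF V(1,2)]
    obtain a b where ab: "x \<in> box a b" "cbox a b \<subseteq> V" by metis
    then have "(a, b) \<in> P" using V test_functions_mono unfolding P_def by blast
    then show "x \<in> (\<Union>p\<in>P. case_prod box p)" using ab by blast
  qed
  then obtain B where B: "B \<subseteq> P" "finite B" "?K \<subseteq> (\<Union>p\<in>B. case_prod box p)"
    using compactE_image[OF K(1), of P "case_prod box"] by (auto simp: split_beta open_box)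
  define F where "F x = (\<Sum>p\<in>B. bump 1 (fst p) (snd p) x)" for x
  have F: "smooth F" unfolding F_def by (intro smooth_sum smooth_bump) simp
  have Fnz: "F x \<noteq> 0" if "x \<in> ?K" for x
  proof -
    from subsetD[OF B(3) that] obtain p where "p \<in> B" "x \<in> case_prod box p" by (rule UN_E)
    then have p: "p \<in> B" "x \<in> box (fst p) (snd p)" by (simp_all add: split_beta)
    have "0 < (\<Sum>p\<in>B. bump_real 1 (fst p) (snd p) x)"
      using B(2) p bump_real_pos by (intro sum_pos2[of _ p]) (auto simp: bump_real_nonneg)
    moreover have "F x = of_real (\<Sum>p\<in>B. bump_real 1 (fst p) (snd p) x)" by (simp add: F_def bump_def)
    ultimately show ?thesis using of_real_eq_0_iff less_irrefl by metis
  qed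
  let ?g = "\<lambda>x. \<phi> x / F x"
  have g: "smooth ?g" using \<phi> F Fnz by (intro smooth_divide) (auto dest: test_functionsD)
  \<comment> \<open>The quotients of single bumps by \<open>F\<close> need not be smooth where
    \<open>F\<close> vanishes; dividing \<phi> by \<open>F\<close> first keeps every factor
    smooth.\<close>
  let ?h = "\<lambda>p x. bump 1 (fst p) (snd p) x * ?g x"
  have h: "?h p \<in> test_functions (cbox (fst p) (snd p))" for p
    using g by (intro test_functions_mult bump_test_function) auto
  have eq: "\<phi> = (\<lambda>x. \<Sum>p\<in>B. ?h p x)"
  proof
    fix x show "\<phi> x = (\<Sum>p\<in>B. ?h p x)"
      unfolding sum_distrib_right[symmetric] F_def[symmetric]
      using Fnz[of x] not_in_fun_supp[of x \<phi>] by (cases "x \<in> ?K") auto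
  qed
  have "u \<phi> = (\<Sum>p\<in>B. u (?h p))"
    by (subst eq) (use antilinear_on_sum[OF u schwartz_zero schwartz_add, of B ?h] h test_functions_schwartz in blast)
  also have "\<dots> = 0"
  proof (rule sum.neutral, rule ballI)
    fix p assume "p \<in> B"
    then have "?N (cbox (fst p) (snd p))" using B(1) by (auto simp: P_def)
    then show "u (?h p) = 0" using h by blast
  qed
  finally show ?thesis .
qed

section \<open>Uniqueness of densities\<close>

text \<open>\<open>ennreal\<close> cuts negative values to 0, so the two densities are the positive
  and the negative part of \<open>h\<close>. The measures agree on boxes, an intersection-stable
  generator of the Borel sets, hence everywhere; and positive and negative parts that are equal are
  both 0.\<close>

lemma AE_zero_if_box_integrals_zero:
  fixes h :: "real^'n \<Rightarrow> real"
  assumes [measurable]: "h \<in> borel_measurable borel"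
    and int: "\<And>a b. set_integrable lborel (box a b) h"
    and zero: "\<And>a b. (LINT x:box a b|lborel. h x) = 0"
  shows "AE x in lborel. h x = 0"
proof -
  let ?M = "density lborel (\<lambda>x. ennreal (h x))" and ?N = "density lborel (\<lambda>x. ennreal (- h x))"
  have pos: "emeasure (density lborel (\<lambda>x. ennreal (h x))) (box a b) = ennreal (LINT x|lborel. indicator (box a b) x * max 0 (h x))"
    and fin: "integrable lborel (\<lambda>x. indicator (box a b) x * max 0 (h x))"
    if int: "set_integrable lborel (box a b) h" and [measurable]: "h \<in> borel_measurable borel"
    for a b and h :: "real^'n \<Rightarrow> real"
  proof -
    show 1: "integrable lborel (\<lambda>x. indicator (box a b) x * max 0 (h x))"
      by (rule Bochner_Integration.integrable_bound[OF int[unfolded set_integrable_def]])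
         (auto simp: indicator_def)
    have "emeasure (density lborel (\<lambda>x. ennreal (h x))) (box a b)
        = (\<integral>\<^sup>+x. ennreal (indicator (box a b) x * max 0 (h x)) \<partial>lborel)"
      by (subst emeasure_density) (auto intro!: nn_integral_cong simp: indicator_def max_def ennreal_neg)
    also have "\<dots> = ennreal (LINT x|lborel. indicator (box a b) x * max 0 (h x))"
      by (rule nn_integral_eq_integral[OF 1]) (simp add: indicator_def)
    finally show "emeasure (density lborel (\<lambda>x. ennreal (h x))) (box a b)
        = ennreal (LINT x|lborel. indicator (box a b) x * max 0 (h x))" .
  qed
  have intm: "set_integrable lborel (box a b) (\<lambda>x. - h x)" for a b
    using int[of a b] unfolding set_integrable_def by simp
  have "?M = ?N"
  proof (rule measure_eqI_generator_eq)
    let ?E = "range (\<lambda>(a, b). box a b::(real^'n) set)"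
    show "Int_stable ?E"
      by (auto simp: Int_stable_def box_Int_box)
    show "?E \<subseteq> Pow UNIV" "sets ?M = sigma_sets UNIV ?E" "sets ?N = sigma_sets UNIV ?E"
      by (simp_all add: borel_eq_box)
    let ?A = "\<lambda>n::nat. box (- (real n *\<^sub>R One)) (real n *\<^sub>R One) :: (real^'n) set"
    show "range ?A \<subseteq> ?E" "(\<Union>i. ?A i) = UNIV"
      unfolding UN_box_eq_UNIV by auto
    show "emeasure ?M (?A i) \<noteq> \<infinity>" for i
      by (subst pos[OF int]) auto
    show "emeasure ?M X = emeasure ?N X" if X: "X \<in> ?E" for X
    proof -
      obtain a b where X: "X = box a b" using X by auto
      have "(LINT x|lborel. indicator (box a b) x * max 0 (h x)) - (LINT x|lborel. indicator (box a b) x * max 0 (- h x))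
          = (LINT x|lborel. indicator (box a b) x * max 0 (h x) - indicator (box a b) x * max 0 (- h x))"
        using fin[OF int, of a b] fin[OF intm, of a b] by (subst Bochner_Integration.integral_diff) auto
      also have "\<dots> = (LINT x:box a b|lborel. h x)"
        unfolding set_lebesgue_integral_def
        by (rule Bochner_Integration.integral_cong) (auto simp: indicator_def max_def)
      finally show ?thesis
        unfolding X using zero[of a b] by (simp add: pos[OF int] pos[OF intm])
    qed
  qed
  then have "AE x in lborel. ennreal (h x) = ennreal (- h x)"
    by (subst (asm) sigma_finite_measure.density_unique_iff[OF sigma_finite_lborel]) auto
  then show ?thesis
    by eventually_elim (metis ennreal_eq_0_iff ennreal_inj linear neg_0_le_iff_le neg_le_0_iff_le antisym)
qed

text \<open>Bumps sharpen to indicators of boxes, which reduces the claim to box integrals of the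
  real and imaginary parts. Local integrability of \<open>g\<close> is extracted from integrability
  against one bump that is bounded below on the box.\<close>

lemma density_zero:
  fixes g :: "real^'n \<Rightarrow> complex"
  assumes gm [measurable]: "g \<in> borel_measurable borel"
    and int: "\<And>\<psi>. \<psi> \<in> schwartz \<Longrightarrow> integrable lborel (\<lambda>\<xi>. g \<xi> * cnj (\<psi> \<xi>))"
    and zero: "\<And>\<psi>. \<psi> \<in> schwartz \<Longrightarrow> (\<integral>\<xi>. g \<xi> * cnj (\<psi> \<xi>) \<partial>lborel) = 0"
  shows "AE \<xi> in lborel. g \<xi> = 0"
proof -
  have bS: "bump c a b \<in> schwartz" if "0 < c" for c and a b :: "real^'n"
    using bump_test_function[OF that, of a b UNIV] test_functions_schwartz by blast
  have [measurable]: "bump_real c a b \<in> borel_measurable borel" for c and a b :: "real^'n"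
    unfolding bump_real_def exp_cutoff_def by measurable
  have loc: "integrable lborel (\<lambda>x. indicator (box a b) x *\<^sub>R g x)" for a b
  proof -
    \<comment> \<open>The bump lives on the box enlarged by 1 in each direction, so on the compact
      \<open>cbox a b\<close> it has a positive minimum.\<close>
    let ?f = "\<lambda>x. bump_real 1 (a - 1) (b + 1) x"
    have cont: "continuous_on (cbox a b) ?f"
    proof -
      have "continuous_on (cbox a b) (\<lambda>x. Re (bump 1 (a - 1) (b + 1) x))"
        by (intro continuous_intros smooth_continuous smooth_bump) simp
      then show ?thesis by (simp add: bump_def)
    qed
    obtain m where m: "m > 0" "\<And>x. x \<in> box a b \<Longrightarrow> m \<le> ?f x"
    proof (cases "cbox a b = {}")
      case True
      then show ?thesis using that[of 1] box_subset_cbox[of a b] by auto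
    next
      case False
      obtain y where y: "y \<in> cbox a b" "\<And>x. x \<in> cbox a b \<Longrightarrow> ?f y \<le> ?f x"
        using continuous_attains_inf[OF compact_cbox False cont] by blast
      have "y \<in> box (a - 1) (b + 1)" using y(1) 
        unfolding mem_box_cart by (simp add: less_diff_eq) (meson add_strict_increasing2 le_less_trans less_add_one zero_less_one diff_less_eq less_le_trans)
      then show ?thesis using that[of "?f y"] bump_real_pos y(2) box_subset_cbox by blast
    qed
    have "integrable lborel (\<lambda>x. (1 / m) *\<^sub>R (g x * cnj (bump 1 (a - 1) (b + 1) x)))"
      by (intro integrable_scaleR_right int bS) simp
    then show ?thesis
    proof (rule Bochner_Integration.integrable_bound)
      show "AE x in lborel. norm (indicator (box a b) x *\<^sub>R g x) \<le> norm ((1 / m) *\<^sub>R (g x * cnj (bump 1 (a - 1) (b + 1) x)))"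
      proof (rule AE_I2)
        fix x
        show "norm (indicator (box a b) x *\<^sub>R g x) \<le> norm ((1 / m) *\<^sub>R (g x * cnj (bump 1 (a - 1) (b + 1) x)))"
        proof (cases "x \<in> box a b")
          case True
          have "cmod (g x) * m \<le> cmod (g x) * ?f x" using m(2)[OF True] by (intro mult_left_mono) auto
          then show ?thesis using True m(1) bump_real_nonneg[of 1 "a - 1" "b + 1" x]
            by (simp add: bump_def norm_mult field_simps)
        qed simp
      qed
    qed measurable
  qed
  have box0: "(\<integral>x. indicator (box a b) x *\<^sub>R g x \<partial>lborel) = 0" for a b
  proof -
    let ?c = "\<lambda>k. inverse (real (Suc k))"
    have "(\<lambda>k. \<integral>x. g x * cnj (bump (?c k) a b x) \<partial>lborel) \<longlonglongrightarrow> (\<integral>x. indicator (box a b) x *\<^sub>R g x \<partial>lborel)"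
    proof (rule integral_dominated_convergence[where w="\<lambda>x. norm (indicator (box a b) x *\<^sub>R g x)"])
      show "AE x in lborel. (\<lambda>k. g x * cnj (bump (?c k) a b x)) \<longlonglongrightarrow> indicator (box a b) x *\<^sub>R g x"
      proof (rule AE_I2)
        fix x
        have "(\<lambda>k. bump_real (?c k) a b x) \<longlonglongrightarrow> indicator (box a b) x"
          using bump_real_tendsto[of x a b] by (cases "x \<in> box a b") (auto simp: bump_real_outside)
        then have "(\<lambda>k. g x * of_real (bump_real (?c k) a b x)) \<longlonglongrightarrow> g x * of_real (indicator (box a b) x)"
          by (intro tendsto_intros)
        then show "(\<lambda>k. g x * cnj (bump (?c k) a b x)) \<longlonglongrightarrow> indicator (box a b) x *\<^sub>R g x"
          by (simp add: bump_def scaleR_conv_of_real mult.commute)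
      qed
      show "AE x in lborel. norm (g x * cnj (bump (?c k) a b x)) \<le> norm (indicator (box a b) x *\<^sub>R g x)" for k
      proof (rule AE_I2)
        fix x
        show "norm (g x * cnj (bump (?c k) a b x)) \<le> norm (indicator (box a b) x *\<^sub>R g x)"
          using bump_real_le_1[of "?c k" a b x] bump_real_nonneg[of "?c k" a b x]
          by (cases "x \<in> box a b") (auto simp: bump_def norm_mult bump_real_outside mult_left_le)
      qed
      show "(\<lambda>x. g x * cnj (bump (?c k) a b x)) \<in> borel_measurable lborel" for k
        unfolding bump_def complex_cnj_complex_of_real by measurable
    qed (use loc[of a b] integrable_norm[OF loc[of a b]] in simp_all)
    then show ?thesis
      using zero[OF bS] LIMSEQ_unique[OF _ tendsto_const[of 0]] by simp
  qed
  have "AE x in lborel. Re (g x) = 0"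
  proof (rule AE_zero_if_box_integrals_zero)
    show "set_integrable lborel (box a b) (\<lambda>x. Re (g x))" for a b
      using integrable_Re[OF loc[of a b]] unfolding set_integrable_def by simp
    show "(LINT x:box a b|lborel. Re (g x)) = 0" for a b
      using integral_Re[OF loc[of a b]] box0[of a b] unfolding set_lebesgue_integral_def by simp
  qed measurable
  moreover have "AE x in lborel. Im (g x) = 0"
  proof (rule AE_zero_if_box_integrals_zero)
    show "set_integrable lborel (box a b) (\<lambda>x. Im (g x))" for a b
      using integrable_Im[OF loc[of a b]] unfolding set_integrable_def by simp
    show "(LINT x:box a b|lborel. Im (g x)) = 0" for a b
      using integral_Im[OF loc[of a b]] box0[of a b] unfolding set_lebesgue_integral_def by simp
  qed measurable
  ultimately show ?thesis by eventually_elim (simp add: complex_eq_iff)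
qed

section \<open>Weighted square-integrable functions\<close>

lemma borel_measurable_cnj [measurable (raw)]:
  "f \<in> borel_measurable M \<Longrightarrow> (\<lambda>x. cnj (f x)) \<in> borel_measurable M"
  by (rule measurable_compose[OF _ borel_measurable_continuous_onI]) (auto intro: continuous_intros)

definition sobolev_weight :: "real \<Rightarrow> real^'n \<Rightarrow> real" where
  "sobolev_weight s \<xi> = (1 + (norm \<xi>)\<^sup>2) powr s"

lemma one_plus_norm_sq_pos: "0 < 1 + (norm \<xi>)\<^sup>2"
  by (simp add: add_pos_nonneg)

lemma sobolev_weight_pos: "0 < sobolev_weight s \<xi>"
  using one_plus_norm_sq_pos[of \<xi>] by (simp add: sobolev_weight_def)

lemma sobolev_weight_nonneg [simp]: "0 \<le> sobolev_weight s \<xi>"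
  by (simp add: sobolev_weight_pos less_imp_le)

lemma sobolev_weight_measurable [measurable]: "sobolev_weight s \<in> borel_measurable borel"
  unfolding sobolev_weight_def by measurable

lemma sobolev_weight_add: "sobolev_weight s \<xi> * sobolev_weight t \<xi> = sobolev_weight (s + t) \<xi>"
  by (simp add: sobolev_weight_def powr_add)

lemma sobolev_weight_0 [simp]: "sobolev_weight 0 \<xi> = 1"
  using one_plus_norm_sq_pos[of \<xi>] by (simp add: sobolev_weight_def)

lemma sobolev_weight_half: "(sobolev_weight (s / 2) \<xi>)\<^sup>2 = sobolev_weight s \<xi>"
  by (simp add: power2_eq_square sobolev_weight_add)

lemma sobolev_weight_le: "sobolev_weight s \<xi> \<le> (1 + norm \<xi>) ^ (2 * nat \<lceil>\<bar>s\<bar>\<rceil>)"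
proof -
  have "s \<le> real (nat \<lceil>\<bar>s\<bar>\<rceil>)" by linarith
  then have "sobolev_weight s \<xi> \<le> (1 + (norm \<xi>)\<^sup>2) powr real (nat \<lceil>\<bar>s\<bar>\<rceil>)"
    unfolding sobolev_weight_def by (intro powr_mono) simp_all
  also have "\<dots> = (1 + (norm \<xi>)\<^sup>2) ^ nat \<lceil>\<bar>s\<bar>\<rceil>"
    by (rule powr_realpow[OF one_plus_norm_sq_pos])
  also have "\<dots> \<le> ((1 + norm \<xi>)\<^sup>2) ^ nat \<lceil>\<bar>s\<bar>\<rceil>"
    by (intro power_mono) (auto simp: power2_sum)
  finally show ?thesis by (simp add: power_mult)
qed

text \<open>Plain functions instead of classes modulo null sets; the passage to distributions by
  \<open>fourier_synthesis\<close> identifies those that are equal almost everywhere.\<close>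

definition weighted_L2 :: "real \<Rightarrow> (real^'n \<Rightarrow> complex) set" where
  "weighted_L2 s = {g. g \<in> borel_measurable borel \<and>
     integrable lborel (\<lambda>\<xi>. sobolev_weight s \<xi> * (cmod (g \<xi>))\<^sup>2)}"

definition weighted_sq :: "real \<Rightarrow> (real^'n \<Rightarrow> complex) \<Rightarrow> real" where
  "weighted_sq s g = (\<integral>\<xi>. sobolev_weight s \<xi> * (cmod (g \<xi>))\<^sup>2 \<partial>lborel)"

definition weighted_inner :: "real \<Rightarrow> (real^'n \<Rightarrow> complex) \<Rightarrow> (real^'n \<Rightarrow> complex) \<Rightarrow> complex" where
  "weighted_inner s g h = (\<integral>\<xi>. of_real (sobolev_weight s \<xi>) * g \<xi> * cnj (h \<xi>) \<partial>lborel)"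

lemma
  assumes "g \<in> weighted_L2 s"
  shows weighted_L2_measurable: "g \<in> borel_measurable borel"
    and weighted_L2_integrable: "integrable lborel (\<lambda>\<xi>. sobolev_weight s \<xi> * (cmod (g \<xi>))\<^sup>2)"
  using assms by (auto simp: weighted_L2_def)

lemma weighted_sq_nonneg [simp]: "0 \<le> weighted_sq s g"
  unfolding weighted_sq_def by (intro Bochner_Integration.integral_nonneg mult_nonneg_nonneg) auto

lemma weighted_L2_bound:
  assumes g: "g \<in> weighted_L2 s" "h \<in> weighted_L2 s" and [measurable]: "f \<in> borel_measurable borel"
    and le: "\<And>\<xi>. (cmod (f \<xi>))\<^sup>2 \<le> a * (cmod (g \<xi>))\<^sup>2 + b * (cmod (h \<xi>))\<^sup>2"
  shows "f \<in> weighted_L2 s" "weighted_sq s f \<le> a * weighted_sq s g + b * weighted_sq s h"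
proof -
  let ?r = "\<lambda>\<xi>. a * (sobolev_weight s \<xi> * (cmod (g \<xi>))\<^sup>2) + b * (sobolev_weight s \<xi> * (cmod (h \<xi>))\<^sup>2)"
  have i: "integrable lborel ?r"
    using g by (intro Bochner_Integration.integrable_add integrable_mult_right weighted_L2_integrable)
  have le': "sobolev_weight s \<xi> * (cmod (f \<xi>))\<^sup>2 \<le> ?r \<xi>" for \<xi>
    using mult_left_mono[OF le sobolev_weight_nonneg, of s \<xi> \<xi>] by (simp add: algebra_simps)
  have fi: "integrable lborel (\<lambda>\<xi>. sobolev_weight s \<xi> * (cmod (f \<xi>))\<^sup>2)"
    by (rule Bochner_Integration.integrable_bound[OF i])
       (use le' in \<open>auto intro!: order_trans[OF _ abs_ge_self]\<close>)
  then show "f \<in> weighted_L2 s" by (simp add: weighted_L2_def)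
  have "weighted_sq s f \<le> (\<integral>\<xi>. ?r \<xi> \<partial>lborel)"
    unfolding weighted_sq_def by (intro integral_mono fi i le')
  also have "\<dots> = a * weighted_sq s g + b * weighted_sq s h"
    unfolding weighted_sq_def using g
    by (subst Bochner_Integration.integral_add)
       (auto intro: integrable_mult_right weighted_L2_integrable)
  finally show "weighted_sq s f \<le> a * weighted_sq s g + b * weighted_sq s h" .
qed

text \<open>Replaces the triangle inequality, so that all estimates stay on the level of squared
  norms; letting \<open>t\<close> tend to 0 recovers the sharp constant 1 in front of
  \<open>x\<close>.\<close>

lemma cmod_add_sq_le:
  assumes "0 < t"
  shows "(cmod (x + y))\<^sup>2 \<le> (1 + t) * (cmod x)\<^sup>2 + (1 + 1 / t) * (cmod y)\<^sup>2"
proof -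
  have "0 \<le> (t * cmod x - cmod y)\<^sup>2" by simp
  then have "2 * (t * cmod x * cmod y) \<le> t * (t * (cmod x)\<^sup>2) + (cmod y)\<^sup>2"
    by (simp add: power2_eq_square algebra_simps)
  then have "2 * (cmod x * cmod y) \<le> t * (cmod x)\<^sup>2 + (cmod y)\<^sup>2 / t"
    using assms by (simp add: field_simps power2_eq_square)
  moreover have "(cmod (x + y))\<^sup>2 \<le> (cmod x + cmod y)\<^sup>2"
    by (intro power_mono norm_triangle_ineq) simp
  ultimately show ?thesis by (simp add: power2_sum algebra_simps)
qed

lemma weighted_L2_scale:
  assumes g: "g \<in> weighted_L2 s"
  shows "(\<lambda>\<xi>. c * g \<xi>) \<in> weighted_L2 s"
proof -
  note [measurable] = weighted_L2_measurable[OF g]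
  show ?thesis
    by (rule weighted_L2_bound(1)[OF g g, of _ "(cmod c)\<^sup>2" 0]) (auto simp: norm_mult power_mult_distrib)
qed

lemma weighted_L2_add:
  assumes g: "g \<in> weighted_L2 s" and h: "h \<in> weighted_L2 s"
  shows "(\<lambda>\<xi>. g \<xi> + h \<xi>) \<in> weighted_L2 s"
proof -
  note [measurable] = weighted_L2_measurable[OF g] weighted_L2_measurable[OF h]
  show ?thesis
    by (rule weighted_L2_bound(1)[OF g h, of _ "1 + 1" "1 + 1 / 1"]) (measurable, rule cmod_add_sq_le, simp)
qed

lemma weighted_L2_lincomb:
  "g \<in> weighted_L2 s \<Longrightarrow> h \<in> weighted_L2 s \<Longrightarrow> (\<lambda>\<xi>. a * g \<xi> + b * h \<xi>) \<in> weighted_L2 s"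
  by (intro weighted_L2_add weighted_L2_scale)

lemma weighted_L2_diff:
  "g \<in> weighted_L2 s \<Longrightarrow> h \<in> weighted_L2 s \<Longrightarrow> (\<lambda>\<xi>. g \<xi> - h \<xi>) \<in> weighted_L2 s"
  using weighted_L2_lincomb[of g s h 1 "-1"] by simp

text \<open>The weights of orders \<open>s / 2\<close> and \<open>- s / 2\<close> cancel pointwise,
  which makes the orders \<open>s\<close> and \<open>- s\<close> dual. Young's inequality with a
  free parameter \<open>t\<close> plays the part of Cauchy-Schwarz.\<close>

lemma weighted_pairing:
  fixes p :: "real^'n \<Rightarrow> complex"
  assumes g: "g \<in> weighted_L2 s" and p: "p \<in> weighted_L2 (- s)" and t: "0 < t"
  shows "integrable lborel (\<lambda>\<xi>. cmod (g \<xi>) * cmod (p \<xi>))"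
    and "(\<integral>\<xi>. cmod (g \<xi>) * cmod (p \<xi>) \<partial>lborel) \<le> (t * weighted_sq s g + weighted_sq (- s) p / t) / 2"
proof -
  have [measurable]: "g \<in> borel_measurable borel" "p \<in> borel_measurable borel"
    using g p by (auto dest: weighted_L2_measurable)
  let ?r = "\<lambda>\<xi>. (t / 2) * (sobolev_weight s \<xi> * (cmod (g \<xi>))\<^sup>2) + (1 / (2 * t)) * (sobolev_weight (- s) \<xi> * (cmod (p \<xi>))\<^sup>2)"
  have i: "integrable lborel ?r"
    using g p by (intro Bochner_Integration.integrable_add integrable_mult_right weighted_L2_integrable)
  have le: "cmod (g \<xi>) * cmod (p \<xi>) \<le> ?r \<xi>" for \<xi>
  proof -
    define x where "x = sobolev_weight (s / 2) \<xi> * cmod (g \<xi>)"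
    define y where "y = sobolev_weight (- s / 2) \<xi> * cmod (p \<xi>)"
    have "0 \<le> (t * x - y)\<^sup>2" by simp
    then have "2 * (t * (x * y)) \<le> t * (t * x\<^sup>2) + y\<^sup>2"
      by (simp add: power2_eq_square algebra_simps)
    then have "x * y \<le> (t / 2) * x\<^sup>2 + (1 / (2 * t)) * y\<^sup>2"
      using t by (simp add: field_simps)
    moreover have "x * y = (sobolev_weight (s / 2) \<xi> * sobolev_weight (- s / 2) \<xi>) * (cmod (g \<xi>) * cmod (p \<xi>))"
      unfolding x_def y_def by (simp only: mult_ac)
    then have xy: "x * y = cmod (g \<xi>) * cmod (p \<xi>)"
      unfolding sobolev_weight_add by simp
    moreover have "x\<^sup>2 = sobolev_weight s \<xi> * (cmod (g \<xi>))\<^sup>2" "y\<^sup>2 = sobolev_weight (- s) \<xi> * (cmod (p \<xi>))\<^sup>2"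
      unfolding x_def y_def power_mult_distrib sobolev_weight_half by simp_all
    ultimately show ?thesis by (simp only:)
  qed
  show fi: "integrable lborel (\<lambda>\<xi>. cmod (g \<xi>) * cmod (p \<xi>))"
    by (rule Bochner_Integration.integrable_bound[OF i])
       (use le in \<open>auto intro!: order_trans[OF _ abs_ge_self]\<close>)
  have "(\<integral>\<xi>. cmod (g \<xi>) * cmod (p \<xi>) \<partial>lborel) \<le> (\<integral>\<xi>. ?r \<xi> \<partial>lborel)"
    by (intro integral_mono fi i le)
  also have "\<dots> = (t * weighted_sq s g + weighted_sq (- s) p / t) / 2"
    unfolding weighted_sq_def
    using Bochner_Integration.integral_add[OF integrable_mult_right[OF weighted_L2_integrable[OF g]]
        integrable_mult_right[OF weighted_L2_integrable[OF p]], of "t / 2" "1 / (2 * t)"]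
    by (simp add: add_divide_distrib mult.commute)
  finally show "(\<integral>\<xi>. cmod (g \<xi>) * cmod (p \<xi>) \<partial>lborel) \<le> (t * weighted_sq s g + weighted_sq (- s) p / t) / 2" .
qed

lemma weighted_pairing_small:
  assumes p: "p \<in> weighted_L2 (- s)" and e: "0 < e"
  shows "\<exists>\<delta>>0. \<forall>g\<in>weighted_L2 s. weighted_sq s g < \<delta> \<longrightarrow> (\<integral>\<xi>. cmod (g \<xi>) * cmod (p \<xi>) \<partial>lborel) < e"
proof -
  \<comment> \<open>Makes the contribution of \<open>p\<close> to the Young bound less than
    \<open>e\<close>; adding 1 keeps \<open>t\<close> positive. The contribution of \<open>g\<close>
    is then controlled by \<delta> = e / t.\<close>
  define t where "t = (weighted_sq (- s) p + 1) / e"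
  have t: "0 < t" using e by (simp add: t_def add_nonneg_pos)
  have "w / ((w + 1) / e) < e" if "0 \<le> w" for w
    using that e by (simp add: divide_simps)
  then have "weighted_sq (- s) p / t < e" unfolding t_def by simp
  moreover have "t * weighted_sq s g < e" if "weighted_sq s g < e / t" for g :: "real^'a \<Rightarrow> complex"
    using that t by (simp add: field_simps)
  ultimately have "(\<integral>\<xi>. cmod (g \<xi>) * cmod (p \<xi>) \<partial>lborel) < e"
    if "g \<in> weighted_L2 s" "weighted_sq s g < e / t" for g
    using weighted_pairing(2)[OF that(1) p t] that(2) by fastforce
  then show ?thesis using e t by (intro exI[of _ "e / t"]) auto
qed

lemma weighted_pairing_integrable:
  assumes g: "g \<in> weighted_L2 s" and p: "p \<in> weighted_L2 (- s)"
  shows "integrable lborel (\<lambda>\<xi>. g \<xi> * cnj (p \<xi>))"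
proof -
  note [measurable] = weighted_L2_measurable[OF g] weighted_L2_measurable[OF p]
  show ?thesis
    by (rule Bochner_Integration.integrable_bound[OF weighted_pairing(1)[OF g p zero_less_one]])
       (auto simp: norm_mult)
qed

text \<open>A nowhere vanishing member of \<open>weighted_L2 s\<close>:
  \<open>nat \<lceil>\<bar>s\<bar>\<rceil>\<close> powers compensate the weight, and
  \<open>CARD('n)\<close> more leave the integrable \<open>decay_weight\<close> after squaring.
  Taken at \<open>- s\<close>, its product with any member of \<open>weighted_L2 s\<close> is in
  L^1.\<close>

definition dual_decay :: "real \<Rightarrow> real^'n \<Rightarrow> complex" where
  "dual_decay s \<xi> = of_real (inverse ((1 + norm \<xi>) ^ (nat \<lceil>\<bar>s\<bar>\<rceil> + CARD('n))))"

lemma one_plus_norm_power_pos: "0 < (1 + norm \<xi>) ^ k"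
  by (intro zero_less_power add_pos_nonneg) auto

lemma cmod_dual_decay:
  fixes \<xi> :: "real^'n"
  shows "cmod (dual_decay s \<xi>) = inverse ((1 + norm \<xi>) ^ (nat \<lceil>\<bar>s\<bar>\<rceil> + CARD('n)))"
  unfolding dual_decay_def norm_of_real
  using one_plus_norm_power_pos[of \<xi>] by (simp only: abs_of_pos positive_imp_inverse_positive)

lemma dual_decay_weighted_L2: "(dual_decay s :: real^'n \<Rightarrow> complex) \<in> weighted_L2 s"
proof -
  have m [measurable]: "(dual_decay s :: real^'n \<Rightarrow> complex) \<in> borel_measurable borel"
    unfolding dual_decay_def by measurable
  have "sobolev_weight s \<xi> * (cmod (dual_decay s \<xi>))\<^sup>2 \<le> decay_weight \<xi>" for \<xi> :: "real^'n"
  proof -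
    let ?x = "1 + norm \<xi>" and ?N = "nat \<lceil>\<bar>s\<bar>\<rceil>"
    have x: "0 < ?x" by (simp add: add_pos_nonneg)
    have "(cmod (dual_decay s \<xi>))\<^sup>2 = inverse (?x ^ (2 * ?N)) * decay_weight \<xi>"
      unfolding cmod_dual_decay decay_weight_def power_inverse power_mult[symmetric]
        inverse_mult_distrib[symmetric] power_add[symmetric] by (simp add: algebra_simps)
    then have "sobolev_weight s \<xi> * (cmod (dual_decay s \<xi>))\<^sup>2
        \<le> ?x ^ (2 * ?N) * (inverse (?x ^ (2 * ?N)) * decay_weight \<xi>)"
      using x decay_weight_pos[of \<xi>] by (auto intro!: mult_mono sobolev_weight_le simp: less_imp_le)
    then show ?thesis unfolding mult.assoc[symmetric] using x by simp
  qed
  then have "integrable lborel (\<lambda>\<xi>::real^'n. sobolev_weight s \<xi> * (cmod (dual_decay s \<xi>))\<^sup>2)"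
    by (intro Bochner_Integration.integrable_bound[OF integrable_decay_weight])
       (auto intro!: order_trans[OF _ abs_ge_self])
  then show ?thesis using m by (simp add: weighted_L2_def)
qed

lemma rapid_weighted_L2:
  assumes "rapid p" and [measurable]: "p \<in> borel_measurable borel"
  shows "p \<in> weighted_L2 s"
proof -
  obtain C where C: "\<And>\<xi>. (1 + norm \<xi>) ^ (nat \<lceil>\<bar>s\<bar>\<rceil> + CARD('a)) * cmod (p \<xi>) \<le> C"
    using assms(1) unfolding rapid_def by blast
  have le: "cmod (p \<xi>) \<le> C * cmod (dual_decay s \<xi>)" for \<xi>
    using C[of \<xi>] one_plus_norm_power_pos[of \<xi>] unfolding cmod_dual_decay by (simp add: field_simps)
  have "(cmod (p \<xi>))\<^sup>2 \<le> C\<^sup>2 * (cmod (dual_decay s \<xi>))\<^sup>2 + 0 * (cmod (dual_decay s \<xi>))\<^sup>2" for \<xi>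
    using power_mono[OF le[of \<xi>], of 2] by (simp add: power_mult_distrib)
  then show ?thesis
    by (rule weighted_L2_bound(1)[OF dual_decay_weighted_L2 dual_decay_weighted_L2 assms(2)])
qed

lemma schwartz_weighted_L2: "f \<in> schwartz \<Longrightarrow> f \<in> weighted_L2 s"
  by (simp add: rapid_weighted_L2 schwartz_measurable schwartz_rapid)

section \<open>Sobolev spaces as weighted spaces\<close>

text \<open>The inverse Fourier transform of \<open>g\<close> as a distribution, with the transform
  moved onto the test function by Parseval's identity.\<close>

definition fourier_synthesis :: "(real^'n \<Rightarrow> complex) \<Rightarrow> (real^'n \<Rightarrow> complex) \<Rightarrow> complex" where
  "fourier_synthesis g = on_space schwartz (\<lambda>\<psi>. \<integral>\<xi>. g \<xi> * cnj (fourier \<psi> \<xi>) \<partial>lborel)"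

lemma fourier_synthesis_eq:
  "\<psi> \<in> schwartz \<Longrightarrow> fourier_synthesis g \<psi> = (\<integral>\<xi>. g \<xi> * cnj (fourier \<psi> \<xi>) \<partial>lborel)"
  by (simp add: fourier_synthesis_def on_space_def)

lemma fourier_synthesis_integrable:
  "g \<in> weighted_L2 s \<Longrightarrow> \<psi> \<in> schwartz \<Longrightarrow> integrable lborel (\<lambda>\<xi>. g \<xi> * cnj (fourier \<psi> \<xi>))"
  by (rule weighted_pairing_integrable) (auto intro: schwartz_weighted_L2 fourier_schwartz)

lemma fourier_synthesis_lincomb:
  assumes "g \<in> weighted_L2 s" "h \<in> weighted_L2 s"
  shows "fourier_synthesis (\<lambda>\<xi>. a * g \<xi> + b * h \<xi>)
    = (\<lambda>\<psi>. a * fourier_synthesis g \<psi> + b * fourier_synthesis h \<psi>)"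
proof
  fix \<psi> :: "real^'a \<Rightarrow> complex"
  show "fourier_synthesis (\<lambda>\<xi>. a * g \<xi> + b * h \<xi>) \<psi>
      = a * fourier_synthesis g \<psi> + b * fourier_synthesis h \<psi>"
  proof (cases "\<psi> \<in> schwartz")
    case True
    have "(\<integral>\<xi>. (a * g \<xi> + b * h \<xi>) * cnj (fourier \<psi> \<xi>) \<partial>lborel)
        = (\<integral>\<xi>. a * (g \<xi> * cnj (fourier \<psi> \<xi>)) + b * (h \<xi> * cnj (fourier \<psi> \<xi>)) \<partial>lborel)"
      by (simp add: algebra_simps)
    also have "\<dots> = a * (\<integral>\<xi>. g \<xi> * cnj (fourier \<psi> \<xi>) \<partial>lborel) + b * (\<integral>\<xi>. h \<xi> * cnj (fourier \<psi> \<xi>) \<partial>lborel)"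
      using assms[THEN fourier_synthesis_integrable, OF True]
      by (subst Bochner_Integration.integral_add) auto
    finally show ?thesis using True by (simp add: fourier_synthesis_eq)
  qed (simp add: fourier_synthesis_def on_space_def)
qed

lemma antilinear_fourier_synthesis:
  fixes g :: "real^'n \<Rightarrow> complex"
  assumes g: "g \<in> weighted_L2 s"
  shows "antilinear_on schwartz (fourier_synthesis g)"
  unfolding antilinear_on_def
proof (intro ballI allI)
  fix \<phi> \<psi> :: "real^'n \<Rightarrow> complex" and a b
  assume S: "\<phi> \<in> schwartz" "\<psi> \<in> schwartz"
  have "(\<integral>\<xi>. g \<xi> * cnj (fourier (\<lambda>x. a * \<phi> x + b * \<psi> x) \<xi>) \<partial>lborel)
      = (\<integral>\<xi>. cnj a * (g \<xi> * cnj (fourier \<phi> \<xi>)) + cnj b * (g \<xi> * cnj (fourier \<psi> \<xi>)) \<partial>lborel)"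
    using S by (simp add: fourier_lincomb schwartz_integrable algebra_simps)
  also have "\<dots> = cnj a * (\<integral>\<xi>. g \<xi> * cnj (fourier \<phi> \<xi>) \<partial>lborel) + cnj b * (\<integral>\<xi>. g \<xi> * cnj (fourier \<psi> \<xi>) \<partial>lborel)"
    using S[THEN fourier_synthesis_integrable[OF g]]
    by (subst Bochner_Integration.integral_add) auto
  finally show "fourier_synthesis g (\<lambda>x. a * \<phi> x + b * \<psi> x)
      = cnj a * fourier_synthesis g \<phi> + cnj b * fourier_synthesis g \<psi>"
    using S by (simp add: fourier_synthesis_eq schwartz_lincomb)
qed

text \<open>Schwartz convergence bounds the difference of the transforms by a null sequence times
  \<open>dual_decay (- s)\<close>, which is integrable against \<open>g\<close>.\<close>

lemma tempered_fourier_synthesis: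
  fixes g :: "real^'n \<Rightarrow> complex"
  assumes g: "g \<in> weighted_L2 s"
  shows "fourier_synthesis g \<in> tempered"
  unfolding tempered_def
proof (intro CollectI conjI allI impI)
  show "fourier_synthesis g \<phi> = 0" if "\<phi> \<notin> schwartz" for \<phi>
    using that by (simp add: fourier_synthesis_def on_space_def)
  show "antilinear_on schwartz (fourier_synthesis g)"
    by (rule antilinear_fourier_synthesis[OF g])
  fix \<Phi> and \<phi> :: "real^'n \<Rightarrow> complex" assume conv: "converges_schwartz \<Phi> \<phi>"
  then have S: "\<Phi> j \<in> schwartz" "\<phi> \<in> schwartz" for j by (auto simp: converges_schwartz_def)
  let ?k = "nat \<lceil>\<bar>- s\<bar>\<rceil> + CARD('n)"
  from converges_schwartz_fourier[OF conv, of ?k] obtain \<epsilon>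
    where \<epsilon>: "\<epsilon> \<longlonglongrightarrow> 0" "\<And>j \<xi>. (1 + norm \<xi>) ^ ?k * cmod (fourier (\<Phi> j) \<xi> - fourier \<phi> \<xi>) \<le> \<epsilon> j"
    by metis
  let ?I = "\<integral>\<xi>. cmod (g \<xi>) * cmod (dual_decay (- s) \<xi>) \<partial>lborel"
  note pi = weighted_pairing(1)[OF g dual_decay_weighted_L2 zero_less_one]
  have "cmod (fourier_synthesis g (\<Phi> j) - fourier_synthesis g \<phi>) \<le> \<epsilon> j * ?I" for j
  proof -
    have "fourier_synthesis g (\<Phi> j) - fourier_synthesis g \<phi>
        = (\<integral>\<xi>. g \<xi> * cnj (fourier (\<Phi> j) \<xi>) - g \<xi> * cnj (fourier \<phi> \<xi>) \<partial>lborel)"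
      using fourier_synthesis_integrable[OF g S(1)[of j]] fourier_synthesis_integrable[OF g S(2)]
      by (simp add: fourier_synthesis_eq S)
    also have "cmod \<dots> \<le> (\<integral>\<xi>. \<epsilon> j * (cmod (g \<xi>) * cmod (dual_decay (- s) \<xi>)) \<partial>lborel)"
    proof (rule order_trans[OF integral_norm_bound], rule integral_mono)
      show "integrable lborel (\<lambda>\<xi>. cmod (g \<xi> * cnj (fourier (\<Phi> j) \<xi>) - g \<xi> * cnj (fourier \<phi> \<xi>)))"
        by (intro integrable_norm Bochner_Integration.integrable_diff fourier_synthesis_integrable[OF g] S)
      show "integrable lborel (\<lambda>\<xi>. \<epsilon> j * (cmod (g \<xi>) * cmod (dual_decay (- s) \<xi>)))"
        by (rule integrable_mult_right[OF pi])
      fix \<xi> :: "real^'n"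
      have "cmod (fourier (\<Phi> j) \<xi> - fourier \<phi> \<xi>) \<le> \<epsilon> j * cmod (dual_decay (- s) \<xi>)"
        using \<epsilon>(2)[of \<xi> j] one_plus_norm_power_pos[of \<xi> ?k]
        unfolding cmod_dual_decay by (simp add: field_simps)
      then have "cmod (g \<xi>) * cmod (fourier (\<Phi> j) \<xi> - fourier \<phi> \<xi>)
          \<le> cmod (g \<xi>) * (\<epsilon> j * cmod (dual_decay (- s) \<xi>))"
        by (rule mult_left_mono) simp
      moreover have "cmod (g \<xi> * cnj (fourier (\<Phi> j) \<xi>) - g \<xi> * cnj (fourier \<phi> \<xi>))
          = cmod (g \<xi>) * cmod (fourier (\<Phi> j) \<xi> - fourier \<phi> \<xi>)"
        by (metis complex_cnj_diff complex_mod_cnj norm_mult right_diff_distrib)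
      ultimately show "cmod (g \<xi> * cnj (fourier (\<Phi> j) \<xi>) - g \<xi> * cnj (fourier \<phi> \<xi>))
          \<le> \<epsilon> j * (cmod (g \<xi>) * cmod (dual_decay (- s) \<xi>))"
        by (simp add: mult.left_commute)
    qed
    finally show ?thesis by simp
  qed
  moreover have "(\<lambda>j. \<epsilon> j * ?I) \<longlonglongrightarrow> 0" using \<epsilon>(1) by (rule tendsto_mult_left_zero)
  ultimately have "(\<lambda>j. fourier_synthesis g (\<Phi> j) - fourier_synthesis g \<phi>) \<longlonglongrightarrow> 0"
    by (metis (no_types, lifting) Lim_null_comparison always_eventually)
  then show "(\<lambda>j. fourier_synthesis g (\<Phi> j)) \<longlonglongrightarrow> fourier_synthesis g \<phi>"
    by (rule LIM_zero_cancel)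
qed

text \<open>Transforming, reflecting and transforming again is the identity on Schwartz functions,
  so \<open>fourier_dist\<close> undoes the synthesis.\<close>

lemma is_density_fourier_synthesis:
  assumes g: "g \<in> weighted_L2 s"
  shows "is_density (fourier_dist (fourier_synthesis g)) g"
proof -
  have "fourier_dist (fourier_synthesis g) \<psi> = regular_dist g \<psi>" for \<psi>
  proof (cases "\<psi> \<in> schwartz")
    case True
    note F = fourier_schwartz[OF True]
    have "fourier (\<lambda>x. fourier \<psi> (- x)) = \<psi>"
      using fourier_reflect[OF schwartz_measurable[OF F]] schwartz_inversion[OF True] by auto
    then show ?thesis
      using True schwartz_reflect[OF F]
      by (simp add: fourier_dist_def on_space_def fourier_synthesis_eq regular_dist_def)
  qed (simp add: fourier_dist_def on_space_def regular_dist_def)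
  then show ?thesis
    unfolding is_density_def using g
    by (auto intro!: weighted_pairing_integrable[OF g] schwartz_weighted_L2 dest: weighted_L2_measurable)
qed

lemma is_density_unique:
  assumes f: "is_density v f" and g: "is_density v g"
  shows "AE \<xi> in lborel. f \<xi> = g \<xi>"
proof -
  have "AE \<xi> in lborel. f \<xi> - g \<xi> = 0"
  proof (rule density_zero)
    show "(\<lambda>\<xi>. f \<xi> - g \<xi>) \<in> borel_measurable borel"
      using f g by (auto simp: is_density_def)
    fix \<psi> :: "real^'a \<Rightarrow> complex" assume \<psi>: "\<psi> \<in> schwartz"
    then have i: "integrable lborel (\<lambda>\<xi>. f \<xi> * cnj (\<psi> \<xi>))" "integrable lborel (\<lambda>\<xi>. g \<xi> * cnj (\<psi> \<xi>))"
      using f g by (auto simp: is_density_def)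
    have "regular_dist f \<psi> = regular_dist g \<psi>"
      using f g by (simp add: is_density_def)
    then have "(\<integral>\<xi>. f \<xi> * cnj (\<psi> \<xi>) \<partial>lborel) = (\<integral>\<xi>. g \<xi> * cnj (\<psi> \<xi>) \<partial>lborel)"
      using \<psi> by (simp add: regular_dist_def on_space_def)
    then show "(\<integral>\<xi>. (f \<xi> - g \<xi>) * cnj (\<psi> \<xi>) \<partial>lborel) = 0"
      using i by (simp add: left_diff_distrib)
    show "integrable lborel (\<lambda>\<xi>. (f \<xi> - g \<xi>) * cnj (\<psi> \<xi>))"
      using i by (simp add: left_diff_distrib)
  qed
  then show ?thesis by simp
qed

lemma is_density_fourier_fun:
  "is_density (fourier_dist u) g \<Longrightarrow> is_density (fourier_dist u) (fourier_fun u)"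
  unfolding fourier_fun_def by (rule someI[of "is_density (fourier_dist u)"])

text \<open>\<open>fourier_fun\<close> is a choice among densities, which are unique only up to null
  sets; agreement almost everywhere suffices for norms and inner products.\<close>

lemma fourier_fun_synthesis:
  assumes "g \<in> weighted_L2 s"
  shows "AE \<xi> in lborel. fourier_fun (fourier_synthesis g) \<xi> = g \<xi>"
    and "fourier_fun (fourier_synthesis g) \<in> borel_measurable borel"
proof -
  note d = is_density_fourier_synthesis[OF assms]
  note d' = is_density_fourier_fun[OF d]
  show "AE \<xi> in lborel. fourier_fun (fourier_synthesis g) \<xi> = g \<xi>"
    by (rule is_density_unique[OF d' d])
  show "fourier_fun (fourier_synthesis g) \<in> borel_measurable borel"
    using d' by (simp add: is_density_def)
qed

lemma fourier_synthesis_sobolev: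
  assumes g: "g \<in> weighted_L2 s"
  shows "fourier_synthesis g \<in> sobolev s"
proof -
  note ff = fourier_fun_synthesis[OF g]
  have [measurable]: "g \<in> borel_measurable borel" "fourier_fun (fourier_synthesis g) \<in> borel_measurable borel"
    using g ff(2) by (auto dest: weighted_L2_measurable)
  have "integrable lborel (\<lambda>\<xi>. sobolev_weight s \<xi> * (cmod (fourier_fun (fourier_synthesis g) \<xi>))\<^sup>2)"
    by (rule integrable_cong_AE_imp[OF weighted_L2_integrable[OF g]]) (use ff(1) in \<open>auto elim: eventually_mono\<close>)
  then show ?thesis
    unfolding sobolev_def sobolev_weight_def
    using tempered_fourier_synthesis[OF g] is_density_fourier_synthesis[OF g] by blast
qed

lemma sobolev_norm_synthesis:
  assumes g: "g \<in> weighted_L2 s"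
  shows "sobolev_norm s (fourier_synthesis g) = sqrt (weighted_sq s g)"
proof -
  note ff = fourier_fun_synthesis[OF g]
  have [measurable]: "g \<in> borel_measurable borel" "fourier_fun (fourier_synthesis g) \<in> borel_measurable borel"
    using g ff(2) by (auto dest: weighted_L2_measurable)
  show ?thesis
    unfolding sobolev_norm_def weighted_sq_def sobolev_weight_def[symmetric] real_sqrt_eq_iff
    by (rule integral_cong_AE) (use ff(1) in \<open>auto elim: eventually_mono\<close>)
qed

lemma sobolev_inner_synthesis:
  assumes g: "g \<in> weighted_L2 s" and h: "h \<in> weighted_L2 s"
  shows "sobolev_inner s (fourier_synthesis g) (fourier_synthesis h) = weighted_inner s g h"
proof -
  note ff = fourier_fun_synthesis[OF g] fourier_fun_synthesis[OF h]
  have [measurable]: "g \<in> borel_measurable borel" "fourier_fun (fourier_synthesis g) \<in> borel_measurable borel"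
    "h \<in> borel_measurable borel" "fourier_fun (fourier_synthesis h) \<in> borel_measurable borel"
    using g h ff(2,4) by (auto dest: weighted_L2_measurable)
  show ?thesis
    unfolding sobolev_inner_def weighted_inner_def sobolev_weight_def[symmetric]
  proof (rule integral_cong_AE)
    show "AE \<xi> in lborel. of_real (sobolev_weight s \<xi>) * fourier_fun (fourier_synthesis g) \<xi> *
        cnj (fourier_fun (fourier_synthesis h) \<xi>) = of_real (sobolev_weight s \<xi>) * g \<xi> * cnj (h \<xi>)"
      using ff(1,3) by eventually_elim simp
  qed measurable
qed

text \<open>The synthesis is onto: by inversion, evaluating \<open>fourier_dist u\<close> at the
  transform of \<psi> returns the value of \<open>u\<close> at \<psi>, so \<open>u\<close> is
  recovered from its density.\<close>

lemma sobolevE: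
  assumes u: "u \<in> sobolev s"
  obtains g where "g \<in> weighted_L2 s" "u = fourier_synthesis g"
proof
  let ?g = "fourier_fun u"
  have d: "is_density (fourier_dist u) ?g"
    using u is_density_fourier_fun unfolding sobolev_def by blast
  show "?g \<in> weighted_L2 s"
    using u d by (auto simp: sobolev_def weighted_L2_def sobolev_weight_def is_density_def)
  show "u = fourier_synthesis ?g"
  proof
    fix \<psi> :: "real^'a \<Rightarrow> complex"
    show "u \<psi> = fourier_synthesis ?g \<psi>"
    proof (cases "\<psi> \<in> schwartz")
      case True
      have "fourier_dist u (fourier \<psi>) = u \<psi>"
        using fourier_schwartz[OF True] schwartz_inversion[OF True]
        by (simp add: fourier_dist_def on_space_def)
      moreover have "fourier_dist u = regular_dist ?g" using d by (simp add: is_density_def)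
      ultimately show ?thesis
        using fourier_schwartz[OF True] True by (simp add: regular_dist_def on_space_def fourier_synthesis_eq)
    next
      case False
      then show ?thesis using u by (simp add: sobolev_def tempered_def fourier_synthesis_def on_space_def)
    qed
  qed
qed

text \<open>Parseval's identity with the transform of the test function as second factor; inversion
  removes the double transform.\<close>

lemma regular_dist_eq_synthesis:
  assumes \<phi>: "\<phi> \<in> schwartz"
  shows "regular_dist \<phi> = fourier_synthesis (fourier \<phi>)"
proof
  fix \<psi> :: "real^'a \<Rightarrow> complex"
  show "regular_dist \<phi> \<psi> = fourier_synthesis (fourier \<phi>) \<psi>"
  proof (cases "\<psi> \<in> schwartz")
    case True
    then show ?thesis
      using fourier_parseval[of \<phi> "fourier \<psi>"] \<phi>
      by (simp add: regular_dist_def on_space_def fourier_synthesis_eq schwartz_integrable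
          fourier_schwartz schwartz_inversion)
  qed (simp add: regular_dist_def on_space_def fourier_synthesis_def)
qed

section \<open>Minimal elements in the weighted spaces\<close>

lemma weighted_inner_integrable:
  assumes g: "g \<in> weighted_L2 s" and h: "h \<in> weighted_L2 s"
  shows "integrable lborel (\<lambda>\<xi>. of_real (sobolev_weight s \<xi>) * g \<xi> * cnj (h \<xi>))"
proof -
  have [measurable]: "g \<in> borel_measurable borel" "h \<in> borel_measurable borel"
    using g h by (auto dest: weighted_L2_measurable)
  show ?thesis
  proof (rule Bochner_Integration.integrable_bound[OF Bochner_Integration.integrable_add[OF
        weighted_L2_integrable[OF g] weighted_L2_integrable[OF h]]])
    have "sobolev_weight s \<xi> * (cmod (g \<xi>) * cmod (h \<xi>))
        \<le> sobolev_weight s \<xi> * ((cmod (g \<xi>))\<^sup>2 + (cmod (h \<xi>))\<^sup>2)" for \<xi>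
    proof (rule mult_left_mono)
      have "2 * (cmod (g \<xi>) * cmod (h \<xi>)) \<le> (cmod (g \<xi>))\<^sup>2 + (cmod (h \<xi>))\<^sup>2"
        using sum_squares_bound[of "cmod (g \<xi>)" "cmod (h \<xi>)"] by (simp add: mult.assoc)
      moreover have "0 \<le> cmod (g \<xi>) * cmod (h \<xi>)" by simp
      ultimately show "cmod (g \<xi>) * cmod (h \<xi>) \<le> (cmod (g \<xi>))\<^sup>2 + (cmod (h \<xi>))\<^sup>2" by linarith
    qed simp
    then show "AE \<xi> in lborel. norm (of_real (sobolev_weight s \<xi>) * g \<xi> * cnj (h \<xi>))
        \<le> norm (sobolev_weight s \<xi> * (cmod (g \<xi>))\<^sup>2 + sobolev_weight s \<xi> * (cmod (h \<xi>))\<^sup>2)"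
      by (auto simp: norm_mult abs_of_nonneg algebra_simps intro!: order_trans[OF _ abs_ge_self])
  qed measurable
qed

lemma weighted_sq_add:
  assumes g: "g \<in> weighted_L2 s" and h: "h \<in> weighted_L2 s"
  shows "weighted_sq s (\<lambda>\<xi>. g \<xi> + h \<xi>) = weighted_sq s g + weighted_sq s h + 2 * Re (weighted_inner s g h)"
proof -
  note i = weighted_L2_integrable[OF g] weighted_L2_integrable[OF h] integrable_Re[OF weighted_inner_integrable[OF g h]]
  have eq: "sobolev_weight s \<xi> * (cmod (g \<xi> + h \<xi>))\<^sup>2 = (sobolev_weight s \<xi> * (cmod (g \<xi>))\<^sup>2
      + sobolev_weight s \<xi> * (cmod (h \<xi>))\<^sup>2) + 2 * Re (of_real (sobolev_weight s \<xi>) * g \<xi> * cnj (h \<xi>))" for \<xi>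
  proof -
    have "(cmod (x + y))\<^sup>2 = (cmod x)\<^sup>2 + (cmod y)\<^sup>2 + 2 * Re (x * cnj y)" for x y
      unfolding cmod_power2 by (simp add: power2_eq_square algebra_simps)
    moreover have "Re (of_real (sobolev_weight s \<xi>) * g \<xi> * cnj (h \<xi>)) = sobolev_weight s \<xi> * Re (g \<xi> * cnj (h \<xi>))"
      unfolding mult.assoc by (simp add: algebra_simps)
    ultimately show ?thesis by (simp only: distrib_left mult.left_commute)
  qed
  have "weighted_sq s (\<lambda>\<xi>. g \<xi> + h \<xi>) = weighted_sq s g + weighted_sq s h
      + 2 * (\<integral>\<xi>. Re (of_real (sobolev_weight s \<xi>) * g \<xi> * cnj (h \<xi>)) \<partial>lborel)"
    unfolding weighted_sq_def eq
    using Bochner_Integration.integral_add[OF Bochner_Integration.integrable_add[OF i(1,2)] integrable_mult_right[OF i(3), of 2]]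
      Bochner_Integration.integral_add[OF i(1,2)] by (simp only: integral_mult_right_zero)
  then show ?thesis unfolding weighted_inner_def integral_Re[OF weighted_inner_integrable[OF g h]] .
qed

lemma weighted_sq_scale: "weighted_sq s (\<lambda>\<xi>. c * g \<xi>) = (cmod c)\<^sup>2 * weighted_sq s g"
  unfolding weighted_sq_def norm_mult power_mult_distrib mult.left_commute[of _ "(cmod c)\<^sup>2"] by simp

lemma weighted_inner_scale: "weighted_inner s g (\<lambda>\<xi>. c * h \<xi>) = cnj c * weighted_inner s g h"
  unfolding weighted_inner_def by (simp add: mult.left_commute)

text \<open>The variational argument: on a set closed under scaling, orthogonality is the vanishing
  of the first-order term of the squared norm in every direction.\<close>

lemma weighted_orthogonal_iff_minimal:
  assumes g: "g \<in> weighted_L2 s" and N: "N \<subseteq> weighted_L2 s" and scale: "\<And>h c. h \<in> N \<Longrightarrow> (\<lambda>\<xi>. c * h \<xi>) \<in> N"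
  shows "(\<forall>h\<in>N. weighted_inner s g h = 0) \<longleftrightarrow> (\<forall>h\<in>N. weighted_sq s g \<le> weighted_sq s (\<lambda>\<xi>. g \<xi> + h \<xi>))"
proof (intro iffI ballI)
  fix h assume "\<forall>h\<in>N. weighted_inner s g h = 0" "h \<in> N"
  then show "weighted_sq s g \<le> weighted_sq s (\<lambda>\<xi>. g \<xi> + h \<xi>)"
    using weighted_sq_add[OF g, of h] N by auto
next
  fix h assume min: "\<forall>h\<in>N. weighted_sq s g \<le> weighted_sq s (\<lambda>\<xi>. g \<xi> + h \<xi>)" and h: "h \<in> N"
  define z where "z = weighted_inner s g h"
  \<comment> \<open>Small enough for the quadratic term of the expansion to stay below half of the
    linear one.\<close>
  define t where "t = 1 / (weighted_sq s h + 1)"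
  have t: "0 < t" "t * weighted_sq s h < 1"
    unfolding t_def by (auto simp: add_nonneg_pos divide_less_eq)
  \<comment> \<open>The phase of \<open>z\<close> makes the linear term real and
    nonpositive.\<close>
  define c where "c = of_real (- t) * z"
  have "weighted_sq s g \<le> weighted_sq s (\<lambda>\<xi>. g \<xi> + c * h \<xi>)"
    using min[rule_format, OF scale[OF h, of c]] .
  also have "\<dots> = weighted_sq s g + (cmod c)\<^sup>2 * weighted_sq s h + 2 * Re (cnj c * z)"
    using weighted_sq_add[OF g weighted_L2_scale[of h s c]] h N
    by (auto simp: weighted_sq_scale weighted_inner_scale z_def)
  also have "\<dots> = weighted_sq s g + t * (cmod z)\<^sup>2 * (t * weighted_sq s h - 2)"
  proof -
    have "cnj c * z = of_real (- t * (cmod z)\<^sup>2)"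
      unfolding c_def using complex_norm_square[of z] by (simp add: mult.commute)
    moreover have "(cmod c)\<^sup>2 = t * t * (cmod z)\<^sup>2"
      by (simp add: c_def norm_mult power_mult_distrib power2_eq_square)
    ultimately show ?thesis by (simp only: Re_complex_of_real) (simp add: algebra_simps)
  qed
  finally have "0 \<le> t * (cmod z)\<^sup>2 * (t * weighted_sq s h - 2)" by simp
  moreover have "t * weighted_sq s h - 2 < 0" using t by simp
  ultimately have "t * (cmod z)\<^sup>2 \<le> 0"
    by (metis mult_pos_neg not_le)
  then have "cmod z = 0" using t(1) by (simp add: mult_le_0_iff)
  then show "weighted_inner s g h = 0" by (simp add: z_def)
qed

text \<open>Multiplication by \<open>dual_decay (- s)\<close> embeds the space into L^1, where a
  Cauchy sequence has an almost everywhere convergent subsequence; the factor is nowhere 0 and can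
  be divided out. Fatou's lemma then gives convergence in the weighted norm.\<close>

lemma weighted_L2_complete:
  fixes g :: "nat \<Rightarrow> real^'n \<Rightarrow> complex"
  assumes g: "\<And>k. g k \<in> weighted_L2 s"
    and cauchy: "\<And>e. 0 < e \<Longrightarrow> \<exists>N. \<forall>i\<ge>N. \<forall>j\<ge>N. weighted_sq s (\<lambda>\<xi>. g i \<xi> - g j \<xi>) < e"
  shows "\<exists>f\<in>weighted_L2 s. (\<lambda>k. weighted_sq s (\<lambda>\<xi>. g k \<xi> - f \<xi>)) \<longlonglongrightarrow> 0"
proof -
  have gm [measurable]: "g k \<in> borel_measurable borel" for k using g by (rule weighted_L2_measurable)
  let ?\<rho> = "dual_decay (- s) :: real^'n \<Rightarrow> complex"
  have \<rho>nz: "?\<rho> \<xi> \<noteq> 0" for \<xi>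
  proof -
    have "0 < cmod (?\<rho> \<xi>)"
      unfolding cmod_dual_decay by (intro positive_imp_inverse_positive one_plus_norm_power_pos)
    then show ?thesis by auto
  qed
  note \<rho> = dual_decay_weighted_L2[of "- s"]
  have [measurable]: "?\<rho> \<in> borel_measurable borel" using \<rho> by (rule weighted_L2_measurable)
  have L1: "integrable lborel (\<lambda>\<xi>. g k \<xi> * ?\<rho> \<xi>)" for k
    by (rule Bochner_Integration.integrable_bound[OF weighted_pairing(1)[OF g[of k] \<rho> zero_less_one]])
       (auto simp: norm_mult)
  obtain r where r: "strict_mono r" "AE \<xi> in lborel. Cauchy (\<lambda>i. g (r i) \<xi> * ?\<rho> \<xi>)"
  proof (rule cauchy_L1_AE_cauchy_subseq[of lborel "\<lambda>k \<xi>. g k \<xi> * ?\<rho> \<xi>"])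
    show "\<exists>N. \<forall>i\<ge>N. \<forall>j\<ge>N. (LINT \<xi>|lborel. norm (g i \<xi> * ?\<rho> \<xi> - g j \<xi> * ?\<rho> \<xi>)) < e" if e: "0 < e" for e
    proof -
      obtain \<delta> where \<delta>: "\<delta> > 0" "\<And>f. f \<in> weighted_L2 s \<Longrightarrow> weighted_sq s f < \<delta> \<Longrightarrow>
          (\<integral>\<xi>. cmod (f \<xi>) * cmod (?\<rho> \<xi>) \<partial>lborel) < e"
        using weighted_pairing_small[OF \<rho> e] by blast
      obtain N where "\<forall>i\<ge>N. \<forall>j\<ge>N. weighted_sq s (\<lambda>\<xi>. g i \<xi> - g j \<xi>) < \<delta>"
        using cauchy[OF \<delta>(1)] by blast
      then show ?thesis
        using \<delta>(2)[OF weighted_L2_diff[OF g g]]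
        unfolding left_diff_distrib[symmetric] norm_mult by blast
    qed
  qed (use L1 in auto)
  define f where "f \<xi> = lim (\<lambda>i. g (r i) \<xi>)" for \<xi>
  have [measurable]: "f \<in> borel_measurable borel" unfolding f_def by measurable
  have lim: "AE \<xi> in lborel. (\<lambda>i. g (r i) \<xi>) \<longlonglongrightarrow> f \<xi>"
    using r(2)
  proof eventually_elim
    fix \<xi> assume "Cauchy (\<lambda>i. g (r i) \<xi> * ?\<rho> \<xi>)"
    then obtain l where "(\<lambda>i. g (r i) \<xi> * ?\<rho> \<xi>) \<longlonglongrightarrow> l"
      using Cauchy_convergent_iff convergent_def by blast
    from tendsto_divide[OF this tendsto_const \<rho>nz[of \<xi>]] have "(\<lambda>i. g (r i) \<xi>) \<longlonglongrightarrow> l / ?\<rho> \<xi>"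
      using \<rho>nz[of \<xi>] by simp
    then show "(\<lambda>i. g (r i) \<xi>) \<longlonglongrightarrow> f \<xi>" unfolding f_def by (metis limI)
  qed
  \<comment> \<open>Fatou is applied in the second index only, along \<open>r\<close>; the first
    index remains free, which yields the estimate for the full sequence.\<close>
  have close: "(\<lambda>\<xi>. g k \<xi> - f \<xi>) \<in> weighted_L2 s \<and> weighted_sq s (\<lambda>\<xi>. g k \<xi> - f \<xi>) \<le> e"
    if N: "\<forall>i\<ge>N. \<forall>j\<ge>N. weighted_sq s (\<lambda>\<xi>. g i \<xi> - g j \<xi>) < e" and k: "k \<ge> N" for N k e
  proof -
    let ?q = "\<lambda>f \<xi>. sobolev_weight s \<xi> * (cmod (g k \<xi> - f \<xi>))\<^sup>2"
    have e: "0 \<le> e" using N k weighted_sq_nonneg[of s "\<lambda>\<xi>. g k \<xi> - g k \<xi>"] by (meson le_less_trans less_imp_le)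
    have "(\<integral>\<^sup>+\<xi>. ennreal (?q f \<xi>) \<partial>lborel) = (\<integral>\<^sup>+\<xi>. liminf (\<lambda>i. ennreal (?q (g (r i)) \<xi>)) \<partial>lborel)"
    proof (rule nn_integral_cong_AE)
      show "AE \<xi> in lborel. ennreal (?q f \<xi>) = liminf (\<lambda>i. ennreal (?q (g (r i)) \<xi>))"
        using lim
      proof eventually_elim
        case (elim \<xi>)
        have "(\<lambda>i. ennreal (?q (g (r i)) \<xi>)) \<longlonglongrightarrow> ennreal (?q f \<xi>)"
          using elim by (intro tendsto_ennrealI tendsto_intros)
        from lim_imp_Liminf[OF sequentially_bot this] show ?case by (rule sym)
      qed
    qed
    also have "\<dots> \<le> liminf (\<lambda>i. \<integral>\<^sup>+\<xi>. ennreal (?q (g (r i)) \<xi>) \<partial>lborel)"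
      by (rule nn_integral_liminf) measurable
    also have "\<dots> \<le> ennreal e"
    proof (rule Liminf_le)
      show "\<forall>\<^sub>F i in sequentially. (\<integral>\<^sup>+\<xi>. ennreal (?q (g (r i)) \<xi>) \<partial>lborel) \<le> ennreal e"
        using eventually_ge_at_top[of N]
      proof eventually_elim
        case (elim i)
        have "N \<le> r i" using elim seq_suble[OF r(1), of i] by linarith
        then have "weighted_sq s (\<lambda>\<xi>. g k \<xi> - g (r i) \<xi>) < e" using N k by blast
        moreover have "(\<integral>\<^sup>+\<xi>. ennreal (?q (g (r i)) \<xi>) \<partial>lborel) = ennreal (weighted_sq s (\<lambda>\<xi>. g k \<xi> - g (r i) \<xi>))"
          unfolding weighted_sq_def
          by (rule nn_integral_eq_integral[OF weighted_L2_integrable[OF weighted_L2_diff[OF g g]]]) simp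
        ultimately show ?case by (simp add: ennreal_leI)
      qed
    qed simp
    finally have le: "(\<integral>\<^sup>+\<xi>. ennreal (?q f \<xi>) \<partial>lborel) \<le> ennreal e" .
    then have i: "integrable lborel (?q f)"
      by (intro integrableI_nonneg) (auto simp: le_less_trans[OF le])
    then have "ennreal (weighted_sq s (\<lambda>\<xi>. g k \<xi> - f \<xi>)) \<le> ennreal e"
      using le unfolding weighted_sq_def by (subst (asm) nn_integral_eq_integral) auto
    then show ?thesis using i e by (simp add: weighted_L2_def)
  qed
  obtain N where N: "\<forall>i\<ge>N. \<forall>j\<ge>N. weighted_sq s (\<lambda>\<xi>. g i \<xi> - g j \<xi>) < 1"
    using cauchy[of 1] by auto
  have "(\<lambda>\<xi>. g N \<xi> - (g N \<xi> - f \<xi>)) \<in> weighted_L2 s"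
    using weighted_L2_diff[OF g conjunct1[OF close[OF N order_refl]]] .
  moreover have "(\<lambda>k. weighted_sq s (\<lambda>\<xi>. g k \<xi> - f \<xi>)) \<longlonglongrightarrow> 0"
  proof (rule LIMSEQ_I)
    fix e :: real assume "0 < e"
    then obtain M where "\<forall>i\<ge>M. \<forall>j\<ge>M. weighted_sq s (\<lambda>\<xi>. g i \<xi> - g j \<xi>) < e / 2"
      using cauchy[of "e / 2"] by auto
    from close[OF this] show "\<exists>M. \<forall>k\<ge>M. norm (weighted_sq s (\<lambda>\<xi>. g k \<xi> - f \<xi>) - 0) < e"
      using \<open>0 < e\<close> by (intro exI[of _ M]) (fastforce simp: abs_of_nonneg)
  qed
  ultimately show ?thesis by auto
qed

text \<open>The core of the projection theorem: the parallelogram law makes a minimizing sequence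
  Cauchy. It involves midpoints of members only, hence the form of the assumption on
  \<open>A\<close>.\<close>

lemma weighted_L2_minimal:
  fixes A :: "(real^'n \<Rightarrow> complex) set"
  assumes A: "A \<subseteq> weighted_L2 s" "A \<noteq> {}"
    and mid: "\<And>g h. g \<in> A \<Longrightarrow> h \<in> A \<Longrightarrow> (\<lambda>\<xi>. 1/2 * g \<xi> + 1/2 * h \<xi>) \<in> A"
    and closed: "\<And>g f. (\<And>k::nat. g k \<in> A) \<Longrightarrow> f \<in> weighted_L2 s \<Longrightarrow>
      (\<lambda>k. weighted_sq s (\<lambda>\<xi>. g k \<xi> - f \<xi>)) \<longlonglongrightarrow> 0 \<Longrightarrow> f \<in> A"
  shows "\<exists>f\<in>A. \<forall>h\<in>A. weighted_sq s f \<le> weighted_sq s h"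
proof -
  define d where "d = (INF h\<in>A. weighted_sq s h)"
  have bdd: "bdd_below (weighted_sq s ` A)" by (rule bdd_belowI[of _ 0]) auto
  have d: "d \<le> weighted_sq s h" if "h \<in> A" for h
    unfolding d_def using bdd that by (rule cINF_lower)
  have "\<exists>g\<in>A. weighted_sq s g < d + inverse (real (Suc k))" for k
    using cINF_less_iff[OF A(2) bdd, of "d + inverse (real (Suc k))"] unfolding d_def[symmetric] by simp
  then obtain g where g: "\<And>k. g k \<in> A" "\<And>k. weighted_sq s (g k) < d + inverse (real (Suc k))"
    by metis
  have gL: "g k \<in> weighted_L2 s" for k using g(1) A(1) by blast
  have par: "weighted_sq s (\<lambda>\<xi>. g i \<xi> - g j \<xi>) \<le> 2 * inverse (real (Suc i)) + 2 * inverse (real (Suc j))" for i j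
  proof -
    \<comment> \<open>Half sum and half difference: \<open>g i\<close> and \<open>g j\<close> are
      their sum and difference, and the half sum lies in \<open>A\<close>, so its squared norm is at
      least \<open>d\<close>.\<close>
    let ?m = "\<lambda>\<xi>. 1/2 * g i \<xi> + 1/2 * g j \<xi>" and ?d = "\<lambda>\<xi>. 1/2 * g i \<xi> + (-1/2) * g j \<xi>"
    have mL: "?m \<in> weighted_L2 s" "?d \<in> weighted_L2 s" by (intro weighted_L2_lincomb gL)+
    have "weighted_sq s (\<lambda>\<xi>. ?m \<xi> + ?d \<xi>) + weighted_sq s (\<lambda>\<xi>. ?m \<xi> + (-1) * ?d \<xi>)
        = 2 * weighted_sq s ?m + 2 * weighted_sq s ?d"
      unfolding weighted_sq_add[OF mL] weighted_sq_add[OF mL(1) weighted_L2_scale[OF mL(2)]]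
        weighted_sq_scale weighted_inner_scale by simp
    moreover have "(\<lambda>\<xi>. ?m \<xi> + ?d \<xi>) = g i" "(\<lambda>\<xi>. ?m \<xi> + (-1) * ?d \<xi>) = g j" by (auto simp: field_simps)
    moreover have "d \<le> weighted_sq s ?m" using mid[OF g(1) g(1)] by (rule d)
    moreover have "(\<lambda>\<xi>. g i \<xi> - g j \<xi>) = (\<lambda>\<xi>. 2 * ?d \<xi>)" by (auto simp: field_simps)
    then have "weighted_sq s (\<lambda>\<xi>. g i \<xi> - g j \<xi>) = 4 * weighted_sq s ?d"
      by (simp only: weighted_sq_scale) simp
    ultimately show ?thesis using g(2)[of i] g(2)[of j] by simp
  qed
  have "\<exists>f\<in>weighted_L2 s. (\<lambda>k. weighted_sq s (\<lambda>\<xi>. g k \<xi> - f \<xi>)) \<longlonglongrightarrow> 0"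
  proof (rule weighted_L2_complete[OF gL])
    fix e :: real assume "0 < e"
    then obtain N where N: "inverse (real (Suc N)) < e / 4"
      using reals_Archimedean[of "e / 4"] by auto
    have "weighted_sq s (\<lambda>\<xi>. g i \<xi> - g j \<xi>) < e" if "i \<ge> N" "j \<ge> N" for i j
    proof -
      have "inverse (real (Suc i)) \<le> inverse (real (Suc N))" "inverse (real (Suc j)) \<le> inverse (real (Suc N))"
        using that by (auto intro!: le_imp_inverse_le)
      then show ?thesis using par[of i j] N by linarith
    qed
    then show "\<exists>N. \<forall>i\<ge>N. \<forall>j\<ge>N. weighted_sq s (\<lambda>\<xi>. g i \<xi> - g j \<xi>) < e" by blast
  qed
  then obtain f where f: "f \<in> weighted_L2 s" "(\<lambda>k. weighted_sq s (\<lambda>\<xi>. g k \<xi> - f \<xi>)) \<longlonglongrightarrow> 0" by blast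
  have fA: "f \<in> A" using closed[OF g(1) f] .
  \<comment> \<open>Passing to the limit through \<open>cmod_add_sq_le\<close> costs a factor
    \<open>1 + t\<close>, which is removed afterwards by letting \<open>t\<close> tend to 0.\<close>
  have "weighted_sq s f \<le> (1 + t) * d" if t: "0 < t" for t
  proof (rule LIMSEQ_le_const)
    have "(\<lambda>k. (1 + t) * (d + inverse (real (Suc k))) + (1 + 1 / t) * weighted_sq s (\<lambda>\<xi>. g k \<xi> - f \<xi>))
        \<longlonglongrightarrow> (1 + t) * (d + 0) + (1 + 1 / t) * 0"
      using f(2) LIMSEQ_inverse_real_of_nat by (intro tendsto_intros)
    then show "(\<lambda>k. (1 + t) * (d + inverse (real (Suc k))) + (1 + 1 / t) * weighted_sq s (\<lambda>\<xi>. g k \<xi> - f \<xi>))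
        \<longlonglongrightarrow> (1 + t) * d" by simp
    have "weighted_sq s f \<le> (1 + t) * (d + inverse (real (Suc k))) + (1 + 1 / t) * weighted_sq s (\<lambda>\<xi>. g k \<xi> - f \<xi>)" for k
    proof -
      have "weighted_sq s f \<le> (1 + t) * weighted_sq s (g k) + (1 + 1 / t) * weighted_sq s (\<lambda>\<xi>. g k \<xi> - f \<xi>)"
      proof (rule weighted_L2_bound(2)[OF gL weighted_L2_diff[OF gL f(1)] weighted_L2_measurable[OF f(1)]])
        show "(cmod (f \<xi>))\<^sup>2 \<le> (1 + t) * (cmod (g k \<xi>))\<^sup>2 + (1 + 1 / t) * (cmod (g k \<xi> - f \<xi>))\<^sup>2" for \<xi>
          using cmod_add_sq_le[OF t, of "g k \<xi>" "f \<xi> - g k \<xi>"] by (simp add: norm_minus_commute)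
      qed
      also have "\<dots> \<le> (1 + t) * (d + inverse (real (Suc k))) + (1 + 1 / t) * weighted_sq s (\<lambda>\<xi>. g k \<xi> - f \<xi>)"
        using g(2)[of k] t by (intro add_right_mono mult_left_mono) auto
      finally show ?thesis .
    qed
    then show "\<exists>N. \<forall>k\<ge>N. weighted_sq s f
        \<le> (1 + t) * (d + inverse (real (Suc k))) + (1 + 1 / t) * weighted_sq s (\<lambda>\<xi>. g k \<xi> - f \<xi>)" by blast
  qed
  note * = this
  have "weighted_sq s f \<le> d"
  proof -
    have "((\<lambda>t. (1 + t) * d) \<longlongrightarrow> (1 + 0) * d) (at_right 0)" by (intro tendsto_intros)
    then have "weighted_sq s f \<le> (1 + 0) * d"
    proof (rule tendsto_lowerbound)
      show "\<forall>\<^sub>F t in at_right 0. weighted_sq s f \<le> (1 + t) * d"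
        using eventually_at_right_less[of "0::real"] by eventually_elim (rule *)
    qed simp
    then show ?thesis by simp
  qed
  then show ?thesis using fA d order_trans by blast
qed

section \<open>Restrictions and minimal extensions\<close>

lemma restrict_dist_apply: "\<psi> \<in> test_functions \<Omega> \<Longrightarrow> restrict_dist \<Omega> U \<psi> = U \<psi>"
  by (simp add: restrict_dist_def on_space_def)

lemma restrict_dist_lincomb:
  "restrict_dist \<Omega> (\<lambda>\<phi>. a * u \<phi> + b * v \<phi>) = (\<lambda>\<phi>. a * restrict_dist \<Omega> u \<phi> + b * restrict_dist \<Omega> v \<phi>)"
  by (auto simp: restrict_dist_def on_space_def fun_eq_iff)

lemma restrict_dist_diff:
  "restrict_dist \<Omega> (\<lambda>\<phi>. u \<phi> - v \<phi>) = (\<lambda>\<phi>. restrict_dist \<Omega> u \<phi> - restrict_dist \<Omega> v \<phi>)"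
  by (auto simp: restrict_dist_def on_space_def fun_eq_iff)

lemma restrict_dist_eq_iff:
  "restrict_dist \<Omega> u = restrict_dist \<Omega> v \<longleftrightarrow> (\<forall>\<psi>\<in>test_functions \<Omega>. u \<psi> = v \<psi>)"
  unfolding restrict_dist_def on_space_def fun_eq_iff by metis

lemma sobolev_lincomb:
  assumes "u \<in> sobolev s" "v \<in> sobolev s"
  shows "(\<lambda>\<phi>. a * u \<phi> + b * v \<phi>) \<in> sobolev s"
proof -
  obtain g h where "g \<in> weighted_L2 s" "u = fourier_synthesis g" "h \<in> weighted_L2 s" "v = fourier_synthesis h"
    using assms by (metis sobolevE)
  then show ?thesis
    using fourier_synthesis_lincomb[of g s h a b] fourier_synthesis_sobolev[OF weighted_L2_lincomb[of g s h a b]]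
    by simp
qed

lemma sobolev_diff: "u \<in> sobolev s \<Longrightarrow> v \<in> sobolev s \<Longrightarrow> (\<lambda>\<phi>. u \<phi> - v \<phi>) \<in> sobolev s"
  using sobolev_lincomb[of u s v 1 "-1"] by simp

lemma regular_dist_sobolev: "\<phi> \<in> schwartz \<Longrightarrow> regular_dist \<phi> \<in> sobolev s"
  by (simp add: regular_dist_eq_synthesis fourier_synthesis_sobolev schwartz_weighted_L2 fourier_schwartz)

text \<open>From left to right the definition only provides a cover of \<Omega> by open sets on
  which \<open>u\<close> vanishes; the partition of unity in \<open>vanishes_off_support\<close>
  glues them together.\<close>

lemma dist_supp_subset_iff:
  assumes "open \<Omega>" "antilinear_on schwartz u"
  shows "dist_supp u \<subseteq> - \<Omega> \<longleftrightarrow> (\<forall>\<psi>\<in>test_functions \<Omega>. u \<psi> = 0)"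
  using vanishes_off_support[OF assms(2)] assms(1) unfolding dist_supp_def by blast

text \<open>The kernel of restriction to \<Omega>, on the Fourier side; for open \<Omega> it
  represents the distributions supported in the complement.\<close>

definition null_ext :: "real \<Rightarrow> (real^'n) set \<Rightarrow> (real^'n \<Rightarrow> complex) set" where
  "null_ext s \<Omega> = {h \<in> weighted_L2 s. \<forall>\<psi>\<in>test_functions \<Omega>. fourier_synthesis h \<psi> = 0}"

lemma sobolev_supported_eq:
  assumes "open \<Omega>"
  shows "sobolev_supported s (- \<Omega>) = fourier_synthesis ` null_ext s \<Omega>"
proof -
  have "fourier_synthesis h \<in> sobolev_supported s (- \<Omega>) \<longleftrightarrow> (\<forall>\<psi>\<in>test_functions \<Omega>. fourier_synthesis h \<psi> = 0)"
    if "h \<in> weighted_L2 s" for h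
    using that dist_supp_subset_iff[OF assms antilinear_fourier_synthesis[OF that]] fourier_synthesis_sobolev[OF that]
    by (simp add: sobolev_supported_def)
  note * = this
  show ?thesis
  proof (intro equalityI subsetI)
    fix u assume u: "u \<in> sobolev_supported s (- \<Omega>)"
    then have "u \<in> sobolev s" by (simp add: sobolev_supported_def)
    then obtain g where g: "g \<in> weighted_L2 s" "u = fourier_synthesis g" by (rule sobolevE)
    then have "g \<in> null_ext s \<Omega>" using u * by (simp add: null_ext_def)
    then show "u \<in> fourier_synthesis ` null_ext s \<Omega>" using g by blast
  qed (use * in \<open>auto simp: null_ext_def\<close>)
qed

lemma sobolev_orth_iff:
  assumes "open \<Omega>" "g \<in> weighted_L2 s"
  shows "fourier_synthesis g \<in> sobolev_orth s (sobolev_supported s (- \<Omega>))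
    \<longleftrightarrow> (\<forall>h\<in>null_ext s \<Omega>. weighted_inner s g h = 0)"
proof -
  have "sobolev_inner s (fourier_synthesis g) (fourier_synthesis h) = weighted_inner s g h"
    if "h \<in> null_ext s \<Omega>" for h
    using that by (intro sobolev_inner_synthesis assms) (simp add: null_ext_def)
  then show ?thesis
    using fourier_synthesis_sobolev[OF assms(2)]
    by (auto simp: sobolev_orth_def sobolev_supported_eq[OF assms(1)])
qed

lemma null_ext_subset: "null_ext s \<Omega> \<subseteq> weighted_L2 s"
  by (auto simp: null_ext_def)

lemma null_ext_lincomb:
  assumes "g \<in> null_ext s \<Omega>" "h \<in> null_ext s \<Omega>"
  shows "(\<lambda>\<xi>. a * g \<xi> + b * h \<xi>) \<in> null_ext s \<Omega>"
  using assms weighted_L2_lincomb[of g s h a b] fourier_synthesis_lincomb[of g s h a b]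
  by (simp add: null_ext_def)

lemma null_ext_scale: "h \<in> null_ext s \<Omega> \<Longrightarrow> (\<lambda>\<xi>. c * h \<xi>) \<in> null_ext s \<Omega>"
  using null_ext_lincomb[of h s \<Omega> h c 0] by simp

lemma null_ext_orthogonal_iff:
  assumes "g \<in> weighted_L2 s"
  shows "(\<forall>h\<in>null_ext s \<Omega>. weighted_inner s g h = 0)
    \<longleftrightarrow> (\<forall>h\<in>null_ext s \<Omega>. weighted_sq s g \<le> weighted_sq s (\<lambda>\<xi>. g \<xi> + h \<xi>))"
  by (rule weighted_orthogonal_iff_minimal[OF assms null_ext_subset]) (rule null_ext_scale)

lemma null_ext_diff_iff:
  assumes "f \<in> weighted_L2 s" "g \<in> weighted_L2 s"
  shows "(\<lambda>\<xi>. f \<xi> - g \<xi>) \<in> null_ext s \<Omega>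
    \<longleftrightarrow> restrict_dist \<Omega> (fourier_synthesis f) = restrict_dist \<Omega> (fourier_synthesis g)"
  using fourier_synthesis_lincomb[OF assms, of 1 "-1"] weighted_L2_diff[OF assms]
  by (simp add: null_ext_def restrict_dist_eq_iff)

text \<open>The extensions of a given restriction form an affine set, closed because each pairing
  with a test function is continuous in the weighted norm. Its element of least norm is orthogonal
  to the directions of the set, which are \<open>null_ext s \<Omega>\<close>.\<close>

lemma minimal_extension_exists:
  fixes g :: "real^'n \<Rightarrow> complex"
  assumes g: "g \<in> weighted_L2 s"
  shows "\<exists>f\<in>weighted_L2 s. restrict_dist \<Omega> (fourier_synthesis f) = restrict_dist \<Omega> (fourier_synthesis g)
    \<and> (\<forall>h\<in>null_ext s \<Omega>. weighted_inner s f h = 0)"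
proof -
  let ?R = "\<lambda>f. restrict_dist \<Omega> (fourier_synthesis f)"
  define A where "A = {f \<in> weighted_L2 s. ?R f = ?R g}"
  have "\<exists>f\<in>A. \<forall>h\<in>A. weighted_sq s f \<le> weighted_sq s h"
  proof (rule weighted_L2_minimal)
    show "A \<subseteq> weighted_L2 s" by (auto simp: A_def)
    show "A \<noteq> {}" using g by (auto simp: A_def)
    show "(\<lambda>\<xi>. 1/2 * p \<xi> + 1/2 * q \<xi>) \<in> A" if "p \<in> A" "q \<in> A" for p q
    proof -
      have L: "p \<in> weighted_L2 s" "q \<in> weighted_L2 s" using that by (auto simp: A_def)
      have "fourier_synthesis (\<lambda>\<xi>. 1/2 * p \<xi> + 1/2 * q \<xi>) \<psi> = fourier_synthesis g \<psi>"
        if "\<psi> \<in> test_functions \<Omega>" for \<psi>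
        using \<open>p \<in> A\<close> \<open>q \<in> A\<close> that fourier_synthesis_lincomb[OF L, of "1/2" "1/2"]
        by (simp add: A_def restrict_dist_eq_iff)
      then show ?thesis
        unfolding A_def using weighted_L2_lincomb[OF L, of "1/2" "1/2"] by (simp add: restrict_dist_eq_iff)
    qed
    fix p f assume p: "\<And>k::nat. p k \<in> A" and f: "f \<in> weighted_L2 s"
      and lim: "(\<lambda>k. weighted_sq s (\<lambda>\<xi>. p k \<xi> - f \<xi>)) \<longlonglongrightarrow> 0"
    have pL: "p k \<in> weighted_L2 s" for k using p by (auto simp: A_def)
    have "fourier_synthesis f \<psi> = fourier_synthesis g \<psi>" if \<psi>: "\<psi> \<in> test_functions \<Omega>" for \<psi>
    proof -
      have S: "\<psi> \<in> schwartz" using \<psi> test_functions_schwartz by blast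
      then have F: "fourier \<psi> \<in> weighted_L2 (- s)" by (simp add: fourier_schwartz schwartz_weighted_L2)
      have pg: "fourier_synthesis (p k) \<psi> = fourier_synthesis g \<psi>" for k
        using p[of k] \<psi> by (simp add: A_def restrict_dist_eq_iff)
      have "cmod (fourier_synthesis g \<psi> - fourier_synthesis f \<psi>) < e" if e: "0 < e" for e
      proof -
        obtain \<delta> where \<delta>: "\<delta> > 0" "\<And>d. d \<in> weighted_L2 s \<Longrightarrow> weighted_sq s d < \<delta> \<Longrightarrow>
            (\<integral>\<xi>. cmod (d \<xi>) * cmod (fourier \<psi> \<xi>) \<partial>lborel) < e"
          using weighted_pairing_small[OF F e] by blast
        have "\<forall>\<^sub>F k in sequentially. weighted_sq s (\<lambda>\<xi>. p k \<xi> - f \<xi>) < \<delta>"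
          using order_tendstoD(2)[OF lim \<delta>(1)] .
        then obtain k where k: "weighted_sq s (\<lambda>\<xi>. p k \<xi> - f \<xi>) < \<delta>"
          using eventually_happens sequentially_bot by blast
        have "fourier_synthesis g \<psi> - fourier_synthesis f \<psi> = (\<integral>\<xi>. (p k \<xi> - f \<xi>) * cnj (fourier \<psi> \<xi>) \<partial>lborel)"
          unfolding pg[of k, symmetric] unfolding fourier_synthesis_eq[OF S] left_diff_distrib
          by (rule Bochner_Integration.integral_diff[symmetric]; rule fourier_synthesis_integrable[OF _ S])
             (use pL f in auto)
        also have "cmod \<dots> \<le> (\<integral>\<xi>. cmod ((p k \<xi> - f \<xi>) * cnj (fourier \<psi> \<xi>)) \<partial>lborel)"
          by (rule integral_norm_bound)
        also have "\<dots> < e"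
          using \<delta>(2)[OF weighted_L2_diff[OF pL[of k] f] k] by (simp add: norm_mult)
        finally show ?thesis .
      qed
      then have "cmod (fourier_synthesis g \<psi> - fourier_synthesis f \<psi>) \<le> 0"
        by (meson linorder_not_le order_less_irrefl)
      then show ?thesis by simp
    qed
    then show "f \<in> A" using f by (simp add: A_def restrict_dist_eq_iff)
  qed
  then obtain f where f: "f \<in> A" "\<And>h. h \<in> A \<Longrightarrow> weighted_sq s f \<le> weighted_sq s h" by blast
  then have fL: "f \<in> weighted_L2 s" "?R f = ?R g" by (auto simp: A_def)
  have "weighted_sq s f \<le> weighted_sq s (\<lambda>\<xi>. f \<xi> + h \<xi>)" if h: "h \<in> null_ext s \<Omega>" for h
  proof (rule f(2))
    have hL: "h \<in> weighted_L2 s" using h by (simp add: null_ext_def)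
    have "(\<lambda>\<xi>. (f \<xi> + h \<xi>) - f \<xi>) \<in> null_ext s \<Omega>" using h by simp
    then show "(\<lambda>\<xi>. f \<xi> + h \<xi>) \<in> A"
      using null_ext_diff_iff[OF weighted_L2_add[OF fL(1) hL] fL(1), of \<Omega>] fL weighted_L2_add[OF fL(1) hL]
      by (simp add: A_def)
  qed
  then have "\<forall>h\<in>null_ext s \<Omega>. weighted_inner s f h = 0"
    unfolding null_ext_orthogonal_iff[OF fL(1)] by blast
  then show ?thesis using fL by blast
qed

lemma orthogonal_norm_le:
  assumes f: "f \<in> weighted_L2 s" and orth: "\<forall>h\<in>null_ext s \<Omega>. weighted_inner s f h = 0"
    and g: "g \<in> weighted_L2 s" and eq: "restrict_dist \<Omega> (fourier_synthesis g) = restrict_dist \<Omega> (fourier_synthesis f)"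
  shows "weighted_sq s f \<le> weighted_sq s g"
proof -
  have "(\<lambda>\<xi>. g \<xi> - f \<xi>) \<in> null_ext s \<Omega>" using null_ext_diff_iff[OF g f] eq by blast
  then have "weighted_sq s f \<le> weighted_sq s (\<lambda>\<xi>. f \<xi> + (g \<xi> - f \<xi>))"
    by (rule orth[unfolded null_ext_orthogonal_iff[OF f], rule_format])
  then show ?thesis by simp
qed

section \<open>The orthogonal complement and minimal extensions\<close>

context
  fixes \<Omega> :: "(real^'n) set" and s :: real
  assumes \<Omega>: "open \<Omega>"
begin

abbreviation (input) orth :: "((real^'n \<Rightarrow> complex) \<Rightarrow> complex) set" where
  "orth \<equiv> sobolev_orth s (sobolev_supported s (- \<Omega>))"

lemma orth_norm_le:
  assumes "U \<in> orth" "V \<in> sobolev s" "restrict_dist \<Omega> V = restrict_dist \<Omega> U"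
  shows "sobolev_norm s U \<le> sobolev_norm s V"
proof -
  have "U \<in> sobolev s" using assms(1) by (simp add: sobolev_orth_def)
  then obtain f where f: "f \<in> weighted_L2 s" "U = fourier_synthesis f" by (rule sobolevE)
  obtain g where g: "g \<in> weighted_L2 s" "V = fourier_synthesis g" using assms(2) by (rule sobolevE)
  show ?thesis
    using orthogonal_norm_le[OF f(1) _ g(1)] assms f g sobolev_orth_iff[OF \<Omega> f(1)]
    by (simp add: sobolev_norm_synthesis)
qed

text \<open>Supplies the value behind \<open>LEAST\<close>: the set of norms has a least element,
  attained by the extension in the complement.\<close>

lemma orth_norm:
  assumes U: "U \<in> orth"
  shows "sobolev_on_norm s \<Omega> (restrict_dist \<Omega> U) = sobolev_norm s U"
  unfolding sobolev_on_norm_def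
proof (rule Least_equality)
  show "sobolev_norm s U \<in> {sobolev_norm s V | V. V \<in> sobolev s \<and> restrict_dist \<Omega> V = restrict_dist \<Omega> U}"
    using U by (auto simp: sobolev_orth_def)
qed (use orth_norm_le[OF U] in auto)

lemma orth_extension:
  assumes "U \<in> sobolev s"
  obtains U0 where "U0 \<in> orth" "restrict_dist \<Omega> U0 = restrict_dist \<Omega> U"
proof -
  obtain g where g: "g \<in> weighted_L2 s" "U = fourier_synthesis g" using assms by (rule sobolevE)
  obtain f where "f \<in> weighted_L2 s" "restrict_dist \<Omega> (fourier_synthesis f) = restrict_dist \<Omega> U"
    "\<forall>h\<in>null_ext s \<Omega>. weighted_inner s f h = 0"
    using minimal_extension_exists[OF g(1), of \<Omega>] g(2) by blast
  then show ?thesis using that sobolev_orth_iff[OF \<Omega>] by blast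
qed

lemma sobolev_on_norm_le:
  assumes "U \<in> sobolev s"
  shows "sobolev_on_norm s \<Omega> (restrict_dist \<Omega> U) \<le> sobolev_norm s U"
proof -
  obtain U0 where U0: "U0 \<in> orth" "restrict_dist \<Omega> U0 = restrict_dist \<Omega> U"
    using orth_extension[OF assms] .
  then show ?thesis using orth_norm[OF U0(1)] orth_norm_le[OF U0(1) assms] by simp
qed

text \<open>The norm of \<open>U\<close> equals that of the extension in the complement, so no
  extension of the same restriction is shorter, and minimality amounts to orthogonality.\<close>

lemma orth_if_norm_eq:
  assumes U: "U \<in> sobolev s" and eq: "sobolev_on_norm s \<Omega> (restrict_dist \<Omega> U) = sobolev_norm s U"
  shows "U \<in> orth"
proof -
  obtain U0 where U0: "U0 \<in> orth" "restrict_dist \<Omega> U0 = restrict_dist \<Omega> U"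
    using orth_extension[OF U] .
  obtain g where g: "g \<in> weighted_L2 s" "U = fourier_synthesis g" using U by (rule sobolevE)
  have "weighted_sq s g \<le> weighted_sq s (\<lambda>\<xi>. g \<xi> + h \<xi>)" if h: "h \<in> null_ext s \<Omega>" for h
  proof -
    have hL: "h \<in> weighted_L2 s" using h by (simp add: null_ext_def)
    note gh = weighted_L2_add[OF g(1) hL]
    have "(\<lambda>\<xi>. (g \<xi> + h \<xi>) - g \<xi>) \<in> null_ext s \<Omega>" using h by simp
    then have "restrict_dist \<Omega> (fourier_synthesis (\<lambda>\<xi>. g \<xi> + h \<xi>)) = restrict_dist \<Omega> U0"
      using null_ext_diff_iff[OF gh g(1), of \<Omega>] g(2) U0(2) by simp
    then have "sobolev_norm s U0 \<le> sobolev_norm s (fourier_synthesis (\<lambda>\<xi>. g \<xi> + h \<xi>))"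
      using orth_norm_le[OF U0(1) fourier_synthesis_sobolev[OF gh]] by blast
    then have "sobolev_norm s U \<le> sobolev_norm s (fourier_synthesis (\<lambda>\<xi>. g \<xi> + h \<xi>))"
      using orth_norm[OF U0(1)] U0(2) eq by simp
    then show ?thesis using g gh by (simp add: sobolev_norm_synthesis)
  qed
  then have "\<forall>h\<in>null_ext s \<Omega>. weighted_inner s g h = 0"
    unfolding null_ext_orthogonal_iff[OF g(1)] by blast
  then show ?thesis using sobolev_orth_iff[OF \<Omega> g(1)] g(2) by blast
qed

lemma weighted_inner_diff:
  assumes "f \<in> weighted_L2 s" "g \<in> weighted_L2 s" "h \<in> weighted_L2 s"
  shows "weighted_inner s (\<lambda>\<xi>. f \<xi> - g \<xi>) h = weighted_inner s f h - weighted_inner s g h"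
  unfolding weighted_inner_def left_diff_distrib right_diff_distrib
  by (intro Bochner_Integration.integral_diff weighted_inner_integrable assms)

lemma orth_diff:
  assumes U: "U \<in> orth" and V: "V \<in> orth"
  shows "(\<lambda>\<phi>. U \<phi> - V \<phi>) \<in> orth"
proof -
  obtain f where f: "f \<in> weighted_L2 s" "U = fourier_synthesis f"
    using U by (auto simp: sobolev_orth_def elim: sobolevE)
  obtain g where g: "g \<in> weighted_L2 s" "V = fourier_synthesis g"
    using V by (auto simp: sobolev_orth_def elim: sobolevE)
  have eq: "(\<lambda>\<phi>. U \<phi> - V \<phi>) = fourier_synthesis (\<lambda>\<xi>. f \<xi> - g \<xi>)"
    using fourier_synthesis_lincomb[OF f(1) g(1), of 1 "-1"] f g by simp
  have "weighted_inner s (\<lambda>\<xi>. f \<xi> - g \<xi>) h = 0" if h: "h \<in> null_ext s \<Omega>" for h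
  proof -
    have hL: "h \<in> weighted_L2 s" using h by (simp add: null_ext_def)
    show ?thesis
      using weighted_inner_diff[OF f(1) g(1) hL] U V h
      by (simp add: f(2) g(2) sobolev_orth_iff[OF \<Omega>] f(1) g(1))
  qed
  then show ?thesis unfolding eq using sobolev_orth_iff[OF \<Omega> weighted_L2_diff[OF f(1) g(1)]] by blast
qed

text \<open>The inner product with a fixed \<open>h\<close> is the pairing with the weight times
  \<open>h\<close>, which has order \<open>- s\<close>. Hence it is continuous in the norm and its
  zero set is closed.\<close>

lemma orth_closed:
  assumes U: "U \<in> norm_closure (sobolev_norm s) (sobolev s) A" and A: "A \<subseteq> orth"
  shows "U \<in> orth"
proof -
  have "U \<in> sobolev s" using U by (simp add: norm_closure_def)
  then obtain f where f: "f \<in> weighted_L2 s" "U = fourier_synthesis f" by (rule sobolevE)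
  have "weighted_inner s f h = 0" if h: "h \<in> null_ext s \<Omega>" for h
  proof -
    have hL: "h \<in> weighted_L2 s" using h by (simp add: null_ext_def)
    note [measurable] = weighted_L2_measurable[OF hL]
    let ?p = "\<lambda>\<xi>. of_real (sobolev_weight s \<xi>) * h \<xi>"
    have "sobolev_weight (- s) \<xi> * (cmod (?p \<xi>))\<^sup>2 = sobolev_weight s \<xi> * (cmod (h \<xi>))\<^sup>2" for \<xi>
    proof -
      have "sobolev_weight (- s) \<xi> * (cmod (?p \<xi>))\<^sup>2
          = (sobolev_weight (- s) \<xi> * sobolev_weight s \<xi>) * sobolev_weight s \<xi> * (cmod (h \<xi>))\<^sup>2"
        by (simp add: norm_mult power2_eq_square)
      then show ?thesis unfolding sobolev_weight_add by simp
    qed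
    then have p: "?p \<in> weighted_L2 (- s)" using weighted_L2_integrable[OF hL] by (simp add: weighted_L2_def)
    have "cmod (weighted_inner s f h) < e" if e: "0 < e" for e
    proof -
      obtain \<delta> where \<delta>: "\<delta> > 0" "\<And>d. d \<in> weighted_L2 s \<Longrightarrow> weighted_sq s d < \<delta> \<Longrightarrow>
          (\<integral>\<xi>. cmod (d \<xi>) * cmod (?p \<xi>) \<partial>lborel) < e"
        using weighted_pairing_small[OF p e] by blast
      obtain V where V: "V \<in> A" "sobolev_norm s (\<lambda>\<phi>. U \<phi> - V \<phi>) < sqrt \<delta>"
      proof -
        have "\<forall>\<epsilon>>0. \<exists>a\<in>A. sobolev_norm s (\<lambda>\<phi>. U \<phi> - a \<phi>) < \<epsilon>"
          using U by (simp add: norm_closure_def)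
        moreover have "0 < sqrt \<delta>" using \<delta>(1) by simp
        ultimately show ?thesis using that by blast
      qed
      then have VO: "V \<in> orth" using A by blast
      then obtain g where g: "g \<in> weighted_L2 s" "V = fourier_synthesis g"
        by (auto simp: sobolev_orth_def elim: sobolevE)
      note d = weighted_L2_diff[OF f(1) g(1)]
      have "(\<lambda>\<phi>. U \<phi> - V \<phi>) = fourier_synthesis (\<lambda>\<xi>. f \<xi> - g \<xi>)"
        using fourier_synthesis_lincomb[OF f(1) g(1), of 1 "-1"] f g by simp
      then have "weighted_sq s (\<lambda>\<xi>. f \<xi> - g \<xi>) < \<delta>"
        using V(2) by (simp add: sobolev_norm_synthesis[OF d])
      from \<delta>(2)[OF d this]
      have lt: "(\<integral>\<xi>. cmod (of_real (sobolev_weight s \<xi>) * (f \<xi> - g \<xi>) * cnj (h \<xi>)) \<partial>lborel) < e"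
        by (simp add: norm_mult mult_ac)
      have "weighted_inner s g h = 0"
        using VO g h sobolev_orth_iff[OF \<Omega> g(1)] by blast
      then have "weighted_inner s f h = weighted_inner s (\<lambda>\<xi>. f \<xi> - g \<xi>) h"
        using weighted_inner_diff[OF f(1) g(1) hL] by simp
      also have "cmod \<dots> \<le> (\<integral>\<xi>. cmod (of_real (sobolev_weight s \<xi>) * (f \<xi> - g \<xi>) * cnj (h \<xi>)) \<partial>lborel)"
        unfolding weighted_inner_def by (rule integral_norm_bound)
      finally show ?thesis using lt by linarith
    qed
    then have "cmod (weighted_inner s f h) \<le> 0" by (meson linorder_not_le order_less_irrefl)
    then show ?thesis by simp
  qed
  then show ?thesis using f sobolev_orth_iff[OF \<Omega> f(1)] by blast
qed

end

text \<open>All supports involved lie in one bounded set, where the polynomial weights are bounded;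
  outside it all derivatives vanish.\<close>

lemma converges_test_schwartz:
  fixes \<phi> :: "real^'n \<Rightarrow> complex"
  assumes "converges_test \<Omega> \<Phi> \<phi>"
  shows "converges_schwartz \<Phi> \<phi>"
  unfolding converges_schwartz_def
proof (intro conjI allI)
  from assms obtain K where T: "\<And>j. \<Phi> j \<in> test_functions \<Omega>" "\<phi> \<in> test_functions \<Omega>"
    and K: "compact K" "\<And>j. fun_supp (\<Phi> j) \<subseteq> K"
    and lim: "\<And>is. uniform_limit UNIV (\<lambda>j. partials is (\<Phi> j)) (partials is \<phi>) sequentially"
    unfolding converges_test_def by blast
  show "\<Phi> j \<in> schwartz" "\<phi> \<in> schwartz" for j using T test_functions_schwartz by blast+
  fix k "is"
  have "bounded (K \<union> fun_supp \<phi>)"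
    using K(1) T(2) by (auto dest: test_functionsD compact_imp_bounded)
  then obtain r where r: "\<And>x. x \<in> K \<union> fun_supp \<phi> \<Longrightarrow> norm x \<le> r" by (auto simp: bounded_iff)
  have zero: "partials is f x = 0" if "x \<notin> fun_supp f" for f and x :: "real^'n"
    using that
  proof (induction "is" arbitrary: x)
    case (Cons i "is")
    show ?case using pd_eq_0[OF closed_fun_supp Cons.IH Cons.prems, where i=i] by simp
  qed (simp add: not_in_fun_supp)
  define C where "C = (1 + \<bar>r\<bar>) ^ k"
  have C: "C > 0" by (simp add: C_def add_pos_nonneg)
  show "uniform_limit UNIV (\<lambda>j x. (1 + norm x) ^ k *\<^sub>R partials is (\<Phi> j) x)
      (\<lambda>x. (1 + norm x) ^ k *\<^sub>R partials is \<phi> x) sequentially"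
  proof (rule uniform_limitI)
    fix e :: real assume "0 < e"
    then have "0 < e / C" using C by simp
    from uniform_limitD[OF lim this, of "is"]
    show "\<forall>\<^sub>F j in sequentially. \<forall>x\<in>UNIV. dist ((1 + norm x) ^ k *\<^sub>R partials is (\<Phi> j) x) ((1 + norm x) ^ k *\<^sub>R partials is \<phi> x) < e"
    proof eventually_elim
      case (elim j)
      show ?case
      proof
        fix x :: "real^'n"
        show "dist ((1 + norm x) ^ k *\<^sub>R partials is (\<Phi> j) x) ((1 + norm x) ^ k *\<^sub>R partials is \<phi> x) < e"
        proof (cases "x \<in> K \<union> fun_supp \<phi>")
          case True
          have "(1 + norm x) ^ k \<le> C" unfolding C_def using r[OF True] by (intro power_mono) auto
          then have "(1 + norm x) ^ k * dist (partials is (\<Phi> j) x) (partials is \<phi> x)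
              \<le> C * dist (partials is (\<Phi> j) x) (partials is \<phi> x)"
            by (rule mult_right_mono) simp
          also have "\<dots> < e" using elim C by (simp add: field_simps)
          finally show ?thesis by (simp add: dist_norm scaleR_diff_right[symmetric] abs_of_nonneg)
        next
          case False
          then have "partials is (\<Phi> j) x = 0" "partials is \<phi> x = 0" using zero K(2) by blast+
          then show ?thesis using \<open>0 < e\<close> by simp
        qed
      qed
    qed
  qed
qed

lemma restrict_dist_distribution:
  assumes "u \<in> tempered"
  shows "restrict_dist \<Omega> u \<in> distributions \<Omega>"
  unfolding distributions_def
proof (intro CollectI conjI allI impI)
  show "restrict_dist \<Omega> u \<phi> = 0" if "\<phi> \<notin> test_functions \<Omega>" for \<phi>
    using that by (simp add: restrict_dist_def on_space_def)
  show "antilinear_on (test_functions \<Omega>) (restrict_dist \<Omega> u)"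
    using assms test_functions_subset_schwartz[of \<Omega>]
    by (auto simp: antilinear_on_def tempered_def restrict_dist_apply test_functions_lincomb subset_iff)
  fix \<Phi> and \<phi> :: "real^'a \<Rightarrow> complex" assume c: "converges_test \<Omega> \<Phi> \<phi>"
  then have "(\<lambda>j. u (\<Phi> j)) \<longlonglongrightarrow> u \<phi>"
    using assms converges_test_schwartz[OF c] by (simp add: tempered_def)
  then show "(\<lambda>j. restrict_dist \<Omega> u (\<Phi> j)) \<longlonglongrightarrow> restrict_dist \<Omega> u \<phi>"
    using c by (simp add: converges_test_def restrict_dist_apply)
qed

lemma restrict_dist_sobolev_on: "u \<in> sobolev s \<Longrightarrow> restrict_dist \<Omega> u \<in> sobolev_on s \<Omega>"
  unfolding sobolev_on_def using restrict_dist_distribution by (auto simp: sobolev_def)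

section \<open>Integer orders\<close>

lemma fourier_sum:
  assumes "finite I" "\<And>i. i \<in> I \<Longrightarrow> integrable lborel (f i)"
  shows "fourier (\<lambda>x. \<Sum>i\<in>I. f i x) \<xi> = (\<Sum>i\<in>I. fourier (f i) \<xi>)"
  using assms
proof (induction I rule: finite_induct)
  case empty
  then show ?case by (simp add: fourier_def)
next
  case (insert i I)
  then show ?case
    using fourier_lincomb[of "f i" "\<lambda>x. \<Sum>i\<in>I. f i x" 1 1 \<xi>] by simp
qed

text \<open>Each factor 1 + |\<xi>|^2 is the symbol of 1 - \<Delta>, a differential operator, which
  does not enlarge supports.\<close>

lemma weight_times_fourier:
  fixes \<phi> :: "real^'n \<Rightarrow> complex"
  assumes "\<phi> \<in> test_functions \<Omega>"
  shows "\<exists>\<psi>\<in>test_functions \<Omega>. \<forall>\<xi>. fourier \<psi> \<xi> = of_real (sobolev_weight (real m) \<xi>) * fourier \<phi> \<xi>"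
proof (induction m)
  case 0
  then show ?case using assms by auto
next
  case (Suc m)
  then obtain \<psi> where \<psi>: "\<psi> \<in> test_functions \<Omega>"
    "\<And>\<xi>. fourier \<psi> \<xi> = of_real (sobolev_weight (real m) \<xi>) * fourier \<phi> \<xi>" by blast
  note S = test_functions_schwartz[OF \<psi>(1)]
  let ?L = "\<lambda>x. \<Sum>i\<in>UNIV. pd i (pd i \<psi>) x"
  let ?\<psi> = "\<lambda>x. \<psi> x - ?L x"
  have "?\<psi> \<in> test_functions \<Omega>"
  proof (rule test_functionsI[of _ "fun_supp \<psi>"])
    show "smooth ?\<psi>"
      by (intro smooth_diff smooth_sum smooth_pd schwartz_smooth S)
    show "?\<psi> x = 0" if "x \<notin> fun_supp \<psi>" for x
    proof -
      have 1: "pd i \<psi> y = 0" if "y \<notin> fun_supp \<psi>" for i y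
        by (rule pd_eq_0[OF closed_fun_supp not_in_fun_supp that])
      have "pd i (pd i \<psi>) x = 0" for i
        by (rule pd_eq_0[OF closed_fun_supp 1 that])
      then show ?thesis using not_in_fun_supp[OF that] by simp
    qed
  qed (use \<psi>(1) in \<open>auto dest: test_functionsD\<close>)
  moreover have "fourier ?\<psi> \<xi> = of_real (sobolev_weight (real (Suc m)) \<xi>) * fourier \<phi> \<xi>" for \<xi>
  proof -
    have i: "integrable lborel (pd i (pd i \<psi>))" for i by (intro schwartz_integrable schwartz_pd S)
    have iL: "integrable lborel ?L" by (rule Bochner_Integration.integrable_sum) (rule i)
    have "fourier ?L \<xi> = (\<Sum>i\<in>UNIV. fourier (pd i (pd i \<psi>)) \<xi>)" by (rule fourier_sum) (auto intro: i)
    also have "\<dots> = (\<Sum>i\<in>UNIV. - of_real ((\<xi> $ i)\<^sup>2) * fourier \<psi> \<xi>)"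
      by (simp add: fourier_pd S schwartz_pd power2_eq_square mult_ac)
    also have "\<dots> = - of_real ((norm \<xi>)\<^sup>2) * fourier \<psi> \<xi>"
    proof -
      have "(norm \<xi>)\<^sup>2 = (\<Sum>i\<in>UNIV. (\<xi> $ i)\<^sup>2)"
        unfolding power2_norm_eq_inner inner_vec_def by (simp add: power2_eq_square)
      then show ?thesis by (simp add: sum_distrib_right sum_negf)
    qed
    finally have "fourier ?\<psi> \<xi> = of_real (1 + (norm \<xi>)\<^sup>2) * fourier \<psi> \<xi>"
      using fourier_diff[OF schwartz_integrable[OF S] iL, of \<xi>]
      by (simp add: algebra_simps)
    moreover have "1 + (norm \<xi>)\<^sup>2 = sobolev_weight 1 \<xi>"
      using one_plus_norm_sq_pos[of \<xi>] by (simp add: sobolev_weight_def)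
    ultimately have "fourier ?\<psi> \<xi> = of_real (sobolev_weight 1 \<xi> * sobolev_weight (real m) \<xi>) * fourier \<phi> \<xi>"
      by (simp only: \<psi>(2) of_real_mult mult.assoc)
    then show ?thesis unfolding sobolev_weight_add by simp
  qed
  ultimately show ?case by blast
qed

text \<open>The inner product of order \<open>m\<close> is the conjugate of the pairing of
  \<open>h\<close> with (1 - \<Delta>)^m \<phi>, a test function on \<Omega>, where \<open>h\<close>
  represents 0.\<close>

lemma test_functions_orth_if_nat:
  fixes \<Omega> :: "(real^'n) set"
  assumes \<Omega>: "open \<Omega>"
  shows "regular_dist ` test_functions \<Omega> \<subseteq> sobolev_orth (real m) (sobolev_supported (real m) (- \<Omega>))"
proof
  fix u assume "u \<in> regular_dist ` test_functions \<Omega>"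
  then obtain \<phi> where \<phi>: "\<phi> \<in> test_functions \<Omega>" "u = regular_dist \<phi>" by auto
  have S: "\<phi> \<in> schwartz" using \<phi> test_functions_schwartz by blast
  obtain \<psi> where \<psi>: "\<psi> \<in> test_functions \<Omega>"
    "\<And>\<xi>. fourier \<psi> \<xi> = of_real (sobolev_weight (real m) \<xi>) * fourier \<phi> \<xi>"
    using weight_times_fourier[OF \<phi>(1)] by blast
  have "weighted_inner (real m) (fourier \<phi>) h = 0" if h: "h \<in> null_ext (real m) \<Omega>" for h
  proof -
    have "fourier_synthesis h \<psi> = 0" using h \<psi>(1) by (simp add: null_ext_def)
    then have "cnj (\<integral>\<xi>. h \<xi> * cnj (fourier \<psi> \<xi>) \<partial>lborel) = 0"
      using test_functions_schwartz[OF \<psi>(1)] by (simp add: fourier_synthesis_eq)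
    then have "(\<integral>\<xi>. cnj (h \<xi> * cnj (fourier \<psi> \<xi>)) \<partial>lborel) = 0"
      by (simp only: Bochner_Integration.integral_cnj)
    then show ?thesis unfolding weighted_inner_def \<psi>(2)[symmetric] by (simp add: mult.commute)
  qed
  then show "u \<in> sobolev_orth (real m) (sobolev_supported (real m) (- \<Omega>))"
    unfolding \<phi>(2) regular_dist_eq_synthesis[OF S]
    using sobolev_orth_iff[OF \<Omega> schwartz_weighted_L2[OF fourier_schwartz[OF S]]] by blast
qed

section \<open>Non-integer orders\<close>

lemma integral_pos_on_box:
  fixes f :: "real^'n \<Rightarrow> real"
  assumes f: "integrable lborel f" "\<And>x. 0 \<le> f x" and pos: "\<And>x. x \<in> box a b \<Longrightarrow> 0 < f x"
    and ne: "box a b \<noteq> {}"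
  shows "0 < (\<integral>x. f x \<partial>lborel)"
proof (rule ccontr)
  assume "\<not> 0 < (\<integral>x. f x \<partial>lborel)"
  moreover have "0 \<le> (\<integral>x. f x \<partial>lborel)" using f(2) by simp
  ultimately have "(\<integral>x. f x \<partial>lborel) = 0" by linarith
  then have "AE x in lborel. f x = 0"
    using integral_nonneg_eq_0_iff_AE[OF f(1)] f(2) by simp
  then have "AE x in lborel. x \<notin> box a b"
    by eventually_elim (use pos in force)
  then have "box a b \<in> null_sets lborel"
    by (subst AE_iff_null_sets) auto
  then have "negligible (box a b)"
    by (simp add: negligible_iff_null_sets null_sets_completionI)
  then show False using open_not_negligible[OF open_box ne] by simp
qed

text \<open>Multiplication by the conjugate of \<open>u y\<close> makes the real part positive near
  \<open>y\<close>; a bump concentrated there then has a positive integral against it.\<close>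

lemma zero_if_orthogonal_to_bumps:
  fixes u :: "real^'n \<Rightarrow> complex"
  assumes u: "continuous_on UNIV u" "rapid u" and V: "open V" "y \<in> V"
    and orth: "\<And>a b. cbox a b \<subseteq> V \<Longrightarrow> (\<integral>x. u x * cnj (bump 1 a b x) \<partial>lborel) = 0"
  shows "u y = 0"
proof (rule ccontr)
  assume nz: "u y \<noteq> 0"
  let ?h = "\<lambda>x. Re (cnj (u y) * u x)"
  have cont: "continuous_on UNIV ?h" by (intro continuous_intros u)
  have "Re (cnj (u y) * u y) = (cmod (u y))\<^sup>2" unfolding cmod_power2 by (simp add: power2_eq_square)
  then have y: "0 < ?h y" using nz by simp
  have "open ({x. 0 < ?h x} \<inter> V)"
    using cont V(1) by (intro open_Int open_Collect_less continuous_on_const) auto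
  from open_contains_cbox[OF this, of y] obtain a b
    where ab: "cbox a b \<subseteq> {x. 0 < ?h x} \<inter> V" "y \<in> box a b"
    using y V(2) by (metis (mono_tags, lifting) IntI mem_Collect_eq)
  let ?f = "\<lambda>x. ?h x * bump_real 1 a b x"
  have um [measurable]: "u \<in> borel_measurable borel" using u(1) by (rule borel_measurable_continuous_onI)
  have bm: "bump 1 a b \<in> borel_measurable borel" by (intro smooth_measurable smooth_bump) simp
  have i: "integrable lborel (\<lambda>x. u x * cnj (bump 1 a b x))"
  proof (rule Bochner_Integration.integrable_bound[OF rapid_integrable[OF u(2) um]])
    show "(\<lambda>x. u x * cnj (bump 1 a b x)) \<in> borel_measurable lborel" using bm by simp
    show "AE x in lborel. norm (u x * cnj (bump 1 a b x)) \<le> norm (u x)"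
      using bump_real_le_1[of 1 a b] bump_real_nonneg[of 1 a b]
      by (intro AE_I2) (simp add: bump_def norm_mult mult_left_le)
  qed
  have eq: "?f x = Re (cnj (u y) * (u x * cnj (bump 1 a b x)))" for x
    by (simp add: bump_def algebra_simps)
  have "integrable lborel ?f"
    unfolding eq by (intro integrable_Re integrable_mult_right i)
  moreover have "0 \<le> ?f x" for x
  proof (cases "x \<in> box a b")
    case True
    then have "0 < ?h x" using ab(1) box_subset_cbox by blast
    then show ?thesis using bump_real_nonneg[of 1 a b x] by simp
  qed (simp add: bump_real_outside)
  moreover have "0 < ?f x" if "x \<in> box a b" for x
  proof -
    have "0 < ?h x" using ab(1) that box_subset_cbox by blast
    then show ?thesis using bump_real_pos[OF that] by simp
  qed
  ultimately have "0 < (\<integral>x. ?f x \<partial>lborel)"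
    using ab(2) by (intro integral_pos_on_box[of ?f a b]) auto
  also have "(\<integral>x. ?f x \<partial>lborel) = Re (\<integral>x. cnj (u y) * (u x * cnj (bump 1 a b x)) \<partial>lborel)"
    unfolding eq by (intro integral_Re integrable_mult_right i)
  also have "\<dots> = 0"
    using orth[of a b] ab(1) by simp
  finally show False by simp
qed

text \<open>The easy half of the Paley-Wiener theorem: over a compact box the kernel makes sense for
  every complex \<open>z\<close> and may be differentiated under the integral.\<close>

lemma holomorphic_exp_moment:
  fixes u :: "real^'n \<Rightarrow> complex"
  assumes u: "continuous_on UNIV u" and zero: "\<And>x. x \<notin> cbox a b \<Longrightarrow> u x = 0"
  shows "(\<lambda>z. \<integral>x. exp (\<alpha> * z * of_real (x $ j)) * u x \<partial>lborel) holomorphic_on UNIV"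
proof -
  let ?f = "\<lambda>z (x::real^'n). exp (\<alpha> * z * of_real (x $ j)) * u x"
  have c: "continuous_on A (?f z)" for A z
    by (intro continuous_intros continuous_on_subset[OF u]) auto
  have "(\<integral>x. ?f z x \<partial>lborel) = integral (cbox a b) (?f z)" for z
  proof -
    have "set_integrable lborel (cbox a b) (?f z)"
      unfolding set_integrable_def by (rule borel_integrable_compact[OF compact_cbox c])
    from set_borel_integral_eq_integral(2)[OF this]
    have "(LINT x:cbox a b|lborel. ?f z x) = integral (cbox a b) (?f z)" .
    moreover have "(LINT x:cbox a b|lborel. ?f z x) = (\<integral>x. ?f z x \<partial>lborel)"
      unfolding set_lebesgue_integral_def
      by (rule Bochner_Integration.integral_cong) (auto simp: indicator_def zero)
    ultimately show ?thesis by simp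
  qed
  moreover have "(\<lambda>z. integral (cbox a b) (?f z)) holomorphic_on UNIV"
  proof (rule leibniz_rule_holomorphic[where fx="\<lambda>z x. \<alpha> * of_real (x $ j) * ?f z x"])
    show "((\<lambda>z. ?f z x) has_field_derivative \<alpha> * of_real (x $ j) * ?f z x) (at z within UNIV)" for z x
      by (auto intro!: derivative_eq_intros)
    show "?f z integrable_on cbox a b" for z
      by (rule integrable_continuous[OF c])
    show "continuous_on (UNIV \<times> cbox a b) (\<lambda>(z, x). \<alpha> * of_real (x $ j) * ?f z x)"
      unfolding split_beta
      by (intro continuous_intros continuous_on_compose2[OF u]) auto
  qed simp
  ultimately show ?thesis by simp
qed

lemma powr_limit_pos_imp_eq:
  fixes s t L :: real
  assumes lim: "((\<lambda>x. x powr t / x powr s) \<longlongrightarrow> L) (at_right 0)" and L: "L > 0"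
  shows "s = t"
proof (rule ccontr)
  assume "s \<noteq> t"
  have pos: "\<forall>\<^sub>F x in at_right 0. 0 < (x::real)" by (rule eventually_at_right_less)
  have z: "((\<lambda>x::real. x powr c) \<longlongrightarrow> 0) (at_right 0)" if "0 < c" for c :: real
  proof (rule tendsto_zero_powrI)
    show "\<forall>\<^sub>F x in at_right 0. 0 \<le> (x::real)" using pos by eventually_elim simp
  qed (use that in auto)
  consider "s < t" | "t < s" using \<open>s \<noteq> t\<close> by linarith
  then show False
  proof cases
    case 1
    have "((\<lambda>x. x powr t / x powr s) \<longlongrightarrow> 0) (at_right 0)"
    proof (rule Lim_transform_eventually[OF z[of "t - s"]])
      show "\<forall>\<^sub>F x in at_right 0. x powr (t - s) = x powr t / x powr s"
        using pos by eventually_elim (simp add: powr_diff)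
    qed (use 1 in simp)
    then show False using tendsto_unique[OF _ lim] L by force
  next
    \<comment> \<open>Here the quotient itself blows up, so it is multiplied by a positive power of
      x: the product is 1, but with a finite limit \<open>L\<close> it would tend to 0.\<close>
    case 2
    have "((\<lambda>x. (x powr t / x powr s) * x powr (s - t)) \<longlongrightarrow> L * 0) (at_right 0)"
      using 2 by (intro tendsto_mult lim z) simp
    moreover have "((\<lambda>x. (x powr t / x powr s) * x powr (s - t)) \<longlongrightarrow> 1) (at_right 0)"
    proof (rule Lim_transform_eventually[OF tendsto_const])
      show "\<forall>\<^sub>F x in at_right 0. 1 = (x powr t / x powr s) * x powr (s - t)"
        using pos by eventually_elim (simp add: powr_diff)
    qed
    ultimately show False using tendsto_unique[of "at_right (0::real)"] by fastforce
  qed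
qed

text \<open>The identity extends from the real segment to the unit disc. On the imaginary axis it
  compares the order of vanishing of \<open>G\<close> at \<open>\<i>\<close> with the exponent \<open>s\<close>.\<close>

lemma entire_quotient_order:
  fixes F G :: "complex \<Rightarrow> complex" and s :: real
  assumes F: "F holomorphic_on UNIV" and G: "G holomorphic_on UNIV" and Fi: "F \<i> \<noteq> 0"
    and eq: "\<And>t::real. G (of_real t) = of_real ((1 + t\<^sup>2) powr s) * F (of_real t)"
  shows "s \<in> \<nat>"
proof -
  let ?P = "\<lambda>z. exp (of_real s * Ln (1 + z\<^sup>2))"
  \<comment> \<open>Inside the unit disc 1 + z^2 has positive real part, so the principal logarithm
    is holomorphic along it.\<close>
  have re: "1 + z\<^sup>2 \<notin> \<real>\<^sub>\<le>\<^sub>0" if "z \<in> ball 0 1" for z :: complex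
  proof -
    have "cmod (z\<^sup>2) < 1" using that by (simp add: norm_power power_less_one_iff)
    then have "- 1 < Re (z\<^sup>2)" using abs_Re_le_cmod[of "z\<^sup>2"] by linarith
    then show ?thesis by (auto simp: complex_nonpos_Reals_iff)
  qed
  have P_real: "?P z = of_real (r powr s)" if "1 + z\<^sup>2 = of_real r" "0 < r" for z r
    using that by (simp add: Ln_of_real powr_def exp_of_real[symmetric])
  have disc: "G z - ?P z * F z = 0" if z: "z \<in> ball 0 1" for z
  proof (rule analytic_continuation[of "\<lambda>z. G z - ?P z * F z" "ball 0 1" "of_real ` {-1<..<1}" 0])
    show "(\<lambda>z. G z - ?P z * F z) holomorphic_on ball 0 1"
      using re by (intro holomorphic_intros holomorphic_on_subset[OF F] holomorphic_on_subset[OF G]) auto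
    let ?t = "\<lambda>n. inverse (real (Suc (Suc n)))"
    have "complex_of_real (?t n) \<in> complex_of_real ` {-1<..<1} - {0}" for n
    proof -
      have t: "0 < ?t n" "?t n < 1" by (simp_all add: field_simps)
      have "- 1 < ?t n" using t(1) by linarith
      with t have "?t n \<in> {-1<..<1}" "?t n \<noteq> 0" by (simp_all only: greaterThanLessThan_iff simp_thms)
      then show ?thesis by (simp only: Diff_iff imageI singleton_iff of_real_eq_0_iff not_False_eq_True simp_thms)
    qed
    moreover have "(\<lambda>n. complex_of_real (?t n)) \<longlonglongrightarrow> of_real 0"
      by (intro tendsto_of_real LIMSEQ_Suc LIMSEQ_inverse_real_of_nat)
    ultimately show "0 islimpt complex_of_real ` {-1<..<1}"
      unfolding islimpt_sequential by (intro exI[of _ "\<lambda>n. complex_of_real (?t n)"]) (simp only: of_real_0, blast)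
    fix w assume "w \<in> complex_of_real ` {-1<..<1}"
    then obtain t :: real where t: "w = of_real t" by auto
    have "0 < 1 + t\<^sup>2" by (simp add: add_pos_nonneg)
    then have "?P w = of_real ((1 + t\<^sup>2) powr s)" by (intro P_real) (simp_all add: t)
    then show "G w - ?P w * F w = 0" using eq[of t] by (simp add: t)
  qed (use z in auto)
  \<comment> \<open>On this axis 1 + z^2 is the positive real x (2 - x), so the power is real and
    behaves like a constant times x^s as x decreases to 0.\<close>
  have axis: "G (\<i> * of_real (1 - x)) = of_real ((x * (2 - x)) powr s) * F (\<i> * of_real (1 - x))"
    if x: "0 < x" "x < 1" for x
  proof -
    let ?z = "\<i> * complex_of_real (1 - x)"
    have "?z \<in> ball 0 1" using x by (simp add: norm_mult del: of_real_diff)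
    moreover have "1 + ?z\<^sup>2 = of_real (x * (2 - x))"
      by (simp add: power2_eq_square algebra_simps)
    then have "?P ?z = of_real ((x * (2 - x)) powr s)" by (rule P_real) (use x in simp)
    ultimately show ?thesis using disc by force
  qed
  have path: "((\<lambda>x. \<i> * of_real (1 - x)) \<longlongrightarrow> \<i> * of_real (1 - 0)) (at_right 0)"
    by (intro tendsto_intros)
  have "isCont F \<i>" using holomorphic_on_imp_continuous_on[OF F] by (simp add: continuous_on_eq_continuous_at)
  from isCont_tendsto_compose[OF this] path
  have limF: "((\<lambda>x. F (\<i> * of_real (1 - x))) \<longlongrightarrow> F \<i>) (at_right 0)" by simp
  have ev: "\<forall>\<^sub>F x in at_right 0. 0 < x \<and> x < (1::real)"
    by (intro eventually_conj eventually_at_right_less eventually_at_rightI[of 0 1]) auto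
  \<comment> \<open>A factorization at \<open>\<i>\<close> with a finite order exists only if
    \<open>G\<close> is not identically 0; near \<open>\<i>\<close> the right-hand side of
    \<open>axis\<close> is nonzero because \<open>F \<i>\<close> is.\<close>
  have Gnz: "\<exists>w\<in>UNIV. G w \<noteq> 0"
  proof -
    have "\<forall>\<^sub>F x in at_right 0. F (\<i> * of_real (1 - x)) \<noteq> 0"
      using limF Fi by (rule tendsto_imp_eventually_ne)
    with ev have "\<forall>\<^sub>F x in at_right 0. G (\<i> * of_real (1 - x)) \<noteq> 0"
    proof eventually_elim
      case (elim x)
      then have "0 < x * (2 - x)" by simp
      then show ?case using axis[of x] elim by simp
    qed
    then show ?thesis using eventually_happens trivial_limit_at_right_real by blast
  qed
  \<comment> \<open>The case \<open>m = 0\<close> is included: it is the one where \<open>G\<close>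
    does not vanish at \<open>\<i>\<close>.\<close>
  define m where "m = nat (zorder G \<i>)"
  define g where "g = zor_poly G \<i>"
  from zorder_exist_zero[OF G open_UNIV connected_UNIV UNIV_I Gnz, of \<i>]
  obtain r where r: "r > 0" "g holomorphic_on cball \<i> r"
    "\<And>w. w \<in> cball \<i> r \<Longrightarrow> G w = g w * (w - \<i>) ^ m" "\<And>w. w \<in> cball \<i> r \<Longrightarrow> g w \<noteq> 0"
    unfolding m_def g_def by blast
  have "isCont g \<i>"
    using r(1,2) by (metis centre_in_ball continuous_on_interior holomorphic_on_imp_continuous_on interior_cball)
  from isCont_tendsto_compose[OF this] path
  have limg: "((\<lambda>x. g (\<i> * of_real (1 - x))) \<longlongrightarrow> g \<i>) (at_right 0)" by simp
  have gi: "g \<i> \<noteq> 0" using r(1,4) by simp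
  have ball: "\<forall>\<^sub>F x in at_right 0. \<i> * of_real (1 - x) \<in> cball \<i> r"
  proof -
    have "\<forall>\<^sub>F x in at_right 0. dist (\<i> * of_real (1 - x)) \<i> < r"
      using path r(1) by (intro tendstoD) auto
    then show ?thesis by eventually_elim (simp add: dist_commute less_imp_le)
  qed
  \<comment> \<open>Solving |g| x^m = (x (2 - x))^s |F| for x^m / x^s leaves factors with a finite
    positive limit.\<close>
  let ?L = "(2 - 0) powr s * cmod (F \<i>) / cmod (g \<i>)"
  have "((\<lambda>x. (2 - x) powr s * cmod (F (\<i> * of_real (1 - x))) / cmod (g (\<i> * of_real (1 - x)))) \<longlongrightarrow> ?L) (at_right 0)"
    using gi by (intro tendsto_intros limF limg) auto
  then have "((\<lambda>x. x powr real m / x powr s) \<longlongrightarrow> ?L) (at_right 0)"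
  proof (rule Lim_transform_eventually)
    show "\<forall>\<^sub>F x in at_right 0. (2 - x) powr s * cmod (F (\<i> * of_real (1 - x))) / cmod (g (\<i> * of_real (1 - x)))
        = x powr real m / x powr s"
      using ev ball
    proof eventually_elim
      case (elim x)
      let ?z = "\<i> * complex_of_real (1 - x)"
      have "cmod (?z - \<i>) = x"
      proof -
        have "?z - \<i> = - (\<i> * of_real x)" by (simp add: algebra_simps)
        then have "cmod (?z - \<i>) = cmod (\<i> * of_real x)" by (simp only: norm_minus_cancel)
        then show ?thesis using elim by (simp add: norm_mult)
      qed
      then have "cmod (g ?z) * x ^ m = cmod (G ?z)" using r(3)[of ?z] elim by (simp add: norm_mult norm_power)
      also have "\<dots> = (x * (2 - x)) powr s * cmod (F ?z)" using axis[of x] elim by (simp add: norm_mult)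
      also have "(x * (2 - x)) powr s = x powr s * (2 - x) powr s" using elim by (simp add: powr_mult)
      finally have "cmod (g ?z) * x powr real m = x powr s * (2 - x) powr s * cmod (F ?z)"
        using elim by (simp add: powr_realpow)
      moreover have "cmod (g ?z) \<noteq> 0" using r(4)[of ?z] elim by simp
      moreover have "x powr s \<noteq> 0" using elim by simp
      ultimately show ?case by (simp add: field_simps)
    qed
  qed
  then have "s = real m"
    by (rule powr_limit_pos_imp_eq) (use Fi gi in simp)
  then show ?thesis by simp
qed

lemma nat_if_test_functions_orth:
  fixes \<Omega> :: "(real^'n) set" and s :: real
  assumes \<Omega>: "\<Omega> \<noteq> {}" "open \<Omega>" "bounded \<Omega>"
    and orth: "regular_dist ` test_functions \<Omega> \<subseteq> sobolev_orth s (sobolev_supported s (- \<Omega>))"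
  shows "s \<in> \<nat>"
proof -
  obtain x0 where "x0 \<in> \<Omega>" using \<Omega>(1) by blast
  from open_contains_cbox[OF \<Omega>(2) this] obtain a b where ab: "cbox a b \<subseteq> \<Omega>" "x0 \<in> box a b" by metis
  define \<phi> where "\<phi> = bump 1 a b"
  have \<phi>: "\<phi> \<in> test_functions \<Omega>" unfolding \<phi>_def using ab(1) by (intro bump_test_function) auto
  note S = test_functions_schwartz[OF \<phi>]
  note F = fourier_schwartz[OF S]
  \<comment> \<open>The weight is absorbed into \<open>w\<close>, so that the inner product of order
    \<open>s\<close> with \<phi> becomes an unweighted pairing with \<open>w\<close>.\<close>
  define w where "w \<xi> = of_real (sobolev_weight s \<xi>) * fourier \<phi> \<xi>" for \<xi>
  have wr: "rapid w"
  proof (rule rapid_bound[OF schwartz_rapid[OF F], of _ 1 "2 * nat \<lceil>\<bar>s\<bar>\<rceil>"])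
    show "cmod (w \<xi>) \<le> 1 * (1 + norm \<xi>) ^ (2 * nat \<lceil>\<bar>s\<bar>\<rceil>) * cmod (fourier \<phi> \<xi>)" for \<xi>
      using mult_right_mono[OF sobolev_weight_le[of s \<xi>], of "cmod (fourier \<phi> \<xi>)"]
      by (simp add: w_def norm_mult)
  qed
  have "continuous_on UNIV (\<lambda>\<xi>::real^'n. sobolev_weight s \<xi>)"
    unfolding sobolev_weight_def
    by (intro continuous_intros) (use one_plus_norm_sq_pos in \<open>metis less_irrefl\<close>)
  then have wc: "continuous_on UNIV w"
    unfolding w_def by (intro continuous_intros smooth_continuous schwartz_smooth F)
  have wi: "integrable lborel w"
    by (intro rapid_integrable wr borel_measurable_continuous_onI wc)
  define u where "u x = fourier w (- x)" for x
  have uc: "continuous_on UNIV u"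
    unfolding u_def by (rule continuous_on_compose2[OF fourier_continuous[OF wi, of UNIV]]) (auto intro: continuous_intros)
  \<comment> \<open>A test function off the closure of \<Omega> annihilates those on \<Omega>, so
    its transform belongs to \<open>null_ext s \<Omega>\<close>; Parseval's identity then brings the
    orthogonality back to \<open>u\<close>.\<close>
  have pair: "(\<integral>x. u x * cnj (\<psi> x) \<partial>lborel) = 0" if \<psi>: "\<psi> \<in> test_functions (- closure \<Omega>)" for \<psi>
  proof -
    note S\<psi> = test_functions_schwartz[OF \<psi>]
    note F\<psi> = fourier_schwartz[OF S\<psi>]
    have "fourier_synthesis (fourier \<psi>) \<psi>' = 0" if \<psi>': "\<psi>' \<in> test_functions \<Omega>" for \<psi>'
    proof -
      have "\<psi> x * cnj (\<psi>' x) = 0" for x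
        using test_functionsD(4)[OF \<psi>, of x] test_functionsD(4)[OF \<psi>', of x] closure_subset[of \<Omega>] by auto
      note 0 = this
      show ?thesis
        unfolding regular_dist_eq_synthesis[OF S\<psi>, symmetric] regular_dist_def on_space_def
        by (simp only: 0) simp
    qed
    then have "fourier \<psi> \<in> null_ext s \<Omega>"
      by (simp add: null_ext_def schwartz_weighted_L2[OF F\<psi>])
    moreover have "fourier_synthesis (fourier \<phi>) \<in> sobolev_orth s (sobolev_supported s (- \<Omega>))"
      using orth \<phi> unfolding regular_dist_eq_synthesis[OF S, symmetric] by blast
    ultimately have "weighted_inner s (fourier \<phi>) (fourier \<psi>) = 0"
      using sobolev_orth_iff[OF \<Omega>(2) schwartz_weighted_L2[OF F]] by blast
    then have "(\<integral>\<xi>. w \<xi> * cnj (fourier \<psi> \<xi>) \<partial>lborel) = 0"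
      by (simp add: weighted_inner_def w_def)
    moreover have "fourier (\<lambda>x. \<psi> (- x)) (- \<xi>) = fourier \<psi> \<xi>" for \<xi>
      using fourier_reflect[OF schwartz_measurable[OF S\<psi>], of "- \<xi>"] by simp
    ultimately have "(\<integral>x. fourier w x * cnj (\<psi> (- x)) \<partial>lborel) = 0"
      using fourier_parseval[OF wi schwartz_integrable[OF schwartz_reflect[OF S\<psi>]]] by simp
    moreover have "(\<lambda>x. fourier w x * cnj (\<psi> (- x))) \<in> borel_measurable borel"
      using fourier_measurable[OF wi] schwartz_measurable[OF schwartz_reflect[OF S\<psi>]] by measurable
    ultimately show ?thesis
      using integral_lborel_affine[of "\<lambda>x. fourier w x * cnj (\<psi> (- x))" "-1" 0] by (simp add: u_def)
  qed
  from bounded_subset_cbox_symmetric[OF bounded_closure[OF \<Omega>(3)]]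
  obtain A B where AB: "closure \<Omega> \<subseteq> cbox A B" by metis
  \<comment> \<open>Decay of \<open>u\<close> is not known yet, so
    \<open>zero_if_orthogonal_to_bumps\<close> is applied to \<open>u\<close> times a bump, which
    has compact support.\<close>
  have u0: "u x = 0" if x: "x \<notin> closure \<Omega>" for x
  proof -
    obtain c d where cd: "cbox c d \<subseteq> - closure \<Omega>" "x \<in> box c d"
      using open_contains_cbox[of "- closure \<Omega>" x] x by (metis (no_types) ComplI closed_closure open_Compl)
    let ?v = "\<lambda>x. u x * bump 1 c d x"
    have sub: "box c d \<subseteq> cbox c d" by (rule box_subset_cbox)
    have vc: "continuous_on UNIV ?v"
      by (intro continuous_intros uc smooth_continuous smooth_bump) simp
    have vr: "rapid ?v"
      by (rule rapid_compact_support[OF vc compact_cbox[of c d]])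
         (simp add: bump_def bump_real_outside[OF contra_subsetD[OF sub]])
    have "?v x = 0"
    proof (rule zero_if_orthogonal_to_bumps[OF vc vr open_box cd(2)])
      fix a' b' assume a'b': "cbox a' b' \<subseteq> box c d"
      have "bump 1 a' b' \<in> test_functions (- closure \<Omega>)"
        using a'b' sub cd(1) by (intro bump_test_function) auto
      then have "(\<lambda>x. bump 1 a' b' x * bump 1 c d x) \<in> test_functions (- closure \<Omega>)"
        by (rule test_functions_mult) (intro smooth_bump, simp)
      from pair[OF this] show "(\<integral>x. ?v x * cnj (bump 1 a' b' x) \<partial>lborel) = 0"
        by (simp add: bump_def mult_ac)
    qed
    moreover have "bump 1 c d x \<noteq> 0" using bump_real_pos[OF cd(2), of 1] by (simp add: bump_def)
    ultimately show "u x = 0" by simp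
  qed
  have u0': "u x = 0" if "x \<notin> cbox A B" for x using u0 AB that by blast
  \<comment> \<open>Compact support of \<open>u\<close> gives the integrability of
    \<open>fourier w\<close> that inversion requires; only now can \<open>u\<close> be transformed
    back to \<open>w\<close>.\<close>
  have ur: "rapid u" by (rule rapid_compact_support[OF uc compact_cbox u0'])
  have "rapid (\<lambda>x. u (- x))" by (rule rapid_reflect[OF ur])
  then have "rapid (fourier w)" by (simp add: u_def)
  then have fwi: "integrable lborel (fourier w)"
    by (rule rapid_integrable) (rule fourier_measurable[OF wi])
  obtain C where C: "\<And>x. cmod (w x) \<le> C" using rapid_bounded[OF wr] by blast
  have inv: "fourier u \<xi> = w \<xi>" for \<xi>
  proof -
    have "fourier u \<xi> = fourier (fourier w) (- \<xi>)"
      unfolding u_def by (rule fourier_reflect[OF fourier_measurable[OF wi]])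
    also have "\<dots> = w \<xi>" by (rule fourier_inversion[OF wi fwi wc C])
    finally show ?thesis .
  qed
  \<comment> \<open>An arbitrary coordinate axis.\<close>
  define j :: 'n where "j = undefined"
  let ?M = "\<lambda>f z. \<integral>x. exp (- \<i> * z * of_real (x $ j)) * f x \<partial>lborel"
  have M: "fourier f (axis j t) = fourier_factor TYPE('n) *\<^sub>R ?M f (of_real t)" for f :: "real^'n \<Rightarrow> complex" and t
    by (simp add: fourier_def inner_axis' mult.assoc)
  have nrm: "norm (axis j t :: real^'n) = \<bar>t\<bar>" for t :: real by (simp add: norm_eq_sqrt_inner inner_axis_axis)
  show ?thesis
  proof (rule entire_quotient_order[where F="?M \<phi>" and G="?M u"])
    show "?M u holomorphic_on UNIV" by (rule holomorphic_exp_moment[OF uc u0'])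
    show "?M \<phi> holomorphic_on UNIV"
    proof (rule holomorphic_exp_moment[where a=a and b=b])
      show "continuous_on UNIV \<phi>" by (intro smooth_continuous schwartz_smooth S)
      show "\<phi> x = 0" if "x \<notin> cbox a b" for x
        unfolding \<phi>_def bump_def bump_real_outside[OF contra_subsetD[OF box_subset_cbox that]] by simp
    qed
    show "?M u (of_real t) = of_real ((1 + t\<^sup>2) powr s) * ?M \<phi> (of_real t)" for t
    proof -
      have "fourier_factor TYPE('n) *\<^sub>R ?M u (of_real t)
          = fourier_factor TYPE('n) *\<^sub>R (of_real ((1 + t\<^sup>2) powr s) * ?M \<phi> (of_real t))"
        using inv[of "axis j t"] unfolding w_def M sobolev_weight_def nrm by simp
      then show ?thesis by simp
    qed
    \<comment> \<open>At \<open>z = \<i>\<close> the kernel exp(-\<i> z x_j) is exp(x_j), so the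
      moment of the nonnegative bump is positive.\<close>
    let ?e = "\<lambda>x. exp (x $ j) * bump_real 1 a b x"
    have ec: "continuous_on UNIV (\<lambda>x. complex_of_real (exp (x $ j)) * \<phi> x)"
      by (intro continuous_intros smooth_continuous schwartz_smooth S)
    have er: "rapid (\<lambda>x. complex_of_real (exp (x $ j)) * \<phi> x)"
      by (rule rapid_compact_support[OF ec compact_cbox[of a b]])
         (simp add: \<phi>_def bump_def bump_real_outside[OF contra_subsetD[OF box_subset_cbox]])
    have ei: "integrable lborel (\<lambda>x. complex_of_real (?e x))"
      using rapid_integrable[OF er borel_measurable_continuous_onI[OF ec]] by (simp add: \<phi>_def bump_def)
    have "integrable lborel ?e" using integrable_Re[OF ei] by simp
    then have pos: "0 < (\<integral>x. ?e x \<partial>lborel)"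
      using ab(2) by (intro integral_pos_on_box[of ?e a b])
        (auto simp: bump_real_nonneg bump_real_pos)
    have "exp (- \<i> * \<i> * of_real (x $ j)) * \<phi> x = of_real (?e x)" for x
      by (simp add: \<phi>_def bump_def exp_of_real)
    then have "?M \<phi> \<i> = of_real (\<integral>x. ?e x \<partial>lborel)"
      by (simp only: integral_complex_of_real)
    then show "?M \<phi> \<i> \<noteq> 0" using pos by simp
  qed
qed

theorem proposition2p12:
  fixes \<Omega> :: "(real^'n) set" and s :: real
  assumes "\<Omega> \<noteq> {}" and "open \<Omega>" and "bounded \<Omega>"
  shows "(unitary_iso (sobolev_tilde s \<Omega>) (sobolev_norm s)
            (sobolev_on_0 s \<Omega>) (sobolev_on_norm s \<Omega>) (restrict_dist \<Omega>)
          \<longleftrightarrow> s \<in> \<nat>) \<and>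
         ((\<forall>\<phi>\<in>test_functions \<Omega>. sobolev_on_norm s \<Omega> (restrict_dist \<Omega> (regular_dist \<phi>))
              = sobolev_norm s (regular_dist \<phi>))
          \<longleftrightarrow> s \<in> \<nat>) \<and>
         (regular_dist ` test_functions \<Omega> \<subseteq> sobolev_orth s (sobolev_supported s (- \<Omega>))
          \<longleftrightarrow> s \<in> \<nat>)"
    (is "(?i \<longleftrightarrow> _) \<and> (?ii \<longleftrightarrow> _) \<and> (?iii \<longleftrightarrow> _)")
proof -
  note \<Omega> = assms(2)
  let ?R = "restrict_dist \<Omega>" and ?D = "regular_dist ` test_functions \<Omega>"
  have sob: "regular_dist \<phi> \<in> sobolev s" if "\<phi> \<in> test_functions \<Omega>" for \<phi>
    using that test_functions_schwartz by (intro regular_dist_sobolev) blast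
  have iii: "?iii \<longleftrightarrow> s \<in> \<nat>"
    using nat_if_test_functions_orth[OF assms] test_functions_orth_if_nat[OF \<Omega>] by (metis Nats_cases)
  have ii: "?ii \<longleftrightarrow> ?iii"
    using orth_norm[OF \<Omega>] orth_if_norm_eq[OF \<Omega> sob] by (auto simp: image_subset_iff)
  have "?ii" if ?i
  proof
    fix \<phi> assume \<phi>: "\<phi> \<in> test_functions \<Omega>"
    \<comment> \<open>A test function approximates itself, so it lies in the closure; only the norm
      of 0 has to be evaluated.\<close>
    have "sobolev_norm s (\<lambda>\<psi>. regular_dist \<phi> \<psi> - regular_dist \<phi> \<psi>) = 0"
    proof -
      have 0: "(\<lambda>\<xi>::real^'n. 0) \<in> weighted_L2 s" by (rule schwartz_weighted_L2[OF schwartz_zero])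
      have "(\<lambda>\<psi>. 0) = fourier_synthesis (\<lambda>\<xi>::real^'n. 0)"
        by (auto simp: fourier_synthesis_def on_space_def)
      then show ?thesis using sobolev_norm_synthesis[OF 0] by (simp add: weighted_sq_def)
    qed
    then have "regular_dist \<phi> \<in> sobolev_tilde s \<Omega>"
      unfolding sobolev_tilde_def norm_closure_def using \<phi> sob[OF \<phi>] by force
    then show "sobolev_on_norm s \<Omega> (?R (regular_dist \<phi>)) = sobolev_norm s (regular_dist \<phi>)"
      using \<open>?i\<close> by (simp add: unitary_iso_def)
  qed
  moreover have "?i" if D: ?iii
  proof -
    \<comment> \<open>The orthogonal complement is closed, so it contains the closure of the test
      functions, and restriction is isometric there.\<close>
    have tilde: "U \<in> sobolev_orth s (sobolev_supported s (- \<Omega>))" if "U \<in> sobolev_tilde s \<Omega>" for U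
      using orth_closed[OF \<Omega> _ D] that by (simp add: sobolev_tilde_def)
    have tilde_sob: "U \<in> sobolev s" if "U \<in> sobolev_tilde s \<Omega>" for U
      using that by (simp add: sobolev_tilde_def norm_closure_def)
    have "?R ` sobolev_tilde s \<Omega> = sobolev_on_0 s \<Omega>"
    proof (intro equalityI subsetI)
      fix u assume "u \<in> ?R ` sobolev_tilde s \<Omega>"
      then obtain U where U: "U \<in> sobolev_tilde s \<Omega>" "u = ?R U" by blast
      have "\<exists>a\<in>(\<lambda>\<phi>. ?R (regular_dist \<phi>)) ` test_functions \<Omega>. sobolev_on_norm s \<Omega> (\<lambda>\<psi>. u \<psi> - a \<psi>) < \<epsilon>"
        if e: "0 < \<epsilon>" for \<epsilon>
      proof -
        obtain \<phi> where \<phi>: "\<phi> \<in> test_functions \<Omega>" "sobolev_norm s (\<lambda>\<psi>. U \<psi> - regular_dist \<phi> \<psi>) < \<epsilon>"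
          using U(1) e unfolding sobolev_tilde_def norm_closure_def by blast
        have "sobolev_on_norm s \<Omega> (\<lambda>\<psi>. u \<psi> - ?R (regular_dist \<phi>) \<psi>) < \<epsilon>"
          using sobolev_on_norm_le[OF \<Omega> sobolev_diff[OF tilde_sob[OF U(1)] sob[OF \<phi>(1)]]] \<phi>(2)
          unfolding restrict_dist_diff U(2) by linarith
        then show ?thesis using \<phi>(1) by blast
      qed
      then show "u \<in> sobolev_on_0 s \<Omega>"
        unfolding sobolev_on_0_def norm_closure_def
        using restrict_dist_sobolev_on[OF tilde_sob[OF U(1)]] U(2) by blast
    next
      fix u assume u: "u \<in> sobolev_on_0 s \<Omega>"
      then obtain U where "U \<in> sobolev s" "u = ?R U"
        unfolding sobolev_on_0_def norm_closure_def sobolev_on_def by blast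
      \<comment> \<open>Restriction is isometric on the complement, which contains the differences
        of \<open>U0\<close> and test functions, so approximations on \<Omega> lift to the whole
        space.\<close>
      then obtain U0 where U0: "U0 \<in> sobolev_orth s (sobolev_supported s (- \<Omega>))" "?R U0 = u"
        using orth_extension[OF \<Omega>] by metis
      have "\<exists>a\<in>?D. sobolev_norm s (\<lambda>\<psi>. U0 \<psi> - a \<psi>) < \<epsilon>" if e: "0 < \<epsilon>" for \<epsilon>
      proof -
        obtain \<phi> where \<phi>: "\<phi> \<in> test_functions \<Omega>" "sobolev_on_norm s \<Omega> (\<lambda>\<psi>. u \<psi> - ?R (regular_dist \<phi>) \<psi>) < \<epsilon>"
          using u e unfolding sobolev_on_0_def norm_closure_def by blast
        have "regular_dist \<phi> \<in> sobolev_orth s (sobolev_supported s (- \<Omega>))" using D \<phi>(1) by blast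
        from orth_norm[OF \<Omega> orth_diff[OF \<Omega> U0(1) this]]
        have "sobolev_norm s (\<lambda>\<psi>. U0 \<psi> - regular_dist \<phi> \<psi>) < \<epsilon>"
          using \<phi>(2) unfolding restrict_dist_diff U0(2) by simp
        then show ?thesis using \<phi>(1) by blast
      qed
      then have "U0 \<in> sobolev_tilde s \<Omega>"
        unfolding sobolev_tilde_def norm_closure_def using U0(1) by (simp add: sobolev_orth_def)
      then show "u \<in> ?R ` sobolev_tilde s \<Omega>" using U0(2) by blast
    qed
    then show ?thesis
      unfolding unitary_iso_def using restrict_dist_lincomb orth_norm[OF \<Omega> tilde] by blast
  qed
  ultimately show ?thesis using ii iii by blast
qed

end
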